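(* Let $y_0=(y_{10},y_{20})^\top\in\mathbb R^2$ with $y_{10}\ne1$, and let $(\bar t,\bar y(\cdot),\bar u(\cdot))$ be an optimal classical triple of the time optimal control Problem (T) described in the context. Then $$\bar y_2(\bar t)\ge0,$$ and there exists a nontrivial solution $\bar\psi(\cdot)\in C([0,\bar t);\mathbb R^2)$ of $$\frac{d\bar\psi(t)}{dt}=-\begin{pmatrix}\dfrac{\bar y_2(t)}{(1-\bar y_1(t))^2}&1\\[2mm] \dfrac1{1-\bar y_1(t)}&1\end{pmatrix}\bar\psi(t),\qquad t\in[0,\bar t),$$ such that $$\langle\bar\psi(t),B(t)\bar u(t)\rangle=\max_{|u|\le\rho_0}\langle\bar\psi(t),B(t)u\rangle\qquad\text{for a.e. }t\in[0,\bar t).$$ Moreover, if $\bar y_2(\bar t)>0$, then $\lim_{t\to\bar t^-}\bar\psi(t)=0$.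
   Context: Let $n=2$, $\rho_0>0$, $Q=\{(x_1,x_2)^\top\in\mathbb R^2:x_1=1\}$, $U=\{u\in\mathbb R^2:|u|\le\rho_0\}$, $B(\cdot)\in L^\infty([0,+\infty);\mathbb R^{2\times2})$, and $$f(t,y,u)=\begin{pmatrix}\dfrac{y_2}{1-y_1}\\ y_1+y_2\end{pmatrix}+B(t)u,\qquad t\ge0,\ y=(y_1,y_2)^\top\in\mathbb R^2\setminus Q,\ u\in U.$$ $\mathcal U$ is the set of measurable $u(\cdot):[0,+\infty)\to U$. $\mathcal P$ is the set of triples $(T,y(\cdot),u(\cdot))\in(0,+\infty)\times C([0,T);\mathbb R^2)\times\mathcal U$ such that $y(t)\notin Q$ and $y(t)=y_0+\int_0^tf(s,y(s),u(s))\,ds$ for all $t\in[0,T)$. $\mathcal P_{ad}$ is the set of $(T,y(\cdot),u(\cdot))\in\mathcal P$ with $\liminf_{s\to T^-}d(y(s),Q)=0$, where $d(\cdot,Q)$ is Euclidean distance to $Q$. Problem (T): find $(\bar t,\bar y(\cdot),\bar u(\cdot))\in\mathcal P_{ad}$ with $\bar t=\inf\{T:(T,y(\cdot),u(\cdot))\in\mathcal P_{ad}\}$; such a triple is called an optimal classical triple. $\bar y_2(\bar t)$ denotes $\lim_{t\to\bar t^-}\bar y_2(t)$. *)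

theory Defs
  imports "HOL-Analysis.Analysis"
begin

definition Q :: "(real^2) set" where
  "Q = {x. x $ 1 = 1}"

definition U :: "real \<Rightarrow> (real^2) set" where
  "U \<rho>\<^sub>0 = {u. norm u \<le> \<rho>\<^sub>0}"

definition f :: "(real \<Rightarrow> real^2^2) \<Rightarrow> real \<Rightarrow> real^2 \<Rightarrow> real^2 \<Rightarrow> real^2" where
  "f B t y u = vector [y $ 2 / (1 - y $ 1), y $ 1 + y $ 2] + B t *v u"

definition Linfty :: "(real \<Rightarrow> real^2^2) \<Rightarrow> bool" where
  "Linfty B \<longleftrightarrow> B \<in> borel_measurable (lebesgue_on {0..}) \<and>
     (\<exists>C. AE t in lebesgue_on {0..}. norm (B t) \<le> C)"

definition controls :: "real \<Rightarrow> (real \<Rightarrow> real^2) set" where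
  "controls \<rho>\<^sub>0 = {u \<in> borel_measurable (lebesgue_on {0..}). \<forall>t\<ge>0. u t \<in> U \<rho>\<^sub>0}"

text \<open>
  A function on \<open>[0, T)\<close> is represented by a total function whose values outside \<open>[0, T)\<close>
  are irrelevant. Integrability is listed because the Bochner integral of a non-integrable function
  is \<open>0\<close> by convention; for continuous \<open>y\<close> avoiding \<open>Q\<close>, \<open>u\<close> in \<open>controls\<close> and essentially bounded
  \<open>B\<close> it holds automatically.
\<close>
definition triples ::
  "real \<Rightarrow> (real \<Rightarrow> real^2^2) \<Rightarrow> real^2 \<Rightarrow> (real \<times> (real \<Rightarrow> real^2) \<times> (real \<Rightarrow> real^2)) set" where
  "triples \<rho>\<^sub>0 B y\<^sub>0 = {(T, y, u). 0 < T \<and> continuous_on {0..<T} y \<and> u \<in> controls \<rho>\<^sub>0 \<and>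
     (\<forall>t\<in>{0..<T}. y t \<notin> Q \<and>
        set_integrable lebesgue {0..t} (\<lambda>s. f B s (y s) (u s)) \<and>
        y t = y\<^sub>0 + (LINT s:{0..t}|lebesgue. f B s (y s) (u s)))}"

definition admissible_triples ::
  "real \<Rightarrow> (real \<Rightarrow> real^2^2) \<Rightarrow> real^2 \<Rightarrow> (real \<times> (real \<Rightarrow> real^2) \<times> (real \<Rightarrow> real^2)) set" where
  "admissible_triples \<rho>\<^sub>0 B y\<^sub>0 = {(T, y, u) \<in> triples \<rho>\<^sub>0 B y\<^sub>0.
     Liminf (at_left T) (\<lambda>s. ereal (infdist (y s) Q)) = 0}"

definition optimal_classical_triple ::
  "real \<Rightarrow> (real \<Rightarrow> real^2^2) \<Rightarrow> real^2 \<Rightarrow> real \<times> (real \<Rightarrow> real^2) \<times> (real \<Rightarrow> real^2) \<Rightarrow> bool" where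
  "optimal_classical_triple \<rho>\<^sub>0 B y\<^sub>0 p \<longleftrightarrow> p \<in> admissible_triples \<rho>\<^sub>0 B y\<^sub>0 \<and>
     fst p = Inf {T. \<exists>y u. (T, y, u) \<in> admissible_triples \<rho>\<^sub>0 B y\<^sub>0}"

definition adjoint_matrix :: "real^2 \<Rightarrow> real^2^2" where
  "adjoint_matrix y = vector [vector [y $ 2 / (1 - y $ 1)\<^sup>2, 1], vector [1 / (1 - y $ 1), 1]]"

definition is_maximum :: "real set \<Rightarrow> real \<Rightarrow> bool" where
  "is_maximum S m \<longleftrightarrow> m \<in> S \<and> (\<forall>x\<in>S. x \<le> m)"

end

theory Submission imports Defs begin

text \<open>
  Let \<open>\<sigma>\<close> be the sign of \<open>1 - y\<^sub>1\<close> and put \<open>z = \<bar>1 - y\<^sub>1\<bar>\<close>, \<open>v = y\<^sub>2\<close>, \<open>(c1, c2) = (-\<sigma> (B u)\<^sub>1, (B u)\<^sub>2)\<close>.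
  The system becomes \<open>z' = -v/z + c1\<close>, \<open>v' = 1 - \<sigma> z + v + c2\<close>, and \<open>z\<^sup>2\<close> has the derivative
  \<open>-2 v + 2 c1 z\<close>, in which the singularity has disappeared. So a trajectory can only stop to exist by
  quenching (\<open>solves_or_quenches\<close>), \<open>z\<^sup>2\<close> and \<open>v\<close> are Lipschitz up to the quenching time
  \<open>tb\<close>, and \<open>v tb \<ge> 0\<close>, as otherwise \<open>z\<close> would increase near \<open>tb\<close> (\<open>v_end_nonneg\<close>). By
  optimality, every control has a trajectory on the whole of \<open>[0, tb)\<close>.

  The maximum principle is obtained at a time \<open>T < tb\<close> first, and then \<open>T \<rightarrow> tb\<close>. Suppose that some
  trajectory is at time \<open>T\<close> so much ahead of the optimal one that, with the optimal control from \<open>T\<close>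
  on, it would quench before \<open>tb\<close>: this is impossible. The states that are ahead contain an open
  convex cone of displacements \<open>(\<delta>z, \<delta>v)\<close>. Convex perturbations of the control before \<open>T\<close> move the
  state at \<open>T\<close> by a linear expression in the perturbation, up to second order (\<open>linearization\<close>), and
  these first variations form a convex set, since the control enters linearly and \<open>U\<close> is convex. The
  set cannot meet the cone, and a separating functional is the terminal value at \<open>T\<close> of a solution
  of the adjoint equation for which no control has a positive variation (\<open>stationary_at\<close>). After
  normalisation at time \<open>0\<close>, these solutions have a limit point as \<open>T \<rightarrow> tb\<close>
  (\<open>limit_multiplier\<close>).

  What remains is to exhibit the cones. Write \<open>d\<close> and \<open>e\<close> for the leads in \<open>z\<close> and \<open>v\<close>, and \<open>s\<close> for
  the remaining time. For \<open>\<sigma> = 1\<close> the system is cooperative and \<open>d > 0\<close>, \<open>e > 0\<close> suffice. For \<open>\<sigma> = -1\<close>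
  a lead in \<open>z\<close> diminishes the lead in \<open>v\<close>, and solutions may oscillate around one another. Here
  optimality is used a second time: since switching the control to zero never leads to quenching
  before \<open>tb\<close>, \<open>v\<close> cannot be large in comparison with \<open>z\<^sup>2 / s\<close> (\<open>zero_control_bound\<close>), and this
  makes the cone \<open>d > 0\<close>, \<open>e > 4 s d\<close> invariant near \<open>tb\<close> if \<open>v tb = 0\<close>. Finally, if \<open>v tb > 0\<close>, then
  \<open>z\<close> is at least of order \<open>\<surd>s\<close>, so that the linearised equations have integrable coefficients in
  the variables \<open>(z\<^sup>2, v)\<close>, and the cone may be taken so wide that it opens to a half plane as
  \<open>T \<rightarrow> tb\<close>. This forces the limit of the adjoint solutions to vanish at \<open>tb\<close>
  (\<open>extremal_adjoint_transversal\<close>).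
\<close>

section \<open>Primitives of bounded functions\<close>

text \<open>
  Absolute continuity of \<open>x\<close> with bounded derivative \<open>g\<close>, in terms of the Henstock-Kurzweil
  integral. Controls are only measurable, so \<open>x\<close> need not be differentiable at every point; all
  estimates on trajectories are made on such pairs \<open>(x, g)\<close>.
\<close>
definition bounded_primitive :: "(real \<Rightarrow> real) \<Rightarrow> (real \<Rightarrow> real) \<Rightarrow> real \<Rightarrow> real \<Rightarrow> bool" where
  "bounded_primitive x g a b \<longleftrightarrow> (\<exists>M. \<forall>t\<in>{a..b}. \<bar>g t\<bar> \<le> M) \<and>
     (\<forall>s t. a \<le> s \<longrightarrow> s \<le> t \<longrightarrow> t \<le> b \<longrightarrow> (g has_integral (x t - x s)) {s..t})"

lemma bounded_primitiveI:
  assumes "\<And>t. a \<le> t \<Longrightarrow> t \<le> b \<Longrightarrow> \<bar>g t\<bar> \<le> M"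
    and "\<And>s t. a \<le> s \<Longrightarrow> s \<le> t \<Longrightarrow> t \<le> b \<Longrightarrow> (g has_integral (x t - x s)) {s..t}"
  shows "bounded_primitive x g a b"
  unfolding bounded_primitive_def using assms by (intro conjI exI[of _ M]) auto

lemma bounded_primitive_bound:
  assumes "bounded_primitive x g a b"
  obtains M where "M > 0" "\<And>t. a \<le> t \<Longrightarrow> t \<le> b \<Longrightarrow> \<bar>g t\<bar> \<le> M"
proof -
  obtain M where M: "\<forall>t\<in>{a..b}. \<bar>g t\<bar> \<le> M" using assms unfolding bounded_primitive_def by auto
  have "\<bar>g t\<bar> \<le> max M 1" if "a \<le> t" "t \<le> b" for t
    using bspec[OF M, of t] that by (simp add: le_max_iff_disj)
  then show ?thesis by (intro that[of "max M 1"]) simp_all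
qed

lemma bounded_primitive_has_integral:
  "bounded_primitive x g a b \<Longrightarrow> a \<le> s \<Longrightarrow> s \<le> t \<Longrightarrow> t \<le> b \<Longrightarrow> (g has_integral (x t - x s)) {s..t}"
  unfolding bounded_primitive_def by auto

lemma bounded_primitive_lipschitz:
  assumes "bounded_primitive x g a b" and M: "\<And>t. a \<le> t \<Longrightarrow> t \<le> b \<Longrightarrow> \<bar>g t\<bar> \<le> M" "M \<ge> 0"
    and "s \<in> {a..b}" "t \<in> {a..b}"
  shows "\<bar>x t - x s\<bar> \<le> M * \<bar>t - s\<bar>"
proof -
  have *: "\<bar>x t - x s\<bar> \<le> M * (t - s)" if "a \<le> s" "s \<le> t" "t \<le> b" for s t
  proof -
    have "(g has_integral (x t - x s)) (cbox s t)"
      using bounded_primitive_has_integral[OF assms(1) that] by simp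
    then show ?thesis using has_integral_bound[of M g "x t - x s" s t] M that by auto
  qed
  show ?thesis using *[of s t] *[of t s] assms(4,5) by (cases "s \<le> t") (auto simp: abs_minus_commute)
qed

lemma bounded_primitive_continuous:
  assumes "bounded_primitive x g a b"
  shows "continuous_on {a..b} x"
proof -
  obtain M where M: "M > 0" "\<And>t. a \<le> t \<Longrightarrow> t \<le> b \<Longrightarrow> \<bar>g t\<bar> \<le> M"
    using bounded_primitive_bound[OF assms] by blast
  have "M-lipschitz_on {a..b} x"
    using bounded_primitive_lipschitz[OF assms M(2)] M(1)
    by (intro lipschitz_onI) (auto simp: dist_real_def)
  then show ?thesis by (rule lipschitz_on_continuous_on)
qed

lemma bounded_primitive_subinterval:
  assumes "bounded_primitive x g a b" "a \<le> a'" "b' \<le> b"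
  shows "bounded_primitive x g a' b'"
proof -
  obtain M where "\<And>t. a \<le> t \<Longrightarrow> t \<le> b \<Longrightarrow> \<bar>g t\<bar> \<le> M"
    using bounded_primitive_bound[OF assms(1)] by blast
  then show ?thesis
    using assms(2,3)
    by (intro bounded_primitiveI[where M=M] bounded_primitive_has_integral[OF assms(1)]) auto
qed

lemma bounded_primitive_cong:
  assumes "bounded_primitive x g a b"
    and "\<And>t. a \<le> t \<Longrightarrow> t \<le> b \<Longrightarrow> x' t = x t" "\<And>t. a \<le> t \<Longrightarrow> t \<le> b \<Longrightarrow> g' t = g t"
  shows "bounded_primitive x' g' a b"
proof -
  obtain M where M: "\<And>t. a \<le> t \<Longrightarrow> t \<le> b \<Longrightarrow> \<bar>g t\<bar> \<le> M"
    using bounded_primitive_bound[OF assms(1)] by blast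
  show ?thesis
  proof (rule bounded_primitiveI[where M=M])
    fix s t :: real assume st: "a \<le> s" "s \<le> t" "t \<le> b"
    have "(g' has_integral (x t - x s)) {s..t}"
      by (rule has_integral_eq[OF _ bounded_primitive_has_integral[OF assms(1) st]])
         (use assms(3) st in auto)
    then show "(g' has_integral (x' t - x' s)) {s..t}" using assms(2)[of t] assms(2)[of s] st by simp
  next
    fix t assume "a \<le> t" "t \<le> b"
    then show "\<bar>g' t\<bar> \<le> M" using M[of t] assms(3)[of t] by simp
  qed
qed

lemma bounded_primitive_add:
  assumes "bounded_primitive x g a b" "bounded_primitive y h a b"
  shows "bounded_primitive (\<lambda>t. x t + y t) (\<lambda>t. g t + h t) a b"
proof -
  obtain M where M: "\<And>t. a \<le> t \<Longrightarrow> t \<le> b \<Longrightarrow> \<bar>g t\<bar> \<le> M"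
    using bounded_primitive_bound[OF assms(1)] by blast
  obtain N where N: "\<And>t. a \<le> t \<Longrightarrow> t \<le> b \<Longrightarrow> \<bar>h t\<bar> \<le> N"
    using bounded_primitive_bound[OF assms(2)] by blast
  show ?thesis
  proof (rule bounded_primitiveI[where M="M+N"])
    fix s t :: real assume st: "a \<le> s" "s \<le> t" "t \<le> b"
    show "((\<lambda>t. g t + h t) has_integral (x t + y t - (x s + y s))) {s..t}"
      using has_integral_add[OF bounded_primitive_has_integral[OF assms(1) st]
          bounded_primitive_has_integral[OF assms(2) st]]
      by (simp add: algebra_simps)
  next
    fix t assume "a \<le> t" "t \<le> b"
    then show "\<bar>g t + h t\<bar> \<le> M + N" using M[of t] N[of t] by linarith
  qed
qed

lemma bounded_primitive_cmult:
  assumes "bounded_primitive x g a b"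
  shows "bounded_primitive (\<lambda>t. k * x t) (\<lambda>t. k * g t) a b"
proof -
  obtain M where M: "\<And>t. a \<le> t \<Longrightarrow> t \<le> b \<Longrightarrow> \<bar>g t\<bar> \<le> M"
    using bounded_primitive_bound[OF assms(1)] by blast
  show ?thesis
  proof (rule bounded_primitiveI[where M="\<bar>k\<bar>*M"])
    fix s t :: real assume st: "a \<le> s" "s \<le> t" "t \<le> b"
    show "((\<lambda>t. k * g t) has_integral (k * x t - k * x s)) {s..t}"
      using has_integral_mult_right[OF bounded_primitive_has_integral[OF assms(1) st], of k]
      by (simp add: algebra_simps)
  next
    fix t assume "a \<le> t" "t \<le> b"
    then show "\<bar>k * g t\<bar> \<le> \<bar>k\<bar> * M" using M[of t] by (simp add: abs_mult mult_left_mono)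
  qed
qed

lemma bounded_primitive_diff:
  assumes "bounded_primitive x g a b" "bounded_primitive y h a b"
  shows "bounded_primitive (\<lambda>t. x t - y t) (\<lambda>t. g t - h t) a b"
  using bounded_primitive_add[OF assms(1) bounded_primitive_cmult[OF assms(2), of "-1"]] by simp

lemma bounded_primitive_of_derivative:
  assumes "\<And>t. t \<in> {a..b} \<Longrightarrow> (x has_real_derivative g t) (at t within {a..b})"
    and "continuous_on {a..b} g"
  shows "bounded_primitive x g a b"
proof -
  have "compact (g ` {a..b})" using assms(2) by (intro compact_continuous_image) auto
  then obtain M where M: "\<And>t. t \<in> {a..b} \<Longrightarrow> norm (g t) \<le> M"
    using compact_imp_bounded bounded_iff by (metis image_eqI)
  show ?thesis
  proof (rule bounded_primitiveI[where M=M])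
    fix s t :: real assume st: "a \<le> s" "s \<le> t" "t \<le> b"
    show "(g has_integral (x t - x s)) {s..t}"
    proof (rule fundamental_theorem_of_calculus[OF st(2)])
      fix u assume u: "u \<in> {s..t}"
      then have "(x has_real_derivative g u) (at u within {a..b})" using assms(1) st by auto
      then have "(x has_real_derivative g u) (at u within {s..t})"
        by (rule DERIV_subset) (use st in auto)
      then show "(x has_vector_derivative g u) (at u within {s..t})"
        by (simp add: has_real_derivative_iff_has_vector_derivative)
    qed
  qed (use M in auto)
qed

lemma bounded_primitive_const: "bounded_primitive (\<lambda>t. k) (\<lambda>t. 0) a b"
  by (rule bounded_primitive_of_derivative) auto

lemma bounded_primitive_mono:
  assumes "bounded_primitive x g a b" "a \<le> s" "s \<le> t" "t \<le> b" "\<And>u. s \<le> u \<Longrightarrow> u \<le> t \<Longrightarrow> 0 \<le> g u"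
  shows "x s \<le> x t"
  using has_integral_nonneg[OF bounded_primitive_has_integral[OF assms(1-4)]] assms(5) by auto

lemma integrable_continuous_mult_bounded:
  fixes g h :: "real \<Rightarrow> real"
  assumes "continuous_on {a..b} h" "g integrable_on {a..b}" "\<And>t. t \<in> {a..b} \<Longrightarrow> \<bar>g t\<bar> \<le> M"
  shows "(\<lambda>t. h t * g t) absolutely_integrable_on {a..b}"
proof (rule absolutely_integrable_bounded_measurable_product_real)
  show "g absolutely_integrable_on {a..b}"
    by (rule absolutely_integrable_integrable_bound[where g="\<lambda>_. M"]) (use assms in auto)
  show "h \<in> borel_measurable (lebesgue_on {a..b})"
    by (rule continuous_imp_measurable_on_sets_lebesgue[OF assms(1)]) auto
  show "bounded (h ` {a..b})"
    using assms(1) by (intro compact_imp_bounded compact_continuous_image) auto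
qed auto

text \<open>
  The usual chain rule for absolutely continuous functions needs differentiation almost everywhere.
  For bounded \<open>g\<close> it is elementary: the difference of the two sides increases by only
  \<open>o(\<bar>s - t\<bar>)\<close> over \<open>[s, t]\<close>, so it has derivative zero everywhere.
\<close>
lemma bounded_primitive_chain:
  assumes bp: "bounded_primitive x g a b"
    and der: "\<And>t. t \<in> {a..b} \<Longrightarrow> (\<phi> has_real_derivative \<phi>' (x t)) (at (x t))"
    and cont: "continuous_on (x ` {a..b}) \<phi>'"
  shows "bounded_primitive (\<lambda>t. \<phi> (x t)) (\<lambda>t. \<phi>' (x t) * g t) a b"
proof (cases "a \<le> b")
  case False
  then show ?thesis unfolding bounded_primitive_def by auto
next
  case True
  obtain M where M: "M > 0" "\<And>t. a \<le> t \<Longrightarrow> t \<le> b \<Longrightarrow> \<bar>g t\<bar> \<le> M"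
    using bounded_primitive_bound[OF bp] by blast
  have cx: "continuous_on {a..b} x" by (rule bounded_primitive_continuous[OF bp])
  have lip: "\<bar>x t - x s\<bar> \<le> M * \<bar>t - s\<bar>" if "s \<in> {a..b}" "t \<in> {a..b}" for s t
    using bounded_primitive_lipschitz[OF bp M(2) _ that] M(1) by auto
  let ?k = "\<lambda>t. \<phi>' (x t) * g t"
  have cphi': "continuous_on {a..b} (\<lambda>t. \<phi>' (x t))"
    using continuous_on_compose[OF cx cont] by (simp add: o_def)
  have gint: "g integrable_on {a..b}"
    using bounded_primitive_has_integral[OF bp order_refl True order_refl] by blast
  have "?k absolutely_integrable_on {a..b}"
    by (rule integrable_continuous_mult_bounded[OF cphi' gint, of M]) (use M in auto)
  then have kint: "?k integrable_on {a..b}" by (simp add: set_lebesgue_integral_eq_integral(1))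
  then have kint': "?k integrable_on {s..t}" if "a \<le> s" "t \<le> b" for s t
    by (rule integrable_on_subinterval) (use that in auto)
  define H where "H t = \<phi> (x t) - integral {a..t} ?k" for t
  have Hdiff: "H t - H s = \<phi> (x t) - \<phi> (x s) - integral {s..t} ?k"
    if "a \<le> s" "s \<le> t" "t \<le> b" for s t
    using Henstock_Kurzweil_Integration.integral_combine[OF that(1,2) kint'[OF order_refl that(3)]]
    by (simp add: H_def)
  have est: "\<exists>d>0. \<forall>u\<in>{a..b}. \<bar>u - t\<bar> < d \<longrightarrow> \<bar>H u - H t\<bar> \<le> e * \<bar>u - t\<bar>"
    if t: "t \<in> {a..b}" and e: "e > 0" for t e
  proof -
    define e1 where "e1 = e / (2 * M)"
    have e1: "e1 > 0" "e1 * M + e1 * M \<le> e" using e M(1) by (auto simp: e1_def)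
    have dd: "(\<phi> has_derivative (\<lambda>h. \<phi>' (x t) * h)) (at (x t))"
      using der[OF t] by (simp add: has_field_derivative_def)
    obtain d1 where d1: "d1 > 0"
      "\<And>y. \<bar>y - x t\<bar> < d1 \<Longrightarrow> \<bar>\<phi> y - \<phi> (x t) - \<phi>' (x t) * (y - x t)\<bar> \<le> e1 * \<bar>y - x t\<bar>"
      using dd[unfolded has_derivative_at_alt] e1(1) by fastforce
    obtain d2 where d2: "d2 > 0"
      "\<And>s. s \<in> {a..b} \<Longrightarrow> \<bar>s - t\<bar> < d2 \<Longrightarrow> \<bar>\<phi>' (x s) - \<phi>' (x t)\<bar> < e1"
      using cphi'[unfolded continuous_on_iff] t e1(1) by (fastforce simp: dist_real_def)
    define d where "d = min d2 (d1 / M)"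
    have d: "d > 0" using d1(1) d2(1) M(1) by (simp add: d_def)
    have main: "\<bar>\<phi> (x u) - \<phi> (x s) - integral {s..u} ?k\<bar> \<le> e * (u - s)"
      if su: "a \<le> s" "s \<le> u" "u \<le> b" "t = s \<or> t = u" "\<bar>u - s\<bar> < d" for s u
    proof -
      have I1: "((\<lambda>r. (\<phi>' (x r) - \<phi>' (x t)) * g r) has_integral
          (integral {s..u} ?k - \<phi>' (x t) * (x u - x s))) {s..u}"
        using has_integral_diff[OF integrable_integral[OF kint'[OF su(1,3)]]
            has_integral_mult_right[OF bounded_primitive_has_integral[OF bp su(1-3)], of "\<phi>' (x t)"]]
        by (simp add: algebra_simps)
      have "\<bar>integral {s..u} ?k - \<phi>' (x t) * (x u - x s)\<bar> \<le> e1 * M * (u - s)"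
      proof -
        have "norm ((\<phi>' (x r) - \<phi>' (x t)) * g r) \<le> e1 * M" if "r \<in> cbox s u" for r
        proof -
          have "\<bar>\<phi>' (x r) - \<phi>' (x t)\<bar> \<le> e1" using d2(2)[of r] that su d by (auto simp: d_def)
          then show ?thesis using M(2)[of r] that su e1(1) by (auto simp: abs_mult intro!: mult_mono)
        qed
        then show ?thesis
          using has_integral_bound[of "e1 * M" _ _ s u, OF _ I1[folded box_real(2)]] e1(1) M(1) su(2)
          by (simp add: content_real)
      qed
      moreover have "\<bar>\<phi> (x u) - \<phi> (x s) - \<phi>' (x t) * (x u - x s)\<bar> \<le> e1 * M * (u - s)"
      proof -
        have L: "\<bar>x u - x s\<bar> \<le> M * (u - s)" using lip[of s u] su by auto
        also have "\<dots> < M * d" using su M(1) by (auto)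
        also have "\<dots> \<le> d1" using M(1) by (simp add: d_def min_def field_simps)
        finally have L2: "\<bar>x u - x s\<bar> < d1" .
        have "\<bar>\<phi> (x u) - \<phi> (x s) - \<phi>' (x t) * (x u - x s)\<bar> \<le> e1 * \<bar>x u - x s\<bar>"
          using su(4)
        proof
          assume "t = s" then show ?thesis using d1(2)[of "x u"] L2 by auto
        next
          assume tu: "t = u"
          have *: "\<bar>A\<bar> = \<bar>B\<bar>" if "A = - B" for A B :: real using that by simp
          have "\<bar>\<phi> (x u) - \<phi> (x s) - \<phi>' (x t) * (x u - x s)\<bar>
              = \<bar>\<phi> (x s) - \<phi> (x t) - \<phi>' (x t) * (x s - x t)\<bar>"
            by (rule *) (simp add: tu algebra_simps)
          then show ?thesis using d1(2)[of "x s"] L2 tu by (auto simp: abs_minus_commute)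
        qed
        also have "\<dots> \<le> e1 * (M * (u - s))" using L e1(1) by (intro mult_left_mono) auto
        finally show ?thesis by (simp add: mult.assoc)
      qed
      ultimately have "\<bar>\<phi> (x u) - \<phi> (x s) - integral {s..u} ?k\<bar> \<le> (e1 * M + e1 * M) * (u - s)"
        by (simp add: algebra_simps)
      also have "\<dots> \<le> e * (u - s)" using e1(2) su(2) by (intro mult_right_mono) auto
      finally show ?thesis .
    qed
    show ?thesis
    proof (intro exI[of _ d] conjI ballI impI)
      fix u assume u: "u \<in> {a..b}" "\<bar>u - t\<bar> < d"
      show "\<bar>H u - H t\<bar> \<le> e * \<bar>u - t\<bar>"
      proof (cases "t \<le> u")
        case True
        then show ?thesis using main[of t u] Hdiff[of t u] u t by auto
      next
        case False
        then show ?thesis using main[of u t] Hdiff[of u t] u t by (auto simp: abs_minus_commute)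
      qed
    qed (use d in auto)
  qed
  have Hder: "(H has_derivative (\<lambda>h. 0)) (at t within {a..b})" if t: "t \<in> {a..b}" for t
    unfolding has_derivative_within_alt
  proof (intro conjI allI impI)
    fix e :: real assume "e > 0"
    then obtain d where "d > 0" "\<forall>u\<in>{a..b}. \<bar>u - t\<bar> < d \<longrightarrow> \<bar>H u - H t\<bar> \<le> e * \<bar>u - t\<bar>"
      using est[OF t] by blast
    then show "\<exists>d>0. \<forall>y\<in>{a..b}. norm (y - t) < d \<longrightarrow> norm (H y - H t - 0) \<le> e * norm (y - t)"
      by (intro exI[of _ d]) auto
  qed auto
  have Hconst: "H t = H s" if "s \<in> {a..b}" "t \<in> {a..b}" for s t
    using has_derivative_zero_constant[of "{a..b}" H] Hder that by (metis convex_real_interval(5))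
  obtain N where N: "\<And>t. t \<in> {a..b} \<Longrightarrow> norm (\<phi>' (x t)) \<le> N"
    using compact_imp_bounded[OF compact_continuous_image[OF cphi']] bounded_iff
    by (metis compact_Icc image_eqI)
  show ?thesis
  proof (rule bounded_primitiveI[where M="N*M"])
    fix s t assume st: "a \<le> s" "s \<le> t" "t \<le> b"
    have "integral {s..t} ?k = \<phi> (x t) - \<phi> (x s)"
      using Hdiff[OF st] Hconst[of s t] st by auto
    then show "(?k has_integral (\<phi> (x t) - \<phi> (x s))) {s..t}"
      using integrable_integral[OF kint'[OF st(1,3)]] by simp
  next
    fix t assume "a \<le> t" "t \<le> b"
    then show "\<bar>\<phi>' (x t) * g t\<bar> \<le> N * M"
      using N[of t] M(2)[of t] by (auto simp: abs_mult intro!: mult_mono)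
  qed
qed

text \<open>
  Polarisation reduces products to squares, which are a case of the chain rule.
\<close>
lemma bounded_primitive_mult:
  assumes "bounded_primitive x g a b" "bounded_primitive y h a b"
  shows "bounded_primitive (\<lambda>t. x t * y t) (\<lambda>t. g t * y t + x t * h t) a b"
proof -
  have sq: "bounded_primitive (\<lambda>t. (u t)\<^sup>2) (\<lambda>t. (2 * u t) * k t) a b"
    if "bounded_primitive u k a b" for u k
    by (rule bounded_primitive_chain[OF that, of "\<lambda>r. r\<^sup>2" "\<lambda>r. 2 * r"])
       (auto intro!: derivative_eq_intros continuous_intros)
  show ?thesis
    by (rule bounded_primitive_cong[OF bounded_primitive_cmult[OF bounded_primitive_diff[OF
            sq[OF bounded_primitive_add[OF assms]] sq[OF bounded_primitive_diff[OF assms]]], of "1/4"]])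
       (auto simp: power2_eq_square algebra_simps)
qed

lemma bounded_primitive_power2:
  assumes "bounded_primitive x g a b"
  shows "bounded_primitive (\<lambda>t. (x t)\<^sup>2) (\<lambda>t. 2 * x t * g t) a b"
  by (rule bounded_primitive_cong[OF bounded_primitive_mult[OF assms assms]])
     (auto simp: power2_eq_square algebra_simps)

text \<open>
  The derivative of \<open>X * exp (- \<kappa>)\<close> is not positive. Since \<open>X\<close> may have any sign, the lower
  estimates below are the same statement for \<open>- X\<close>.
\<close>
lemma Gronwall:
  assumes bp: "bounded_primitive X g a b" and "a \<le> b"
    and \<kappa>: "\<And>t. t \<in> {a..b} \<Longrightarrow> (\<kappa> has_real_derivative k t) (at t within {a..b})"
    and k: "continuous_on {a..b} k"
    and le: "\<And>t. t \<in> {a..b} \<Longrightarrow> g t \<le> k t * X t"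
  shows "X b \<le> X a * exp (\<kappa> b - \<kappa> a)"
proof -
  have c\<kappa>: "continuous_on {a..b} \<kappa>" using \<kappa> by (rule DERIV_continuous_on)
  have E: "bounded_primitive (\<lambda>t. exp (- \<kappa> t)) (\<lambda>t. - exp (- \<kappa> t) * k t) a b"
    by (rule bounded_primitive_of_derivative)
       (auto intro!: derivative_eq_intros \<kappa> continuous_intros k c\<kappa>)
  have P: "bounded_primitive (\<lambda>t. X t * exp (- \<kappa> t))
     (\<lambda>t. g t * exp (- \<kappa> t) + X t * (- exp (- \<kappa> t) * k t)) a b"
    by (rule bounded_primitive_mult[OF bp E])
  have "(-1) * (X a * exp (- \<kappa> a)) \<le> (-1) * (X b * exp (- \<kappa> b))"
  proof (rule bounded_primitive_mono[OF bounded_primitive_cmult[OF P, of "-1"]])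
    fix u assume "a \<le> u" "u \<le> b"
    then have "g u * exp (- \<kappa> u) \<le> (k u * X u) * exp (- \<kappa> u)" using le by (intro mult_right_mono) auto
    then show "0 \<le> - 1 * (g u * exp (- \<kappa> u) + X u * (- exp (- \<kappa> u) * k u))"
      by (simp add: algebra_simps)
  qed (use \<open>a \<le> b\<close> in auto)
  then have "X b * exp (- \<kappa> b) \<le> X a * exp (- \<kappa> a)" by simp
  then have "X b * exp (- \<kappa> b) * exp (\<kappa> b) \<le> X a * exp (- \<kappa> a) * exp (\<kappa> b)"
    by (rule mult_right_mono) auto
  then show ?thesis by (simp add: mult.assoc flip: exp_add)
qed

lemma Gronwall_lower:
  assumes bp: "bounded_primitive X g a b" and "a \<le> b"
    and "\<And>t. t \<in> {a..b} \<Longrightarrow> (\<kappa> has_real_derivative k t) (at t within {a..b})"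
    and "continuous_on {a..b} k"
    and le: "\<And>t. t \<in> {a..b} \<Longrightarrow> k t * X t \<le> g t"
  shows "X a * exp (\<kappa> b - \<kappa> a) \<le> X b"
  using Gronwall[OF bounded_primitive_cmult[OF bp, of "-1"] assms(2-4)] le by auto

lemma Gronwall_const:
  assumes "bounded_primitive X g a b" "a \<le> b" "\<And>t. t \<in> {a..b} \<Longrightarrow> g t \<le> K * X t"
  shows "X b \<le> X a * exp (K * (b - a))"
proof -
  have "X b \<le> X a * exp (K * b - K * a)"
    by (rule Gronwall[OF assms(1,2), of "\<lambda>t. K * t" "\<lambda>_. K"])
       (auto intro!: derivative_eq_intros assms(3))
  then show ?thesis by (simp add: algebra_simps)
qed

lemma Gronwall_lower_const:
  assumes "bounded_primitive X g a b" "a \<le> b" "\<And>t. t \<in> {a..b} \<Longrightarrow> K * X t \<le> g t"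
  shows "X a * exp (K * (b - a)) \<le> X b"
proof -
  have "X a * exp (K * b - K * a) \<le> X b"
    by (rule Gronwall_lower[OF assms(1,2), of "\<lambda>t. K * t" "\<lambda>_. K"])
       (auto intro!: derivative_eq_intros assms(3))
  then show ?thesis by (simp add: algebra_simps)
qed

lemma first_exit:
  fixes a b :: real
  assumes "a \<le> b" "closed S" "b \<in> S" "a \<notin> S"
  obtains t where "a < t" "t \<le> b" "t \<in> S" "\<And>s. a \<le> s \<Longrightarrow> s < t \<Longrightarrow> s \<notin> S"
proof -
  have "compact (S \<inter> {a..b})" using assms(2) by (simp add: closed_Int_compact)
  moreover have "S \<inter> {a..b} \<noteq> {}" using assms by auto
  ultimately obtain t where t: "t \<in> S \<inter> {a..b}" "\<forall>s\<in>S \<inter> {a..b}. t \<le> s"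
    using compact_attains_inf by blast
  have "a < t" using t(1) assms(4) by (cases "a = t") auto
  moreover have "s \<notin> S" if "a \<le> s" "s < t" for s
    using bspec[OF t(2), of s] that t(1) by auto
  ultimately show ?thesis using t(1) by (intro that[of t]) auto
qed

text \<open>
  A bound that implies a stricter one persists: at the first time at which the stricter one fails,
  the weaker one still holds by continuity.
\<close>
lemma continuity_bootstrap:
  fixes x :: "real \<Rightarrow> real"
  assumes "continuous_on {a..b} x" "a \<le> b" "x a < r"
    and step: "\<And>t. a \<le> t \<Longrightarrow> t \<le> b \<Longrightarrow> (\<And>s. a \<le> s \<Longrightarrow> s \<le> t \<Longrightarrow> x s \<le> r) \<Longrightarrow> x t < r"
  shows "x b < r"
proof (rule ccontr)
  assume "\<not> x b < r"
  let ?C = "{a..b} \<inter> x -` {r..}"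
  have cl: "closed ?C" by (rule continuous_closed_preimage[OF assms(1)]) auto
  have ab: "b \<in> ?C" "a \<notin> ?C" using \<open>\<not> x b < r\<close> assms by auto
  obtain t where t: "a < t" "t \<le> b" "t \<in> ?C" "\<And>s. a \<le> s \<Longrightarrow> s < t \<Longrightarrow> s \<notin> ?C"
    using first_exit[OF assms(2) cl ab] by metis
  have before: "x s < r" if "a \<le> s" "s < t" for s using t(4)[OF that] that t(2) by auto
  have "continuous_on {a..t} x" by (rule continuous_on_subset[OF assms(1)]) (use t in auto)
  then have "(x \<longlongrightarrow> x t) (at_left t)" by (rule continuous_on_Icc_at_leftD[OF _ t(1)])
  then have "x t \<le> r"
    by (rule tendsto_upperbound) (use t(1) before in \<open>auto intro!: eventually_at_leftI[of a] less_imp_le\<close>)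
  then have "x s \<le> r" if "a \<le> s" "s \<le> t" for s using before[of s] that by (cases "s = t") auto
  then have "x t < r" using step[of t] t by auto
  then show False using t(3) by auto
qed

text \<open>
  The positive quadrant is invariant under a flow that points inwards up to terms
  controlled by the distance to the boundary.
\<close>
lemma positive_pair_persists:
  assumes X: "bounded_primitive X g a b" and Y: "bounded_primitive Y h a b" and "a \<le> b"
    and pos: "0 < X a" "0 < Y a"
    and field: "\<And>t. a \<le> t \<Longrightarrow> t \<le> b \<Longrightarrow> (\<And>s. a \<le> s \<Longrightarrow> s \<le> t \<Longrightarrow> 0 \<le> X s \<and> 0 \<le> Y s) \<Longrightarrow>
        - K * X t \<le> g t \<and> - K * Y t \<le> h t"
  shows "0 < X b \<and> 0 < Y b"
proof -
  define m where "m t = - min (X t) (Y t)" for t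
  have cm: "continuous_on {a..b} m"
    unfolding m_def
    by (intro continuous_intros bounded_primitive_continuous[OF X] bounded_primitive_continuous[OF Y])
  have "m b < 0"
  proof (rule continuity_bootstrap[OF cm \<open>a \<le> b\<close>])
    show "m a < 0" using pos by (simp add: m_def)
    fix t assume t: "a \<le> t" "t \<le> b" and "\<And>s. a \<le> s \<Longrightarrow> s \<le> t \<Longrightarrow> m s \<le> 0"
    then have nn: "0 \<le> X s \<and> 0 \<le> Y s" if "a \<le> s" "s \<le> t" for s
      using that by (simp add: m_def)
    have f: "- K * X s \<le> g s \<and> - K * Y s \<le> h s" if "s \<in> {a..t}" for s
      using field[of s] nn that t by auto
    have "X a * exp (- K * (t - a)) \<le> X t"
      by (rule Gronwall_lower_const[OF bounded_primitive_subinterval[OF X order_refl t(2)]]) (use t f in auto)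
    moreover have "Y a * exp (- K * (t - a)) \<le> Y t"
      by (rule Gronwall_lower_const[OF bounded_primitive_subinterval[OF Y order_refl t(2)]]) (use t f in auto)
    moreover have "0 < X a * exp (- K * (t - a))" "0 < Y a * exp (- K * (t - a))" using pos by auto
    ultimately show "m t < 0" by (auto simp: m_def)
  qed
  then show ?thesis by (simp add: m_def)
qed

section \<open>Picard iteration\<close>

text \<open>
  The Lipschitz constant of \<open>G\<close> may blow up at the right end of \<open>[0, S)\<close>; the Picard
  iterates still converge locally uniformly there.
\<close>
lemma Picard_existence:
  fixes G :: "real \<Rightarrow> 'a::euclidean_space \<Rightarrow> 'a"
  assumes lip: "\<And>T. 0 \<le> T \<Longrightarrow> T < S \<Longrightarrow> \<exists>L. \<forall>t\<in>{0..T}. \<forall>x y. norm (G t x - G t y) \<le> L * norm (x - y)"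
    and int: "\<And>T x. 0 \<le> T \<Longrightarrow> T < S \<Longrightarrow> continuous_on {0..T} x \<Longrightarrow> (\<lambda>s. G s (x s)) integrable_on {0..T}"
  shows "\<exists>x. \<forall>T. 0 \<le> T \<longrightarrow> T < S \<longrightarrow>
    continuous_on {0..T} x \<and> ((\<lambda>s. G s (x s)) has_integral (x T - x0)) {0..T}"
proof -
  define X where "X = rec_nat (\<lambda>_. x0) (\<lambda>n x t. x0 + integral {0..t} (\<lambda>s. G s (x s)))"
  have X0: "X 0 t = x0" and XS: "X (Suc n) t = x0 + integral {0..t} (\<lambda>s. G s (X n s))" for n t
    by (simp_all add: X_def)
  define x where "x t = x0 + (\<Sum>k. X (Suc k) t - X k t)" for t
  have tele: "x0 + (\<Sum>k<n. X (Suc k) t - X k t) = X n t" for n t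
    using sum_lessThan_telescope[of "\<lambda>k. X k t" n] by (simp add: X0)
  have main: "continuous_on {0..T} x \<and> ((\<lambda>s. G s (x s)) has_integral (x T - x0)) {0..T}"
    if T: "0 \<le> T" "T < S" for T
  proof -
    obtain L0 where L0: "\<forall>t\<in>{0..T}. \<forall>x y. norm (G t x - G t y) \<le> L0 * norm (x - y)"
      using lip[OF T] by blast
    define L where "L = max L0 1"
    have L: "L > 0" "norm (G t x - G t y) \<le> L * norm (x - y)" if "0 \<le> t" "t \<le> T" for t x y
    proof -
      have "norm (G t x - G t y) \<le> L0 * norm (x - y)" using L0 that by simp
      also have "\<dots> \<le> L * norm (x - y)" by (intro mult_right_mono) (auto simp: L_def)
      finally show "norm (G t x - G t y) \<le> L * norm (x - y)" .
    qed (simp add: L_def)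
    have Lpos: "L > 0" by (simp add: L_def)
    have cX: "continuous_on {0..T} (X n)" for n
    proof (induction n)
      case 0 then show ?case by (simp add: X0 cong: continuous_on_cong)
    next
      case (Suc n)
      have "continuous_on {0..T} (\<lambda>t. x0 + integral {0..t} (\<lambda>s. G s (X n s)))"
        by (intro continuous_intros indefinite_integral_continuous_1 int[OF T Suc])
      then show ?case by (simp add: XS cong: continuous_on_cong)
    qed
    have intX: "(\<lambda>s. G s (X n s)) integrable_on {0..t}" if "0 \<le> t" "t \<le> T" for n t
      by (rule integrable_on_subinterval[OF int[OF T cX[of n]]]) (use that in auto)
    have "compact ((\<lambda>t. X 1 t - X 0 t) ` {0..T})"
      by (intro compact_continuous_image continuous_intros cX) auto
    then obtain M where M: "\<And>t. t \<in> {0..T} \<Longrightarrow> norm (X 1 t - X 0 t) \<le> M"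
      using compact_imp_bounded bounded_iff by (metis (no_types, lifting) image_eqI)
    have est: "norm (X (Suc n) t - X n t) \<le> M * (L * t) ^ n / fact n" if "t \<in> {0..T}" for n t
      using that
    proof (induction n arbitrary: t)
      case 0 then show ?case using M by simp
    next
      case (Suc n)
      then have t: "0 \<le> t" "t \<le> T" by auto
      have "((\<lambda>s. G s (X (Suc n) s) - G s (X n s)) has_integral (X (Suc (Suc n)) t - X (Suc n) t)) {0..t}"
        using has_integral_diff[OF integrable_integral[OF intX[OF t, of "Suc n"]]
            integrable_integral[OF intX[OF t, of n]]] by (simp add: XS)
      moreover have "((\<lambda>s. L * (M * (L * s) ^ n / fact n)) has_integral
          (M * (L * t) ^ Suc n / fact (Suc n) - M * (L * 0) ^ Suc n / fact (Suc n))) {0..t}"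
      proof (rule fundamental_theorem_of_calculus[OF t(1)])
        fix s
        have "((\<lambda>s. M * (L * s) ^ Suc n / fact (Suc n)) has_real_derivative
          (M * (of_nat (Suc n) * (L * s) ^ n * L) / fact (Suc n))) (at s within {0..t})"
          by (auto intro!: derivative_eq_intros simp del: fact_Suc of_nat_Suc power_Suc)
        moreover have "M * (of_nat (Suc n) * (L * s) ^ n * L) / fact (Suc n) = L * (M * (L * s) ^ n / fact n)"
          by (simp add: field_simps del: of_nat_Suc)
        ultimately show "((\<lambda>s. M * (L * s) ^ Suc n / fact (Suc n)) has_vector_derivative
          L * (M * (L * s) ^ n / fact n)) (at s within {0..t})"
          by (simp only: has_real_derivative_iff_has_vector_derivative)
      qed
      moreover have "norm (G s (X (Suc n) s) - G s (X n s)) \<le> L * (M * (L * s) ^ n / fact n)"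
        if "s \<in> {0..t}" for s
      proof -
        have "norm (G s (X (Suc n) s) - G s (X n s)) \<le> L * norm (X (Suc n) s - X n s)"
          using L(2) that t by auto
        also have "\<dots> \<le> L * (M * (L * s) ^ n / fact n)"
          using Suc.IH[of s] that t Lpos by (intro mult_left_mono) auto
        finally show ?thesis .
      qed
      ultimately have "norm (integral {0..t} (\<lambda>s. G s (X (Suc n) s) - G s (X n s))) \<le>
          integral {0..t} (\<lambda>s. L * (M * (L * s) ^ n / fact n))"
        by (intro integral_norm_bound_integral) (auto simp: integrable_on_def)
      then show ?case
        using integral_unique[OF \<open>((\<lambda>s. G s (X (Suc n) s) - G s (X n s)) has_integral _) _\<close>]
          integral_unique[OF \<open>((\<lambda>s. L * (M * (L * s) ^ n / fact n)) has_integral _) _\<close>]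
        by simp
    qed
    have M0: "M \<ge> 0" using M[of 0] T norm_ge_zero order_trans by (metis atLeastAtMost_iff order_refl)
    have est2: "norm (X (Suc n) t - X n t) \<le> M * ((L * T) ^ n /\<^sub>R fact n)" if "t \<in> {0..T}" for n t
    proof -
      have "norm (X (Suc n) t - X n t) \<le> M * (L * t) ^ n / fact n" by (rule est[OF that])
      also have "\<dots> \<le> M * (L * T) ^ n / fact n"
        using that Lpos M0 by (intro divide_right_mono mult_left_mono power_mono) auto
      finally show ?thesis by (simp add: divide_inverse mult.commute mult.left_commute)
    qed
    have "uniform_limit {0..T} (\<lambda>n t. \<Sum>k<n. X (Suc k) t - X k t)
        (\<lambda>t. \<Sum>k. X (Suc k) t - X k t) sequentially"
      by (rule Weierstrass_m_test[OF est2]) (simp_all only: summable_mult summable_exp_generic)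
    then have "uniform_limit {0..T} (\<lambda>n t. x0 + (\<Sum>k<n. X (Suc k) t - X k t))
        (\<lambda>t. x0 + (\<Sum>k. X (Suc k) t - X k t)) sequentially"
      by (intro uniform_limit_intros)
    then have ul: "uniform_limit {0..T} X x sequentially"
      unfolding tele x_def[symmetric] .
    have cx: "continuous_on {0..T} x"
      by (rule uniform_limit_theorem[OF _ ul]) (simp_all add: cX)
    have intx: "(\<lambda>s. G s (x s)) integrable_on {0..T}" by (rule int[OF T cx])
    have "(\<lambda>n. integral {0..T} (\<lambda>s. G s (X n s))) \<longlonglongrightarrow> integral {0..T} (\<lambda>s. G s (x s))"
    proof (rule LIMSEQ_I)
      fix r :: real assume r: "r > 0"
      define e where "e = r / (L * T + 1)"
      have LT: "L * T + 1 > 0" using Lpos T by (simp add: add_nonneg_pos)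
      have e: "e > 0" using r LT by (simp add: e_def)
      obtain N where N: "\<And>n t. n \<ge> N \<Longrightarrow> t \<in> {0..T} \<Longrightarrow> norm (X n t - x t) < e"
        using uniform_limitD[OF ul e] unfolding eventually_sequentially dist_norm by blast
      have "norm (integral {0..T} (\<lambda>s. G s (X n s)) - integral {0..T} (\<lambda>s. G s (x s))) < r"
        if "n \<ge> N" for n
      proof -
        have "((\<lambda>s. G s (X n s) - G s (x s)) has_integral
          (integral {0..T} (\<lambda>s. G s (X n s)) - integral {0..T} (\<lambda>s. G s (x s)))) (cbox 0 T)"
          using has_integral_diff[OF integrable_integral[OF intX[OF T(1) order_refl, of n]]
              integrable_integral[OF intx]] by simp
        moreover have "norm (G s (X n s) - G s (x s)) \<le> L * e" if "s \<in> cbox 0 T" for s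
        proof -
          have "norm (G s (X n s) - G s (x s)) \<le> L * norm (X n s - x s)" using L(2) that by auto
          also have "\<dots> \<le> L * e" using N[OF \<open>n \<ge> N\<close>, of s] that Lpos by (intro mult_left_mono) auto
          finally show ?thesis .
        qed
        ultimately have "norm (integral {0..T} (\<lambda>s. G s (X n s)) - integral {0..T} (\<lambda>s. G s (x s)))
            \<le> L * e * measure lborel (cbox 0 T)"
          using Lpos e by (intro has_integral_bound) auto
        also have "\<dots> = L * T * e" using T by (simp add: content_real)
        also have "\<dots> < (L * T + 1) * e" using e by (simp add: algebra_simps)
        also have "\<dots> = r" using LT by (simp add: e_def)
        finally show ?thesis .
      qed
      then show "\<exists>N. \<forall>n\<ge>N. norm (integral {0..T} (\<lambda>s. G s (X n s)) - integral {0..T} (\<lambda>s. G s (x s))) < r"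
        by blast
    qed
    then have "(\<lambda>n. X (Suc n) T) \<longlonglongrightarrow> x0 + integral {0..T} (\<lambda>s. G s (x s))"
      unfolding XS by (intro tendsto_intros)
    moreover have "(\<lambda>n. X (Suc n) T) \<longlonglongrightarrow> x T"
      using tendsto_uniform_limitI[OF ul, of T] T by (intro LIMSEQ_Suc) auto
    ultimately have "x T = x0 + integral {0..T} (\<lambda>s. G s (x s))" by (rule LIMSEQ_unique[rotated])
    then show ?thesis using cx integrable_integral[OF intx] by simp
  qed
  show ?thesis using main by blast
qed

section \<open>The system in the variables z and v\<close>

definition forcing :: "real \<Rightarrow> (real \<Rightarrow> real) \<Rightarrow> bool" where
  "forcing \<beta> c \<longleftrightarrow> (\<forall>t\<ge>0. \<bar>c t\<bar> \<le> \<beta>) \<and> (\<forall>T\<ge>0. c integrable_on {0..T})"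

text \<open>
  The quenching system for the distance \<open>z\<close> to the line \<open>Q\<close>, with \<open>\<sigma> = 1\<close> to the left of \<open>Q\<close> and
  \<open>\<sigma> = - 1\<close> to the right of it. The interval is half open because \<open>1/z\<close> is unbounded near the
  quenching time.
\<close>
definition solves :: "real \<Rightarrow> (real \<Rightarrow> real) \<Rightarrow> (real \<Rightarrow> real) \<Rightarrow> real \<Rightarrow> (real \<Rightarrow> real) \<Rightarrow> (real \<Rightarrow> real) \<Rightarrow> bool" where
  "solves \<sigma> c1 c2 T z v \<longleftrightarrow> (\<forall>T'. 0 \<le> T' \<longrightarrow> T' < T \<longrightarrow> (\<forall>t\<in>{0..T'}. 0 < z t) \<and>
     bounded_primitive z (\<lambda>t. - v t / z t + c1 t) 0 T' \<and>
     bounded_primitive v (\<lambda>t. 1 - \<sigma> * z t + v t + c2 t) 0 T')"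

definition clamped_sqrt :: "real \<Rightarrow> real \<Rightarrow> real" where
  "clamped_sqrt \<eta> w = sqrt (max w (\<eta>\<^sup>2))"

text \<open>
  The equations of \<open>w = z\<^sup>2\<close> and \<open>v\<close>, with \<open>z\<close> replaced by a globally Lipschitz function of \<open>w\<close>
  that is correct where \<open>z \<ge> \<eta>\<close>.
\<close>
definition solves_clamped :: "real \<Rightarrow> real \<Rightarrow> (real \<Rightarrow> real) \<Rightarrow> (real \<Rightarrow> real) \<Rightarrow> real \<Rightarrow> (real \<Rightarrow> real) \<Rightarrow> (real \<Rightarrow> real) \<Rightarrow> bool" where
  "solves_clamped \<eta> \<sigma> c1 c2 T w v \<longleftrightarrow>
     bounded_primitive w (\<lambda>t. - 2 * v t + 2 * c1 t * clamped_sqrt \<eta> (w t)) 0 T \<and>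
     bounded_primitive v (\<lambda>t. 1 - \<sigma> * clamped_sqrt \<eta> (w t) + v t + c2 t) 0 T"

lemma forcing_nonneg: "forcing \<beta> c \<Longrightarrow> 0 \<le> \<beta>"
  unfolding forcing_def using abs_ge_zero order_trans by blast

lemma clamped_sqrt_lipschitz:
  assumes "\<eta> > 0"
  shows "\<bar>clamped_sqrt \<eta> a - clamped_sqrt \<eta> b\<bar> \<le> \<bar>a - b\<bar> / (2 * \<eta>)"
proof -
  define A where "A = max a (\<eta>\<^sup>2)"
  define B where "B = max b (\<eta>\<^sup>2)"
  have sA: "\<eta> \<le> sqrt A" "\<eta> \<le> sqrt B"
    using assms by (auto intro!: real_le_rsqrt simp: A_def B_def)
  have nn: "0 \<le> sqrt A + sqrt B" using sA assms by linarith
  have "A \<ge> 0" "B \<ge> 0" by (simp_all add: A_def B_def le_max_iff_disj)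
  then have "(sqrt A)\<^sup>2 = A" "(sqrt B)\<^sup>2 = B" by simp_all
  then have "(sqrt A - sqrt B) * (sqrt A + sqrt B) = A - B"
    by (simp add: algebra_simps power2_eq_square)
  then have "\<bar>sqrt A - sqrt B\<bar> * (sqrt A + sqrt B) = \<bar>A - B\<bar>"
    using abs_mult[of "sqrt A - sqrt B" "sqrt A + sqrt B"] nn by simp
  moreover have "\<bar>sqrt A - sqrt B\<bar> * (2 * \<eta>) \<le> \<bar>sqrt A - sqrt B\<bar> * (sqrt A + sqrt B)"
    using sA by (intro mult_left_mono) auto
  moreover have "\<bar>A - B\<bar> \<le> \<bar>a - b\<bar>" by (auto simp: A_def B_def max_def)
  ultimately have "\<bar>sqrt A - sqrt B\<bar> * (2 * \<eta>) \<le> \<bar>a - b\<bar>" by linarith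
  then show ?thesis using assms by (simp add: clamped_sqrt_def A_def B_def pos_le_divide_eq)
qed

lemma clamped_sqrt_id: "0 < z \<Longrightarrow> \<eta> \<le> z \<Longrightarrow> 0 < \<eta> \<Longrightarrow> clamped_sqrt \<eta> (z\<^sup>2) = z"
  by (simp add: clamped_sqrt_def max_absorb1 power_mono)

lemma continuous_on_clamped_sqrt [continuous_intros]:
  "continuous_on S w \<Longrightarrow> continuous_on S (\<lambda>t. clamped_sqrt \<eta> (w t))"
  unfolding clamped_sqrt_def by (intro continuous_intros)

lemma bounded_primitiveI_initial:
  assumes hi: "\<And>t. 0 \<le> t \<Longrightarrow> t \<le> T \<Longrightarrow> (g has_integral (x t - x0)) {0..t}"
    and bd: "\<And>t. 0 \<le> t \<Longrightarrow> t \<le> T \<Longrightarrow> \<bar>g t\<bar> \<le> M"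
  shows "bounded_primitive x g 0 T"
proof (rule bounded_primitiveI[OF bd])
  fix s t assume st: "0 \<le> s" "s \<le> t" "t \<le> T"
  have i: "g integrable_on {0..t}" using hi[of t] st by auto
  have "integral {0..s} g + integral {s..t} g = integral {0..t} g"
    by (rule Henstock_Kurzweil_Integration.integral_combine[OF st(1,2) i])
  then have "integral {s..t} g = x t - x s"
    using hi[of s] hi[of t] st by (auto dest!: integral_unique)
  moreover have "g integrable_on {s..t}" by (rule integrable_on_subinterval[OF i]) (use st in auto)
  ultimately show "(g has_integral x t - x s) {s..t}" by (metis integrable_integral)
qed auto

lemma continuous_on_Icc_bounded:
  fixes h :: "real \<Rightarrow> real"
  assumes "continuous_on {a..b} h"
  obtains M where "M \<ge> 0" "\<And>t. a \<le> t \<Longrightarrow> t \<le> b \<Longrightarrow> \<bar>h t\<bar> \<le> M"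
proof -
  have "bounded (h ` {a..b})" using assms by (intro compact_imp_bounded compact_continuous_image) auto
  then obtain M where M: "M > 0" "\<forall>y\<in>h ` {a..b}. norm y \<le> M" using bounded_pos by metis
  have "\<bar>h t\<bar> \<le> M" if "a \<le> t" "t \<le> b" for t
    using bspec[OF M(2), of "h t"] that by simp
  with M(1) show ?thesis by (intro that[of M]) auto
qed

lemma forcing_integrable:
  assumes "forcing \<beta> c" "0 \<le> a" shows "c integrable_on {a..b}"
proof (cases "a \<le> b")
  case True
  with assms have "c integrable_on {0..b}" unfolding forcing_def by auto
  then show ?thesis by (rule integrable_on_subinterval) (use assms in auto)
qed (simp add: integrable_on_empty)

lemma forcing_mult_integrable:
  assumes "forcing \<beta> c" "0 \<le> a" "continuous_on {a..b} h" shows "(\<lambda>t. c t * h t) integrable_on {a..b}"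
proof -
  have "(\<lambda>t. h t * c t) absolutely_integrable_on {a..b}"
    by (rule integrable_continuous_mult_bounded[OF assms(3) forcing_integrable[OF assms(1,2)], of \<beta>])
       (use assms in \<open>auto simp: forcing_def\<close>)
  then show ?thesis by (simp add: set_lebesgue_integral_eq_integral(1) mult.commute)
qed

lemma has_integral_Pair:
  fixes g h :: "real \<Rightarrow> real"
  assumes "(g has_integral I) S" "(h has_integral J) S"
  shows "((\<lambda>s. (g s, h s)) has_integral (I, J)) S"
proof -
  have 1: "((\<lambda>s. (g s, 0::real)) has_integral (I, 0)) S"
    using has_integral_linear[OF assms(1) bounded_linear_Pair[OF bounded_linear_ident bounded_linear_zero]]
    by (simp add: o_def)
  have 2: "((\<lambda>s. (0::real, h s)) has_integral (0, J)) S"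
    using has_integral_linear[OF assms(2) bounded_linear_Pair[OF bounded_linear_zero bounded_linear_ident]]
    by (simp add: o_def)
  show ?thesis using has_integral_add[OF 1 2] by simp
qed

lemma solves_clamped_exists:
  assumes c: "forcing \<beta> c1" "forcing \<beta> c2" and \<eta>: "\<eta> > 0"
  shows "\<exists>w v. w 0 = w0 \<and> v 0 = v0 \<and> solves_clamped \<eta> \<sigma> c1 c2 S w v"
proof (cases "0 \<le> S")
  case False
  then show ?thesis
    by (intro exI[of _ "\<lambda>_. w0"] exI[of _ "\<lambda>_. v0"])
       (auto simp: solves_clamped_def bounded_primitive_def)
next
  case True
  let ?r = "clamped_sqrt \<eta>"
  define G where "G t x = (- 2 * snd x + 2 * c1 t * ?r (fst x), 1 - \<sigma> * ?r (fst x) + snd x + c2 t)"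
    for t and x :: "real \<times> real"
  have "\<exists>x. \<forall>T. 0 \<le> T \<longrightarrow> T < S + 1 \<longrightarrow>
    continuous_on {0..T} x \<and> ((\<lambda>s. G s (x s)) has_integral (x T - (w0, v0))) {0..T}"
  proof (rule Picard_existence)
    fix T :: real assume T: "0 \<le> T"
    define L where "L = 2 + 2 * \<beta> / (2 * \<eta>) + \<bar>\<sigma>\<bar> / (2 * \<eta>) + 1"
    have "norm (G t x - G t y) \<le> L * norm (x - y)" if t: "t \<in> {0..T}" for t x y
    proof -
      have n1: "\<bar>fst x - fst y\<bar> \<le> norm (x - y)" "\<bar>snd x - snd y\<bar> \<le> norm (x - y)"
      proof -
        have "x - y = (fst x - fst y, snd x - snd y)" by (simp add: prod_eq_iff)
        then show "\<bar>fst x - fst y\<bar> \<le> norm (x - y)" "\<bar>snd x - snd y\<bar> \<le> norm (x - y)"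
          using norm_fst_le[of "fst x - fst y" "snd x - snd y"] norm_snd_le[of "snd x - snd y" "fst x - fst y"]
          by simp_all
      qed
      have r: "\<bar>?r (fst x) - ?r (fst y)\<bar> \<le> norm (x - y) / (2 * \<eta>)"
        using clamped_sqrt_lipschitz[OF \<eta>, of "fst x" "fst y"] n1(1) \<eta>
        by (meson divide_right_mono less_eq_real_def order_trans mult_nonneg_nonneg zero_le_numeral)
      have c1t: "\<bar>c1 t\<bar> \<le> \<beta>" using c t by (auto simp: forcing_def)
      have "norm (G t x - G t y) \<le> \<bar>fst (G t x - G t y)\<bar> + \<bar>snd (G t x - G t y)\<bar>"
        using norm_Pair_le[of "fst (G t x - G t y)" "snd (G t x - G t y)"]
        by (simp only: prod.collapse real_norm_def)
      also have "fst (G t x - G t y) = - 2 * (snd x - snd y) + 2 * c1 t * (?r (fst x) - ?r (fst y))"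
        by (simp add: G_def algebra_simps)
      also have "snd (G t x - G t y) = - \<sigma> * (?r (fst x) - ?r (fst y)) + (snd x - snd y)"
        by (simp add: G_def algebra_simps)
      also have "\<bar>- 2 * (snd x - snd y) + 2 * c1 t * (?r (fst x) - ?r (fst y))\<bar>
          \<le> 2 * norm (x - y) + 2 * \<beta> * (norm (x - y) / (2 * \<eta>))"
      proof -
        have "\<bar>2 * c1 t * (?r (fst x) - ?r (fst y))\<bar> \<le> 2 * \<beta> * (norm (x - y) / (2 * \<eta>))"
          unfolding abs_mult using c1t r by (intro mult_mono) auto
        moreover have "\<bar>- 2 * (snd x - snd y)\<bar> \<le> 2 * norm (x - y)" using n1(2) by simp
        ultimately show ?thesis by (intro order_trans[OF abs_triangle_ineq add_mono])
      qed
      also have "\<bar>- \<sigma> * (?r (fst x) - ?r (fst y)) + (snd x - snd y)\<bar>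
          \<le> \<bar>\<sigma>\<bar> * (norm (x - y) / (2 * \<eta>)) + norm (x - y)"
      proof -
        have "\<bar>- \<sigma> * (?r (fst x) - ?r (fst y))\<bar> \<le> \<bar>\<sigma>\<bar> * (norm (x - y) / (2 * \<eta>))"
          unfolding abs_mult abs_minus_cancel using r by (intro mult_left_mono) auto
        then show ?thesis using n1(2) by (intro order_trans[OF abs_triangle_ineq add_mono])
      qed
      finally show ?thesis by (simp add: L_def algebra_simps)
    qed
    then show "\<exists>L. \<forall>t\<in>{0..T}. \<forall>x y. norm (G t x - G t y) \<le> L * norm (x - y)" by blast
  next
    fix T :: real and x :: "real \<Rightarrow> real \<times> real"
    assume T: "0 \<le> T" and cx: "continuous_on {0..T} x"
    have "(\<lambda>s. - 2 * snd (x s) + c1 s * (2 * ?r (fst (x s)))) integrable_on {0..T}"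
    proof (rule integrable_add)
      show "(\<lambda>s. - 2 * snd (x s)) integrable_on {0..T}"
        by (intro integrable_continuous_interval continuous_intros cx)
      show "(\<lambda>s. c1 s * (2 * ?r (fst (x s)))) integrable_on {0..T}"
        by (intro forcing_mult_integrable[OF c(1)] continuous_intros cx) simp
    qed
    moreover have "(\<lambda>s. (1 - \<sigma> * ?r (fst (x s)) + snd (x s)) + c2 s) integrable_on {0..T}"
    proof (rule integrable_add)
      show "(\<lambda>s. 1 - \<sigma> * ?r (fst (x s)) + snd (x s)) integrable_on {0..T}"
        by (intro integrable_continuous_interval continuous_intros cx)
      show "c2 integrable_on {0..T}" by (rule forcing_integrable[OF c(2)]) simp
    qed
    ultimately obtain I J where
      "((\<lambda>s. - 2 * snd (x s) + c1 s * (2 * ?r (fst (x s)))) has_integral I) {0..T}"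
      "((\<lambda>s. (1 - \<sigma> * ?r (fst (x s)) + snd (x s)) + c2 s) has_integral J) {0..T}"
      unfolding integrable_on_def by blast
    from has_integral_Pair[OF this] have "(\<lambda>s. G s (x s)) integrable_on {0..T}"
      unfolding integrable_on_def G_def by (intro exI[of _ "(I, J)"]) (simp add: mult_ac)
    then show "(\<lambda>s. G s (x s)) integrable_on {0..T}" .
  qed
  then obtain x where x: "\<And>T. 0 \<le> T \<Longrightarrow> T < S + 1 \<Longrightarrow> continuous_on {0..T} x"
    "\<And>T. 0 \<le> T \<Longrightarrow> T < S + 1 \<Longrightarrow> ((\<lambda>s. G s (x s)) has_integral (x T - (w0, v0))) {0..T}"
    by blast
  have cx: "continuous_on {0..S} x" using x(1)[of S] True by simp
  define w where "w t = fst (x t)" for t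
  define v where "v t = snd (x t)" for t
  have cw: "continuous_on {0..S} w" "continuous_on {0..S} v"
    unfolding w_def v_def by (intro continuous_intros cx)+
  have c12: "\<bar>c1 t\<bar> \<le> \<beta>" "\<bar>c2 t\<bar> \<le> \<beta>" if "0 \<le> t" for t using c that by (auto simp: forcing_def)
  have "x 0 = (w0, v0)" using has_integral_unique[OF x(2)[of 0]] True by fastforce
  then have init: "w 0 = w0" "v 0 = v0" by (simp_all add: w_def v_def)
  have hw: "((\<lambda>t. - 2 * v t + 2 * c1 t * ?r (w t)) has_integral (w t - w0)) {0..t}"
    "((\<lambda>t. 1 - \<sigma> * ?r (w t) + v t + c2 t) has_integral (v t - v0)) {0..t}" if "0 \<le> t" "t \<le> S" for t
    using has_integral_linear[OF x(2)[of t] bounded_linear_fst] has_integral_linear[OF x(2)[of t] bounded_linear_snd] that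
    by (simp_all add: o_def G_def w_def v_def)
  have "continuous_on {0..S} (\<lambda>t. 2 * ?r (w t))" by (intro continuous_intros cw)
  from continuous_on_Icc_bounded[OF this] obtain R where R: "R \<ge> 0"
    "\<And>t. 0 \<le> t \<Longrightarrow> t \<le> S \<Longrightarrow> \<bar>2 * ?r (w t)\<bar> \<le> R" by blast
  obtain V where V: "\<And>t. 0 \<le> t \<Longrightarrow> t \<le> S \<Longrightarrow> \<bar>v t\<bar> \<le> V"
    using continuous_on_Icc_bounded[OF cw(2)] by blast
  have "continuous_on {0..S} (\<lambda>t. 1 - \<sigma> * ?r (w t) + v t)" by (intro continuous_intros cw)
  from continuous_on_Icc_bounded[OF this] obtain R2 where R2: 
    "\<And>t. 0 \<le> t \<Longrightarrow> t \<le> S \<Longrightarrow> \<bar>1 - \<sigma> * ?r (w t) + v t\<bar> \<le> R2" by blast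
  have "bounded_primitive w (\<lambda>t. - 2 * v t + 2 * c1 t * ?r (w t)) 0 S"
  proof (rule bounded_primitiveI_initial[OF hw(1), of S "2 * V + \<beta> * R"])
    fix t assume t: "0 \<le> t" "t \<le> S"
    have "\<bar>c1 t * (2 * ?r (w t))\<bar> \<le> \<beta> * R"
      unfolding abs_mult[of "c1 t"] using c12(1)[OF t(1)] R(2)[OF t] by (intro mult_mono) auto
    then show "\<bar>- 2 * v t + 2 * c1 t * ?r (w t)\<bar> \<le> 2 * V + \<beta> * R"
      using V[OF t] by (simp add: mult.left_commute mult.assoc)
  qed auto
  moreover have "bounded_primitive v (\<lambda>t. 1 - \<sigma> * ?r (w t) + v t + c2 t) 0 S"
  proof (rule bounded_primitiveI_initial[OF hw(2), of S "R2 + \<beta>"])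
    fix t assume t: "0 \<le> t" "t \<le> S"
    show "\<bar>1 - \<sigma> * ?r (w t) + v t + c2 t\<bar> \<le> R2 + \<beta>"
      using R2[OF t] c12(2)[OF t(1)] by linarith
  qed auto
  ultimately show ?thesis using init unfolding solves_clamped_def by blast
qed

lemma solves_clamped_unique:
  assumes c1: "forcing \<beta> c1" and \<eta>: "\<eta> > 0"
    and A: "solves_clamped \<eta> \<sigma> c1 c2 T w v" and B: "solves_clamped \<eta> \<sigma> c1 c2 T w' v'"
    and init: "w 0 = w' 0" "v 0 = v' 0" and t: "0 \<le> t" "t \<le> T"
  shows "w t = w' t \<and> v t = v' t"
proof -
  let ?r = "clamped_sqrt \<eta>"
  let ?dw = "\<lambda>t. w t - w' t" and ?dv = "\<lambda>t. v t - v' t"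
  let ?gw = "\<lambda>t. (- 2 * v t + 2 * c1 t * ?r (w t)) - (- 2 * v' t + 2 * c1 t * ?r (w' t))"
  let ?gv = "\<lambda>t. (1 - \<sigma> * ?r (w t) + v t + c2 t) - (1 - \<sigma> * ?r (w' t) + v' t + c2 t)"
  have W: "bounded_primitive ?dw ?gw 0 t"
    using bounded_primitive_diff[of w _ 0 T w'] bounded_primitive_subinterval[of _ _ 0 T 0 t] A B t
    unfolding solves_clamped_def by blast
  have V: "bounded_primitive ?dv ?gv 0 t"
    using bounded_primitive_diff[of v _ 0 T v'] bounded_primitive_subinterval[of _ _ 0 T 0 t] A B t
    unfolding solves_clamped_def by blast
  let ?N = "\<lambda>t. (?dw t)\<^sup>2 + (?dv t)\<^sup>2"
  have N: "bounded_primitive ?N (\<lambda>t. 2 * ?dw t * ?gw t + 2 * ?dv t * ?gv t) 0 t"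
    by (intro bounded_primitive_add bounded_primitive_power2 W V)
  define K where "K = 4 + 2 * \<beta> / \<eta> + \<bar>\<sigma>\<bar> / (2 * \<eta>)"
  have "?N t \<le> ?N 0 * exp (K * (t - 0))"
  proof (rule Gronwall_const[OF N t(1)])
    fix s assume "s \<in> {0..t}"
    then have b: "\<bar>c1 s\<bar> \<le> \<beta>" using c1 by (auto simp: forcing_def)
    define x y d where "x = ?dw s" and "y = ?dv s" and "d = ?r (w s) - ?r (w' s)"
    have d: "\<bar>d\<bar> \<le> \<bar>x\<bar> / (2 * \<eta>)" unfolding d_def x_def by (rule clamped_sqrt_lipschitz[OF \<eta>])
    have xy: "2 * (\<bar>x\<bar> * \<bar>y\<bar>) \<le> x\<^sup>2 + y\<^sup>2"
      using sum_squares_bound[of "\<bar>x\<bar>" "\<bar>y\<bar>"] by simp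
    have e: "2 * ?dw s * ?gw s + 2 * ?dv s * ?gv s = - 4 * (x * y) + 4 * (c1 s * (x * d)) + (- 2 * (\<sigma> * (y * d)) + 2 * y\<^sup>2)"
      by (simp add: x_def y_def d_def algebra_simps power2_eq_square)
    have "\<bar>x * d\<bar> \<le> x\<^sup>2 / (2 * \<eta>)"
    proof -
      have "\<bar>x * d\<bar> \<le> \<bar>x\<bar> * (\<bar>x\<bar> / (2 * \<eta>))" unfolding abs_mult using d by (intro mult_left_mono) auto
      then show ?thesis by (simp add: power2_eq_square)
    qed
    then have "\<bar>c1 s * (x * d)\<bar> \<le> \<beta> * (x\<^sup>2 / (2 * \<eta>))"
      unfolding abs_mult[of "c1 s"] using b by (intro mult_mono) auto
    also have "\<dots> \<le> \<beta> * ((x\<^sup>2 + y\<^sup>2) / (2 * \<eta>))"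
      using forcing_nonneg[OF c1] \<eta> by (intro mult_left_mono divide_right_mono) auto
    finally have "c1 s * (x * d) \<le> \<beta> * ((x\<^sup>2 + y\<^sup>2) / (2 * \<eta>))" by linarith
    then have e2: "4 * (c1 s * (x * d)) \<le> 2 * \<beta> / \<eta> * (x\<^sup>2 + y\<^sup>2)"
      using \<eta> by (simp add: field_simps)
    have "\<bar>y * d\<bar> \<le> \<bar>y\<bar> * (\<bar>x\<bar> / (2 * \<eta>))" unfolding abs_mult using d by (intro mult_left_mono) auto
    also have "\<dots> = (2 * (\<bar>x\<bar> * \<bar>y\<bar>)) / (4 * \<eta>)" by simp
    also have "\<dots> \<le> (x\<^sup>2 + y\<^sup>2) / (4 * \<eta>)" using xy \<eta> by (intro divide_right_mono) auto
    finally have "\<bar>\<sigma> * (y * d)\<bar> \<le> \<bar>\<sigma>\<bar> * ((x\<^sup>2 + y\<^sup>2) / (4 * \<eta>))"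
      unfolding abs_mult[of \<sigma>] by (intro mult_left_mono) auto
    then have "- (\<sigma> * (y * d)) \<le> \<bar>\<sigma>\<bar> * ((x\<^sup>2 + y\<^sup>2) / (4 * \<eta>))" by linarith
    then have e3: "- 2 * (\<sigma> * (y * d)) \<le> \<bar>\<sigma>\<bar> / (2 * \<eta>) * (x\<^sup>2 + y\<^sup>2)"
      using \<eta> by (simp add: field_simps)
    have e4: "- 4 * (x * y) \<le> 2 * (x\<^sup>2 + y\<^sup>2)"
      using xy abs_ge_minus_self[of "x * y"] by (simp add: abs_mult)
    have "2 * y\<^sup>2 \<le> 2 * (x\<^sup>2 + y\<^sup>2)" by simp
    then have "- 4 * (x * y) + 4 * (c1 s * (x * d)) + (- 2 * (\<sigma> * (y * d)) + 2 * y\<^sup>2) \<le> K * (x\<^sup>2 + y\<^sup>2)"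
      using e2 e3 e4 unfolding K_def by (simp only: distrib_right)
    then show "2 * ?dw s * ?gw s + 2 * ?dv s * ?gv s \<le> K * ?N s"
      unfolding e by (simp only: x_def y_def)
  qed
  then have "?N t \<le> 0" using init by simp
  then have "?N t = 0" by (meson add_nonneg_nonneg antisym zero_le_power2)
  then show ?thesis by (simp add: sum_power2_eq_zero_iff)
qed

lemma solvesD:
  assumes "solves \<sigma> c1 c2 T z v" "0 \<le> T'" "T' < T"
  shows "\<And>t. 0 \<le> t \<Longrightarrow> t \<le> T' \<Longrightarrow> 0 < z t"
    "bounded_primitive z (\<lambda>t. - v t / z t + c1 t) 0 T'"
    "bounded_primitive v (\<lambda>t. 1 - \<sigma> * z t + v t + c2 t) 0 T'"
  using assms unfolding solves_def by auto

lemma solves_imp_clamped: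
  assumes "solves \<sigma> c1 c2 T z v" "0 \<le> T'" "T' < T" "\<And>t. 0 \<le> t \<Longrightarrow> t \<le> T' \<Longrightarrow> \<eta> \<le> z t" "\<eta> > 0"
  shows "solves_clamped \<eta> \<sigma> c1 c2 T' (\<lambda>t. (z t)\<^sup>2) v"
  unfolding solves_clamped_def
proof
  note s = solvesD[OF assms(1-3)]
  have r: "clamped_sqrt \<eta> ((z t)\<^sup>2) = z t" if "0 \<le> t" "t \<le> T'" for t
    using clamped_sqrt_id[OF s(1)[OF that]] assms(4)[OF that] assms(5) by simp
  show "bounded_primitive (\<lambda>t. (z t)\<^sup>2) (\<lambda>t. - 2 * v t + 2 * c1 t * clamped_sqrt \<eta> ((z t)\<^sup>2)) 0 T'"
  proof (rule bounded_primitive_cong[OF bounded_primitive_power2[OF s(2)]])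
    fix t assume t: "0 \<le> t" "t \<le> T'"
    show "- 2 * v t + 2 * c1 t * clamped_sqrt \<eta> ((z t)\<^sup>2) = 2 * z t * (- v t / z t + c1 t)"
      using s(1)[OF t] by (simp add: r[OF t] field_simps)
  qed simp
  show "bounded_primitive v (\<lambda>t. 1 - \<sigma> * clamped_sqrt \<eta> ((z t)\<^sup>2) + v t + c2 t) 0 T'"
    by (rule bounded_primitive_cong[OF s(3)]) (simp_all add: r)
qed

lemma clamped_imp_bounded_primitive:
  assumes "solves_clamped \<eta> \<sigma> c1 c2 T w v" "\<And>t. 0 \<le> t \<Longrightarrow> t \<le> T \<Longrightarrow> \<eta>\<^sup>2 < w t" "\<eta> > 0"
  shows "bounded_primitive (\<lambda>t. sqrt (w t)) (\<lambda>t. - v t / sqrt (w t) + c1 t) 0 T"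
    "bounded_primitive v (\<lambda>t. 1 - \<sigma> * sqrt (w t) + v t + c2 t) 0 T"
proof -
  have r: "clamped_sqrt \<eta> (w t) = sqrt (w t)" if "0 \<le> t" "t \<le> T" for t
    using assms(2)[OF that] by (simp add: clamped_sqrt_def max_absorb1)
  have pos: "0 < w t" if "0 \<le> t" "t \<le> T" for t
    using assms(2)[OF that] by (meson le_less_trans zero_le_power2)
  show "bounded_primitive v (\<lambda>t. 1 - \<sigma> * sqrt (w t) + v t + c2 t) 0 T"
    by (rule bounded_primitive_cong[of v "\<lambda>t. 1 - \<sigma> * clamped_sqrt \<eta> (w t) + v t + c2 t"])
       (use assms(1) in \<open>simp_all add: solves_clamped_def r\<close>)
  have W: "bounded_primitive w (\<lambda>t. - 2 * v t + 2 * c1 t * clamped_sqrt \<eta> (w t)) 0 T"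
    using assms(1) by (simp add: solves_clamped_def)
  have "bounded_primitive (\<lambda>t. sqrt (w t))
      (\<lambda>t. inverse (sqrt (w t)) / 2 * (- 2 * v t + 2 * c1 t * clamped_sqrt \<eta> (w t))) 0 T"
  proof (rule bounded_primitive_chain[OF W, of sqrt "\<lambda>r. inverse (sqrt r) / 2"])
    show "continuous_on (w ` {0..T}) (\<lambda>r. inverse (sqrt r) / 2)"
      using pos by (intro continuous_intros) force+
  qed (use pos in \<open>auto intro!: DERIV_real_sqrt\<close>)
  then show "bounded_primitive (\<lambda>t. sqrt (w t)) (\<lambda>t. - v t / sqrt (w t) + c1 t) 0 T"
  proof (rule bounded_primitive_cong)
    fix t assume t: "0 \<le> t" "t \<le> T"
    show "- v t / sqrt (w t) + c1 t =
        inverse (sqrt (w t)) / 2 * (- 2 * v t + 2 * c1 t * clamped_sqrt \<eta> (w t))"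
      using pos[OF t] by (simp add: r[OF t] field_simps)
  qed simp
qed


lemma continuous_on_positive_bounded_below:
  fixes z :: "real \<Rightarrow> real"
  assumes "a \<le> b" "continuous_on {a..b} z" "\<And>t. a \<le> t \<Longrightarrow> t \<le> b \<Longrightarrow> 0 < z t"
  obtains m where "0 < m" "\<And>t. a \<le> t \<Longrightarrow> t \<le> b \<Longrightarrow> m \<le> z t"
proof -
  obtain u where "u \<in> {a..b}" "\<forall>t\<in>{a..b}. z u \<le> z t"
    using continuous_attains_inf[OF compact_Icc _ assms(2)] assms(1) by auto
  then show ?thesis using assms(3) by (intro that[of "z u"]) auto
qed

text \<open>
  Up to a time before quenching \<open>z\<close> is bounded away from \<open>0\<close>, so both solutions satisfy the same
  clamped system.
\<close>
lemma solves_unique: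
  assumes f: "forcing \<beta> c1" and s: "solves \<sigma> c1 c2 T z v" "solves \<sigma> c1' c2' T' z' v'"
    and init: "z 0 = z' 0" "v 0 = v' 0"
    and eq: "\<And>s. 0 \<le> s \<Longrightarrow> s \<le> t \<Longrightarrow> c1 s = c1' s \<and> c2 s = c2' s"
    and t: "0 \<le> t" "t < T" "t < T'"
  shows "z t = z' t \<and> v t = v' t"
proof -
  note A = solvesD[OF s(1) t(1,2)] and B = solvesD[OF s(2) t(1,3)]
  obtain m1 where m1: "0 < m1" "\<And>s. 0 \<le> s \<Longrightarrow> s \<le> t \<Longrightarrow> m1 \<le> z s"
    using continuous_on_positive_bounded_below[OF t(1) bounded_primitive_continuous[OF A(2)] A(1)] by blast
  obtain m2 where m2: "0 < m2" "\<And>s. 0 \<le> s \<Longrightarrow> s \<le> t \<Longrightarrow> m2 \<le> z' s"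
    using continuous_on_positive_bounded_below[OF t(1) bounded_primitive_continuous[OF B(2)] B(1)] by blast
  define \<eta> where "\<eta> = min m1 m2"
  have \<eta>: "\<eta> > 0" "\<And>s. 0 \<le> s \<Longrightarrow> s \<le> t \<Longrightarrow> \<eta> \<le> z s" "\<And>s. 0 \<le> s \<Longrightarrow> s \<le> t \<Longrightarrow> \<eta> \<le> z' s"
    using m1 m2 by (auto simp: \<eta>_def min_le_iff_disj)
  have C: "solves_clamped \<eta> \<sigma> c1 c2 t (\<lambda>t. (z t)\<^sup>2) v"
    by (rule solves_imp_clamped[OF s(1) t(1,2) \<eta>(2,1)])
  have D: "solves_clamped \<eta> \<sigma> c1' c2' t (\<lambda>t. (z' t)\<^sup>2) v'"
    by (rule solves_imp_clamped[OF s(2) t(1,3) \<eta>(3,1)])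
  have D': "solves_clamped \<eta> \<sigma> c1 c2 t (\<lambda>t. (z' t)\<^sup>2) v'"
    unfolding solves_clamped_def
  proof
    show "bounded_primitive (\<lambda>t. (z' t)\<^sup>2) (\<lambda>t. - 2 * v' t + 2 * c1 t * clamped_sqrt \<eta> ((z' t)\<^sup>2)) 0 t"
      by (rule bounded_primitive_cong[OF D[unfolded solves_clamped_def, THEN conjunct1]]) (simp_all add: eq)
    show "bounded_primitive v' (\<lambda>t. 1 - \<sigma> * clamped_sqrt \<eta> ((z' t)\<^sup>2) + v' t + c2 t) 0 t"
      by (rule bounded_primitive_cong[OF D[unfolded solves_clamped_def, THEN conjunct2]]) (simp_all add: eq)
  qed
  have "(z t)\<^sup>2 = (z' t)\<^sup>2 \<and> v t = v' t"
    by (rule solves_clamped_unique[OF f \<eta>(1) C D']) (use init t in auto)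
  then show ?thesis using A(1)[of t] B(1)[of t] t by (simp add: power2_eq_iff)
qed

text \<open>
  In the variables \<open>(z\<^sup>2, v)\<close> the system grows linearly, so a solution can only stop
  to exist by coming close to \<open>z = 0\<close>.  Clamping the square root at \<open>1/n\<close> gives global
  solutions; they agree as long as they stay above their clamping levels, and are glued together.
\<close>
lemma solves_or_quenches:
  assumes c: "forcing \<beta> c1" "forcing \<beta> c2" and z0: "z0 > 0" and S: "S > 0"
  obtains (global) z v where "solves \<sigma> c1 c2 S z v" "z 0 = z0" "v 0 = v0"
  | (quench) \<tau> z v where "0 < \<tau>" "\<tau> < S" "solves \<sigma> c1 c2 \<tau> z v" "z 0 = z0" "v 0 = v0"
      "\<And>c t0. c > 0 \<Longrightarrow> t0 < \<tau> \<Longrightarrow> \<exists>t. t0 < t \<and> 0 \<le> t \<and> t < \<tau> \<and> z t < c"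
proof -
  define \<eta> where "\<eta> n = 1 / real (Suc n)" for n
  have \<eta>: "\<eta> n > 0" for n by (simp add: \<eta>_def)
  have \<eta>_mono: "\<eta> m \<le> \<eta> n" if "n \<le> m" for n m using that by (simp add: \<eta>_def frac_le)
  have \<eta>_small: "\<exists>N. \<forall>n\<ge>N. \<eta> n < c" if c: "c > 0" for c
  proof -
    obtain N where "inverse (real (Suc N)) < c" using reals_Archimedean[OF c] by blast
    then show ?thesis using \<eta>_mono[of N]
      by (intro exI[of _ N]) (auto simp: \<eta>_def inverse_eq_divide intro: le_less_trans)
  qed
  have "\<forall>n. \<exists>p. fst p 0 = z0\<^sup>2 \<and> snd p 0 = v0 \<and> solves_clamped (\<eta> n) \<sigma> c1 c2 S (fst p) (snd p)"
    using solves_clamped_exists[OF c \<eta>, of "z0\<^sup>2" v0] by fastforce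
  then obtain p where p: "\<And>n. fst (p n) 0 = z0\<^sup>2" "\<And>n. snd (p n) 0 = v0"
    "\<And>n. solves_clamped (\<eta> n) \<sigma> c1 c2 S (fst (p n)) (snd (p n))" by metis
  define W where "W n = fst (p n)" for n
  define V where "V n = snd (p n)" for n
  have init: "W n 0 = z0\<^sup>2" "V n 0 = v0" and WV: "solves_clamped (\<eta> n) \<sigma> c1 c2 S (W n) (V n)" for n
    using p by (auto simp: W_def V_def)
  have sub: "solves_clamped (\<eta> n) \<sigma> c1 c2 t (W n) (V n)" if "t \<le> S" for n t
    using WV[of n] that bounded_primitive_subinterval[of _ _ 0 S 0 t]
    unfolding solves_clamped_def by auto
  have cW: "continuous_on {0..S} (W n)" for n
    using WV[of n] bounded_primitive_continuous unfolding solves_clamped_def by blast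
  \<comment> \<open>Up to time \<open>t\<close> the clamp has not taken effect in the \<open>n\<close>-th solution.\<close>
  define good where "good n t \<longleftrightarrow> (\<forall>s\<in>{0..t}. (\<eta> n)\<^sup>2 < W n s)" for n t
  have good_down: "good n s" if "good n t" "s \<le> t" for n s t using that by (auto simp: good_def)
  have agree: "W m t = W n t \<and> V m t = V n t" if "good n t" "n \<le> m" "0 \<le> t" "t \<le> S" for n m t
  proof (rule solves_clamped_unique[OF c(1) \<eta>[of m] sub[OF that(4)]])
    have r: "clamped_sqrt (\<eta> m) (W n s) = clamped_sqrt (\<eta> n) (W n s)" if "0 \<le> s" "s \<le> t" for s
    proof -
      have "(\<eta> n)\<^sup>2 < W n s" using \<open>good n t\<close> that by (auto simp: good_def)
      moreover have "(\<eta> m)\<^sup>2 \<le> (\<eta> n)\<^sup>2" using \<eta>_mono[OF \<open>n \<le> m\<close>] \<eta>[of m] by (intro power_mono) auto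
      ultimately show ?thesis by (simp add: clamped_sqrt_def max_absorb1)
    qed
    show "solves_clamped (\<eta> m) \<sigma> c1 c2 t (W n) (V n)"
      unfolding solves_clamped_def
    proof
      show "bounded_primitive (W n) (\<lambda>t. - 2 * V n t + 2 * c1 t * clamped_sqrt (\<eta> m) (W n t)) 0 t"
        by (rule bounded_primitive_cong[OF sub[OF that(4), of n, unfolded solves_clamped_def, THEN conjunct1]])
           (simp_all add: r)
      show "bounded_primitive (V n) (\<lambda>t. 1 - \<sigma> * clamped_sqrt (\<eta> m) (W n t) + V n t + c2 t) 0 t"
        by (rule bounded_primitive_cong[OF sub[OF that(4), of n, unfolded solves_clamped_def, THEN conjunct2]])
           (simp_all add: r)
    qed
  qed (use that init in auto)
  have good_mono: "good m t" if "good n t" "n \<le> m" "t \<le> S" for n m t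
    unfolding good_def
  proof
    fix s assume s: "s \<in> {0..t}"
    then have "W m s = W n s" using agree[OF good_down[OF that(1), of s] that(2)] that(3) by auto
    moreover have "(\<eta> m)\<^sup>2 \<le> (\<eta> n)\<^sup>2" using \<eta>_mono[OF \<open>n \<le> m\<close>] \<eta>[of m] by (intro power_mono) auto
    moreover have "(\<eta> n)\<^sup>2 < W n s" using that(1) s by (auto simp: good_def)
    ultimately show "(\<eta> m)\<^sup>2 < W m s" by simp
  qed
  have good_open: "\<exists>t'. t < t' \<and> t' < S \<and> good n t'" if "good n t" "0 \<le> t" "t < S" for n t
  proof (rule ccontr)
    assume no: "\<not> ?thesis"
    have "(\<eta> n)\<^sup>2 < W n t" using that by (auto simp: good_def)
    then have "W n t - (\<eta> n)\<^sup>2 > 0" by simp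
    moreover have "t \<in> {0..S}" using that by simp
    ultimately have "\<exists>d>0. \<forall>s\<in>{0..S}. dist s t < d \<longrightarrow> dist (W n s) (W n t) < W n t - (\<eta> n)\<^sup>2"
      using cW[of n] unfolding continuous_on_iff by blast
    then obtain d where d: "d > 0"
      "\<And>s. s \<in> {0..S} \<Longrightarrow> \<bar>s - t\<bar> < d \<Longrightarrow> \<bar>W n s - W n t\<bar> < W n t - (\<eta> n)\<^sup>2"
      unfolding dist_real_def by blast
    define t' where "t' = min (t + d / 2) ((t + S) / 2)"
    have t': "t < t'" "t' < S" "t' < t + d" using d(1) that by (auto simp: t'_def min_def)
    have "good n t'" unfolding good_def
    proof
      fix s assume s: "s \<in> {0..t'}"
      show "(\<eta> n)\<^sup>2 < W n s"
      proof (cases "s \<le> t")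
        case True then show ?thesis using that(1) s by (auto simp: good_def)
      next
        case False
        then have "\<bar>W n s - W n t\<bar> < W n t - (\<eta> n)\<^sup>2" using s t' by (intro d(2)) auto
        then show ?thesis by linarith
      qed
    qed
    then show False using no t' by blast
  qed
  define A where "A = {t. 0 \<le> t \<and> t < S \<and> (\<exists>n. good n t)}"
  obtain N0 where N0: "\<eta> N0 < z0" using \<eta>_small[OF z0] by blast
  have "good N0 0" using N0 \<eta>[of N0] by (auto simp: good_def init intro!: power_strict_mono)
  then have A0: "0 \<in> A" using S by (auto simp: A_def)
  have bdd: "bdd_above A" by (rule bdd_aboveI[of _ S]) (simp add: A_def)
  define \<tau> where "\<tau> = Sup A"
  have A_less: "t < \<tau>" if tA: "t \<in> A" for t
  proof -
    obtain n t' where "t < t'" "t' < S" "good n t'" using tA good_open unfolding A_def by blast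
    then have "t' \<in> A" using tA by (auto simp: A_def)
    then have "t' \<le> \<tau>" unfolding \<tau>_def by (rule cSup_upper[OF _ bdd])
    then show ?thesis using \<open>t < t'\<close> by simp
  qed
  have less_A: "t \<in> A" if t\<tau>: "0 \<le> t" "t < \<tau>" for t
  proof -
    obtain t' where "t' \<in> A" "t < t'"
      using less_cSupD[of A t] A0 t\<tau>(2) unfolding \<tau>_def by blast
    then show ?thesis using t\<tau>(1) good_down[of _ t' t] by (auto simp: A_def)
  qed
  have \<tau>: "0 < \<tau>" "\<tau> \<le> S"
    using A_less[OF A0] A0 by (auto simp: \<tau>_def A_def intro!: cSup_least)
  define N where "N t = (SOME n. good n t)" for t
  have N: "good (N t) t" if "0 \<le> t" "t < \<tau>" for t
    using less_A[OF that] unfolding N_def A_def by (auto intro: someI)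
  define z where "z t = sqrt (W (N t) t)" for t
  define v where "v t = V (N t) t" for t
  have zv: "z s = sqrt (W n s) \<and> v s = V n s" if "good n t" "0 \<le> s" "s \<le> t" "t < \<tau>" for n s t
  proof -
    have g: "good n s" "good (N s) s" using that good_down N[of s] by auto
    show ?thesis
    proof (cases "n \<le> N s")
      case True
      then show ?thesis using agree[OF g(1), of "N s"] that \<tau> by (simp add: z_def v_def)
    next
      case False
      then show ?thesis using agree[OF g(2), of n] that \<tau> by (simp add: z_def v_def)
    qed
  qed
  have sol: "solves \<sigma> c1 c2 \<tau> z v"
    unfolding solves_def
  proof (intro allI impI conjI ballI)
    fix T assume T: "0 \<le> T" "T < \<tau>"
    have "T \<le> S" using T \<tau> by simp
    define n where "n = N T"
    have g: "good n T" using N[OF T] by (simp add: n_def)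
    have W: "(\<eta> n)\<^sup>2 < W n t" if "0 \<le> t" "t \<le> T" for t using g that by (auto simp: good_def)
    note bp = clamped_imp_bounded_primitive[OF sub[OF \<open>T \<le> S\<close>] W \<eta>]
    show "bounded_primitive z (\<lambda>t. - v t / z t + c1 t) 0 T"
      by (rule bounded_primitive_cong[OF bp(1)]) (use zv[OF g] T in auto)
    show "bounded_primitive v (\<lambda>t. 1 - \<sigma> * z t + v t + c2 t) 0 T"
      by (rule bounded_primitive_cong[OF bp(2)]) (use zv[OF g] T in auto)
    show "0 < z t" if "t \<in> {0..T}" for t
      using zv[OF g, of t] W[of t] that T by (auto intro: le_less_trans[OF zero_le_power2])
  qed
  have "good N0 0" by fact
  then have i: "z 0 = z0" "v 0 = v0" using zv[of N0 0 0] \<tau> z0 init by auto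
  show ?thesis
  proof (cases "\<tau> = S")
    case True
    then show ?thesis using global sol i by simp
  next
    case False
    then have \<tau>S: "\<tau> < S" using \<tau> by simp
    show ?thesis
    proof (rule quench[OF \<tau>(1) \<tau>S sol i])
      fix c t0 :: real assume ct: "c > 0" "t0 < \<tau>"
      show "\<exists>t. t0 < t \<and> 0 \<le> t \<and> t < \<tau> \<and> z t < c"
      proof (rule ccontr)
        assume "\<not> ?thesis"
        then have ge: "c \<le> z t" if "t0 < t" "0 \<le> t" "t < \<tau>" for t using that by force
        define t1 where "t1 = max 0 t0"
        have t1: "0 \<le> t1" "t1 < \<tau>" "t0 \<le> t1" using ct \<tau> by (auto simp: t1_def)
        obtain m0 where m0: "\<And>n. n \<ge> m0 \<Longrightarrow> \<eta> n < c" using \<eta>_small[OF ct(1)] by blast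
        define m where "m = max m0 (N t1)"
        have m: "\<eta> m < c" "N t1 \<le> m" using m0[of m] by (auto simp: m_def)
        have gm: "good m t1" using good_mono[OF N[OF t1(1,2)] m(2)] t1 \<tau> by simp
        have "good m \<tau>"
        proof (rule ccontr)
          assume "\<not> good m \<tau>"
          then obtain b where b: "0 \<le> b" "b \<le> \<tau>" "W m b \<le> (\<eta> m)\<^sup>2" by (force simp: good_def)
          let ?C = "{0..S} \<inter> W m -` {..(\<eta> m)\<^sup>2}"
          have cl: "closed ?C" by (rule continuous_closed_preimage[OF cW]) auto
          have bC: "b \<in> ?C" using b \<tau> by auto
          have nC: "0 \<notin> ?C" using bspec[OF gm[unfolded good_def], of 0] t1 by simp
          obtain t where t: "0 < t" "t \<le> b" "t \<in> ?C" "\<And>s. 0 \<le> s \<Longrightarrow> s < t \<Longrightarrow> s \<notin> ?C"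
            using first_exit[OF b(1) cl bC nC] by metis
          have gs: "good m s" if "0 \<le> s" "s < t" for s
            unfolding good_def
          proof
            fix r assume "r \<in> {0..s}"
            then show "(\<eta> m)\<^sup>2 < W m r" using t(4)[of r] that t(2) b \<tau> by auto
          qed
          have "t1 < t"
          proof (rule ccontr)
            assume "\<not> t1 < t"
            then have "(\<eta> m)\<^sup>2 < W m t" using gm t by (auto simp: good_def)
            then show False using t(3) by auto
          qed
          have ge2: "c\<^sup>2 \<le> W m s" if "t1 < s" "s < t" for s
          proof -
            have s: "0 \<le> s" "s < \<tau>" using that t1 t b by auto
            then have "z s = sqrt (W m s)" using zv[OF gs, of s s] that by auto
            then have "c \<le> sqrt (W m s)" using ge[of s] that t1 s by auto
            moreover have "0 \<le> W m s" using gs[OF s(1) that(2)] s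
              by (auto simp: good_def intro: order_trans[OF zero_le_power2 less_imp_le])
            ultimately show ?thesis using ct(1) by (metis real_le_rsqrt real_sqrt_le_iff real_sqrt_abs abs_of_pos)
          qed
          have "continuous_on {t1..t} (W m)" by (rule continuous_on_subset[OF cW]) (use t1 t b \<tau> in auto)
          then have "(W m \<longlongrightarrow> W m t) (at t within {t1..t})"
            using \<open>t1 < t\<close> by (auto simp: continuous_on)
          then have lim: "(W m \<longlongrightarrow> W m t) (at_left t)"
            using \<open>t1 < t\<close> by (simp add: at_within_Icc_at_left)
          have "c\<^sup>2 \<le> W m t"
            by (rule tendsto_lowerbound[OF lim])
               (use ge2 \<open>t1 < t\<close> in \<open>auto intro!: eventually_at_leftI[of t1]\<close>)
          moreover have "(\<eta> m)\<^sup>2 < c\<^sup>2" using m(1) \<eta>[of m] by (intro power_strict_mono) auto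
          ultimately show False using t(3) by auto
        qed
        then have "\<tau> \<in> A" using \<tau> \<tau>S by (auto simp: A_def)
        then show False using A_less by blast
      qed
    qed
  qed
qed

section \<open>Behaviour up to the quenching time\<close>

text \<open>
  At \<open>T\<close> itself, where \<open>z\<close> may vanish, only the regular equations of \<open>z\<^sup>2\<close> and \<open>v\<close> make sense.
\<close>
definition solves_closed :: "real \<Rightarrow> (real \<Rightarrow> real) \<Rightarrow> (real \<Rightarrow> real) \<Rightarrow> real \<Rightarrow> (real \<Rightarrow> real) \<Rightarrow> (real \<Rightarrow> real) \<Rightarrow> bool" where
  "solves_closed \<sigma> c1 c2 T z v \<longleftrightarrow> solves \<sigma> c1 c2 T z v \<and> continuous_on {0..T} z \<and> 0 \<le> z T \<and>
     bounded_primitive (\<lambda>t. (z t)\<^sup>2) (\<lambda>t. - 2 * v t + 2 * c1 t * z t) 0 T \<and>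
     bounded_primitive v (\<lambda>t. 1 - \<sigma> * z t + v t + c2 t) 0 T"

lemma bounded_primitive_extend:
  assumes T: "0 < T" and cx: "continuous_on {0..T} x" and gi: "g integrable_on {0..T}"
    and gb: "\<And>t. 0 \<le> t \<Longrightarrow> t \<le> T \<Longrightarrow> \<bar>g t\<bar> \<le> M"
    and hi: "\<And>t. 0 \<le> t \<Longrightarrow> t < T \<Longrightarrow> (g has_integral (x t - x 0)) {0..t}"
  shows "bounded_primitive x g 0 T"
proof (rule bounded_primitiveI_initial[OF _ gb])
  let ?h = "\<lambda>t. x t - x 0 - integral {0..t} g"
  have ch: "continuous_on {0..T} ?h"
    by (intro continuous_intros cx indefinite_integral_continuous_1 gi)
  have h0: "?h t = 0" if "t \<in> {0..<T}" for t
    using integral_unique[OF hi[of t]] that by simp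
  have cl: "closure {0..<T} = {0..T}" using T by simp
  have h0': "?h t = 0" if "t \<in> {0..T}" for t
    by (rule continuous_constant_on_closure[of "{0..<T}" ?h 0 t]) (use ch h0 that in \<open>simp_all only: cl\<close>)
  fix t assume t: "0 \<le> t" "t \<le> T"
  have "g integrable_on {0..t}" by (rule integrable_on_subinterval[OF gi]) (use t in auto)
  then show "(g has_integral (x t - x 0)) {0..t}"
    using h0'[of t] t integrable_integral[of g "{0..t}"] by simp
qed

text \<open>
  The quantity \<open>1 + z\<^sup>2 + v\<^sup>2\<close> grows at most exponentially because \<open>1/z\<close> disappears from
  the equation of \<open>z\<^sup>2\<close>; so \<open>z\<^sup>2\<close> and \<open>v\<close> are Lipschitz and extend to the closed interval.
\<close>
lemma solves_closed_extension:
  assumes c: "forcing \<beta> c1" "forcing \<beta> c2" and \<sigma>: "\<bar>\<sigma>\<bar> = 1" and T: "0 < T"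
    and s: "solves \<sigma> c1 c2 T z v"
  obtains z' v' where "solves_closed \<sigma> c1 c2 T z' v'"
    "\<And>t. 0 \<le> t \<Longrightarrow> t < T \<Longrightarrow> z' t = z t" "\<And>t. 0 \<le> t \<Longrightarrow> t < T \<Longrightarrow> v' t = v t"
proof -
  have \<beta>: "0 \<le> \<beta>" by (rule forcing_nonneg[OF c(1)])
  have cb: "\<bar>c1 t\<bar> \<le> \<beta>" "\<bar>c2 t\<bar> \<le> \<beta>" if "0 \<le> t" for t using c that by (auto simp: forcing_def)
  have wbp: "bounded_primitive (\<lambda>t. (z t)\<^sup>2) (\<lambda>t. - 2 * v t + 2 * c1 t * z t) 0 t" if "0 \<le> t" "t < T" for t
  proof (rule bounded_primitive_cong[OF bounded_primitive_power2[OF solvesD(2)[OF s that]]])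
    fix u assume u: "0 \<le> u" "u \<le> t"
    show "- 2 * v u + 2 * c1 u * z u = 2 * z u * (- v u / z u + c1 u)"
      using solvesD(1)[OF s that u] by (simp add: field_simps)
  qed simp
  define N where "N t = 1 + (z t)\<^sup>2 + (v t)\<^sup>2" for t
  define K where "K = 5 + 3 * \<beta>"
  have K: "0 \<le> K" using \<beta> by (simp add: K_def)
  define R where "R = N 0 * exp (K * T)"
  have NR: "N t \<le> R" if t: "0 \<le> t" "t < T" for t
  proof -
    let ?g = "\<lambda>u. 0 + (- 2 * v u + 2 * c1 u * z u) + 2 * v u * (1 - \<sigma> * z u + v u + c2 u)"
    have bp: "bounded_primitive N ?g 0 t"
      unfolding N_def
      by (intro bounded_primitive_add bounded_primitive_const wbp bounded_primitive_power2 solvesD(3)[OF s] t)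
    have "N t \<le> N 0 * exp (K * (t - 0))"
    proof (rule Gronwall_const[OF bp t(1)])
      fix u assume "u \<in> {0..t}"
      then have u: "0 \<le> u" by simp
      have a: "2 * \<bar>v u\<bar> \<le> 1 + (v u)\<^sup>2" "2 * \<bar>z u\<bar> \<le> 1 + (z u)\<^sup>2" "2 * (\<bar>z u\<bar> * \<bar>v u\<bar>) \<le> (z u)\<^sup>2 + (v u)\<^sup>2"
        using sum_squares_bound[of 1 "\<bar>v u\<bar>"] sum_squares_bound[of 1 "\<bar>z u\<bar>"] sum_squares_bound[of "\<bar>z u\<bar>" "\<bar>v u\<bar>"]
        by (simp_all add: mult.assoc)
      have "c1 u * (2 * z u) \<le> \<bar>c1 u\<bar> * (2 * \<bar>z u\<bar>)" using abs_ge_self[of "c1 u * (2 * z u)"] by (simp add: abs_mult)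
      also have "\<dots> \<le> \<beta> * (1 + (z u)\<^sup>2)" using cb(1)[OF u] a(2) \<beta> by (intro mult_mono) auto
      finally have b1: "c1 u * (2 * z u) \<le> \<beta> * (1 + (z u)\<^sup>2)" .
      have "c2 u * (2 * v u) \<le> \<bar>c2 u\<bar> * (2 * \<bar>v u\<bar>)" using abs_ge_self[of "c2 u * (2 * v u)"] by (simp add: abs_mult)
      also have "\<dots> \<le> \<beta> * (1 + (v u)\<^sup>2)" using cb(2)[OF u] a(1) \<beta> by (intro mult_mono) auto
      finally have b2: "c2 u * (2 * v u) \<le> \<beta> * (1 + (v u)\<^sup>2)" .
      have "- (\<sigma> * (z u * v u)) \<le> \<bar>\<sigma> * (z u * v u)\<bar>" by simp
      also have "\<dots> = \<bar>z u\<bar> * \<bar>v u\<bar>" using \<sigma> by (simp add: abs_mult)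
      finally have b3: "- 2 * (\<sigma> * (z u * v u)) \<le> (z u)\<^sup>2 + (v u)\<^sup>2" using a(3) by linarith
      have e: "?g u = - 2 * v u + c1 u * (2 * z u) + (2 * v u + - 2 * (\<sigma> * (z u * v u)) + 2 * (v u)\<^sup>2 + c2 u * (2 * v u))"
        by (simp add: algebra_simps power2_eq_square)
      have "?g u \<le> \<beta> * (1 + (z u)\<^sup>2) + ((z u)\<^sup>2 + (v u)\<^sup>2) + 2 * (v u)\<^sup>2 + \<beta> * (1 + (v u)\<^sup>2)"
        unfolding e using b1 b2 b3 by linarith
      also have "\<dots> \<le> 5 * N u + (\<beta> * N u + \<beta> * N u)"
      proof -
        have "\<beta> * (1 + (z u)\<^sup>2) \<le> \<beta> * N u" "\<beta> * (1 + (v u)\<^sup>2) \<le> \<beta> * N u"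
          using \<beta> by (auto intro!: mult_left_mono simp: N_def)
        moreover have "((z u)\<^sup>2 + (v u)\<^sup>2) + 2 * (v u)\<^sup>2 \<le> 5 * N u" by (simp add: N_def)
        ultimately show ?thesis by linarith
      qed
      also have "\<dots> \<le> K * N u"
      proof -
        have "0 \<le> \<beta> * N u" using \<beta> by (simp add: N_def)
        then show ?thesis by (simp add: K_def algebra_simps)
      qed
      finally show "?g u \<le> K * N u" .
    qed
    also have "\<dots> \<le> N 0 * exp (K * T)"
      using K t by (intro mult_left_mono) (auto simp: N_def mult_left_mono)
    finally show ?thesis by (simp add: R_def)
  qed
  have R1: "1 \<le> R" using NR[of 0] T zero_le_power2[of "v 0"] zero_le_power2[of "z 0"] unfolding N_def by linarith
  have sqR: "\<bar>x\<bar> \<le> R" if "x\<^sup>2 \<le> R" for x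
  proof -
    have "R \<le> R\<^sup>2" using mult_left_mono[of 1 R R] R1 by (simp add: power2_eq_square)
    then have "x\<^sup>2 \<le> R\<^sup>2" using that by linarith
    then show ?thesis using R1 abs_le_square_iff[of x R] by simp
  qed
  have vR: "\<bar>v t\<bar> \<le> R" and zR: "\<bar>z t\<bar> \<le> R" if t: "0 \<le> t" "t < T" for t
  proof -
    have "(v t)\<^sup>2 \<le> R" "(z t)\<^sup>2 \<le> R"
      using NR[OF t] zero_le_power2[of "v t"] zero_le_power2[of "z t"] unfolding N_def by linarith+
    then show "\<bar>v t\<bar> \<le> R" "\<bar>z t\<bar> \<le> R" by (auto intro: sqR)
  qed
  define L where "L = 2 * R + 2 * (\<beta> * R) + 1 + \<beta>"
  have L: "0 \<le> L" using R1 \<beta> by (simp add: L_def)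
  have c1z: "\<bar>c1 t * z t\<bar> \<le> \<beta> * R" if t: "0 \<le> t" "t < T" for t
    unfolding abs_mult using cb(1)[OF t(1)] zR[OF t] by (intro mult_mono) auto
  have gw: "\<bar>- 2 * v t + 2 * c1 t * z t\<bar> \<le> L" if t: "0 \<le> t" "t < T" for t
    using c1z[OF t] vR[OF t] \<beta> unfolding L_def mult.assoc by linarith
  have \<sigma>z: "\<bar>\<sigma> * z t\<bar> = \<bar>z t\<bar>" for t using \<sigma> by (simp add: abs_mult)
  have \<beta>R: "0 \<le> \<beta> * R" using \<beta> R1 by simp
  have gv: "\<bar>1 - \<sigma> * z t + v t + c2 t\<bar> \<le> L" if t: "0 \<le> t" "t < T" for t
    using \<sigma>z[of t] zR[OF t] vR[OF t] cb(2)[OF t(1)] \<beta>R unfolding L_def by linarith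
  have lipw: "\<bar>x t - x u\<bar> \<le> L * \<bar>t - u\<bar>"
    if bp: "\<And>t. 0 \<le> t \<Longrightarrow> t < T \<Longrightarrow> bounded_primitive x g 0 t"
      and gL: "\<And>t. 0 \<le> t \<Longrightarrow> t < T \<Longrightarrow> \<bar>g t\<bar> \<le> L"
      and tu: "t \<in> {0..<T}" "u \<in> {0..<T}" for t u and x g :: "real \<Rightarrow> real"
    by (rule bounded_primitive_lipschitz[OF bp[of "max t u"] gL L]) (use tu in auto)
  have cl: "closure {0..<T} = {0..T}" using T by simp
  have "L-lipschitz_on {0..<T} (\<lambda>t. (z t)\<^sup>2)"
    using lipw[OF wbp gw] L by (intro lipschitz_onI) (auto simp: dist_real_def)
  from lipschitz_extend_closure[OF this] obtain w' where
    w': "L-lipschitz_on {0..T} w'" "\<And>t. t \<in> {0..<T} \<Longrightarrow> w' t = (z t)\<^sup>2" unfolding cl by blast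
  have "L-lipschitz_on {0..<T} v"
    using lipw[OF solvesD(3)[OF s] gv] L by (intro lipschitz_onI) (auto simp: dist_real_def)
  from lipschitz_extend_closure[OF this] obtain v' where
    v': "L-lipschitz_on {0..T} v'" "\<And>t. t \<in> {0..<T} \<Longrightarrow> v' t = v t" unfolding cl by blast
  have cw: "continuous_on {0..T} w'" and cv: "continuous_on {0..T} v'"
    using w'(1) v'(1) by (auto intro: lipschitz_on_continuous_on)
  define z' where "z' t = sqrt (w' t)" for t
  have cz: "continuous_on {0..T} z'" unfolding z'_def by (intro continuous_intros cw)
  have zz: "z' t = z t" if "0 \<le> t" "t < T" for t
    using w'(2)[of t] solvesD(1)[OF s that, of t] that by (simp add: z'_def)
  have vv: "v' t = v t" if "0 \<le> t" "t < T" for t using v'(2) that by simp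
  have w0: "0 \<le> w' t" if t: "t \<in> {0..T}" for t
  proof -
    have "closure {0..<T} \<subseteq> {0..T} \<inter> w' -` {0..}"
      by (rule closure_minimal) (use w'(2) in \<open>auto intro!: continuous_closed_preimage[OF cw]\<close>)
    then show ?thesis using t unfolding cl by auto
  qed
  have w'z': "(z' t)\<^sup>2 = w' t" if "t \<in> {0..T}" for t using w0[OF that] by (simp add: z'_def)
  have solves': "solves \<sigma> c1 c2 T z' v'"
    unfolding solves_def
  proof (intro allI impI conjI ballI)
    fix T' assume T': "0 \<le> T'" "T' < T"
    note sD = solvesD[OF s T']
    show "0 < z' t" if "t \<in> {0..T'}" for t using sD(1)[of t] zz[of t] that T' by auto
    show "bounded_primitive z' (\<lambda>t. - v' t / z' t + c1 t) 0 T'"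
      by (rule bounded_primitive_cong[OF sD(2)]) (use T' zz vv in auto)
    show "bounded_primitive v' (\<lambda>t. 1 - \<sigma> * z' t + v' t + c2 t) 0 T'"
      by (rule bounded_primitive_cong[OF sD(3)]) (use T' zz vv in auto)
  qed
  obtain Z where Z: "Z \<ge> 0" "\<And>t. 0 \<le> t \<Longrightarrow> t \<le> T \<Longrightarrow> \<bar>z' t\<bar> \<le> Z"
    using continuous_on_Icc_bounded[OF cz] by blast
  obtain Y where Y: "Y \<ge> 0" "\<And>t. 0 \<le> t \<Longrightarrow> t \<le> T \<Longrightarrow> \<bar>v' t\<bar> \<le> Y"
    using continuous_on_Icc_bounded[OF cv] by blast
  have "bounded_primitive w' (\<lambda>t. - 2 * v' t + c1 t * (2 * z' t)) 0 T"
  proof (rule bounded_primitive_extend[OF T cw, where M="2 * Y + \<beta> * (2 * Z)"])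
    show "(\<lambda>t. - 2 * v' t + c1 t * (2 * z' t)) integrable_on {0..T}"
    proof (rule integrable_add)
      show "(\<lambda>t. - 2 * v' t) integrable_on {0..T}"
        by (intro integrable_continuous_interval continuous_intros cv)
      show "(\<lambda>t. c1 t * (2 * z' t)) integrable_on {0..T}"
        by (intro forcing_mult_integrable[OF c(1)] continuous_intros cz) simp
    qed
    fix t :: real assume t: "0 \<le> t"
    show "\<bar>- 2 * v' t + c1 t * (2 * z' t)\<bar> \<le> 2 * Y + \<beta> * (2 * Z)" if "t \<le> T"
    proof -
      have "\<bar>c1 t * (2 * z' t)\<bar> \<le> \<beta> * (2 * Z)"
        unfolding abs_mult[of "c1 t"] using cb(1)[OF t] Z(2)[OF t that] \<beta> by (intro mult_mono) auto
      moreover have "\<bar>- 2 * v' t\<bar> \<le> 2 * Y" using Y(2)[OF t that] by simp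
      ultimately show ?thesis by (intro order_trans[OF abs_triangle_ineq add_mono])
    qed
    show "((\<lambda>t. - 2 * v' t + c1 t * (2 * z' t)) has_integral (w' t - w' 0)) {0..t}" if "t < T"
    proof -
      have "((\<lambda>t. - 2 * v t + 2 * c1 t * z t) has_integral ((z t)\<^sup>2 - (z 0)\<^sup>2)) {0..t}"
        by (rule bounded_primitive_has_integral[OF wbp[OF t that] order_refl t order_refl])
      moreover have "w' t = (z t)\<^sup>2" "w' 0 = (z 0)\<^sup>2" using w'(2) t that T by auto
      ultimately show ?thesis
        by (simp only:) (erule has_integral_eq[rotated], use zz vv that in auto)
    qed
  qed
  then have B1: "bounded_primitive (\<lambda>t. (z' t)\<^sup>2) (\<lambda>t. - 2 * v' t + 2 * c1 t * z' t) 0 T"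
    by (rule bounded_primitive_cong) (use w'z' in auto)
  have B2: "bounded_primitive v' (\<lambda>t. 1 - \<sigma> * z' t + v' t + c2 t) 0 T"
  proof (rule bounded_primitive_extend[OF T cv, where M="1 + Z + Y + \<beta>"])
    show "(\<lambda>t. 1 - \<sigma> * z' t + v' t + c2 t) integrable_on {0..T}"
    proof (rule integrable_add)
      show "(\<lambda>t. 1 - \<sigma> * z' t + v' t) integrable_on {0..T}"
        by (intro integrable_continuous_interval continuous_intros cv cz)
      show "c2 integrable_on {0..T}" by (intro forcing_integrable[OF c(2)]) simp
    qed
    fix t :: real assume t: "0 \<le> t"
    show "\<bar>1 - \<sigma> * z' t + v' t + c2 t\<bar> \<le> 1 + Z + Y + \<beta>" if "t \<le> T"
    proof -
      have "\<bar>\<sigma> * z' t\<bar> \<le> Z" using Z(2)[OF t that] \<sigma> by (simp add: abs_mult)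
      then show ?thesis using Y(2)[OF t that] cb(2)[OF t] by linarith
    qed
    show "((\<lambda>t. 1 - \<sigma> * z' t + v' t + c2 t) has_integral (v' t - v' 0)) {0..t}" if "t < T"
    proof -
      have "((\<lambda>t. 1 - \<sigma> * z t + v t + c2 t) has_integral (v t - v 0)) {0..t}"
        by (rule bounded_primitive_has_integral[OF solvesD(3)[OF s t that] order_refl t order_refl])
      moreover have "v' t = v t" "v' 0 = v 0" using vv t that T by auto
      ultimately show ?thesis
        by (simp only:) (erule has_integral_eq[rotated], use zz vv that in auto)
    qed
  qed
  have "0 \<le> z' T" using w0[of T] T by (simp add: z'_def)
  then have "solves_closed \<sigma> c1 c2 T z' v'"
    unfolding solves_closed_def using solves' cz B1 B2 by blast
  then show ?thesis by (rule that) (use zz vv in auto)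
qed


text \<open>
  An optimal trajectory \<open>(z, v)\<close> with forcing \<open>(c1, c2)\<close> among the forcings in \<open>K\<close>. Of the set of
  controls only the following matters: it is convex, contains \<open>0\<close>, and is closed under switching
  from one element to another. Optimality appears as the fact that every forcing has a trajectory
  on the whole of \<open>[0, tb)\<close>.
\<close>
locale optimal_quenching =
  fixes \<sigma> \<beta> tb :: real and K :: "(real \<Rightarrow> real) \<Rightarrow> (real \<Rightarrow> real) \<Rightarrow> bool"
    and c1 c2 z v :: "real \<Rightarrow> real"
  assumes \<sigma>: "\<bar>\<sigma>\<bar> = 1"
    and K_forcing: "K k1 k2 \<Longrightarrow> forcing \<beta> k1" "K k1 k2 \<Longrightarrow> forcing \<beta> k2"
    and K_convex: "K k1 k2 \<Longrightarrow> K l1 l2 \<Longrightarrow> 0 \<le> r \<Longrightarrow> r \<le> 1 \<Longrightarrow>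
      K (\<lambda>t. k1 t + r * (l1 t - k1 t)) (\<lambda>t. k2 t + r * (l2 t - k2 t))"
    and K_switch: "K k1 k2 \<Longrightarrow> K l1 l2 \<Longrightarrow>
      K (\<lambda>t. if t < T then k1 t else l1 t) (\<lambda>t. if t < T then k2 t else l2 t)"
    and K_zero: "K (\<lambda>_. 0) (\<lambda>_. 0)"
    and never_earlier: "K k1 k2 \<Longrightarrow> \<exists>z' v'. solves \<sigma> k1 k2 tb z' v' \<and> z' 0 = z 0 \<and> v' 0 = v 0"
    and K_c: "K c1 c2"
    and tb: "0 < tb"
    and sol: "solves_closed \<sigma> c1 c2 tb z v"
    and quenched: "z tb = 0"
begin

lemma \<beta>_nonneg: "0 \<le> \<beta>" by (rule forcing_nonneg[OF K_forcing(1)[OF K_c]])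

lemma c_bound: "0 \<le> t \<Longrightarrow> \<bar>c1 t\<bar> \<le> \<beta>" "0 \<le> t \<Longrightarrow> \<bar>c2 t\<bar> \<le> \<beta>"
  using K_forcing[OF K_c] by (auto simp: forcing_def)

lemma \<sigma>_cases: "\<sigma> = 1 \<or> \<sigma> = -1" using \<sigma> by linarith

lemma never_earlier_closed:
  assumes "K k1 k2"
  obtains z' v' where "solves_closed \<sigma> k1 k2 tb z' v'" "z' 0 = z 0" "v' 0 = v 0"
proof -
  obtain z1 v1 where 1: "solves \<sigma> k1 k2 tb z1 v1" "z1 0 = z 0" "v1 0 = v 0"
    using never_earlier[OF assms] by blast
  obtain z' v' where "solves_closed \<sigma> k1 k2 tb z' v'"
    "\<And>t. 0 \<le> t \<Longrightarrow> t < tb \<Longrightarrow> z' t = z1 t" "\<And>t. 0 \<le> t \<Longrightarrow> t < tb \<Longrightarrow> v' t = v1 t"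
    using solves_closed_extension[OF K_forcing[OF assms] \<sigma> tb 1(1)] by blast
  then show ?thesis using 1 tb by (intro that[of z' v']) auto
qed

lemma closed_pos: "solves_closed \<sigma> k1 k2 tb z' v' \<Longrightarrow> 0 \<le> t \<Longrightarrow> t < tb \<Longrightarrow> 0 < z' t"
  unfolding solves_closed_def using solvesD(1)[of \<sigma> k1 k2 tb z' v' t t] by blast

lemma closed_z_bp: "solves_closed \<sigma> k1 k2 tb z' v' \<Longrightarrow> 0 \<le> b \<Longrightarrow> b < tb \<Longrightarrow>
    bounded_primitive z' (\<lambda>t. - v' t / z' t + k1 t) 0 b"
  unfolding solves_closed_def using solvesD(2) by blast

lemma closed_v_bp: "solves_closed \<sigma> k1 k2 tb z' v' \<Longrightarrow>
    bounded_primitive v' (\<lambda>t. 1 - \<sigma> * z' t + v' t + k2 t) 0 tb"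
  unfolding solves_closed_def by blast

lemma closed_w_bp: "solves_closed \<sigma> k1 k2 tb z' v' \<Longrightarrow>
    bounded_primitive (\<lambda>t. (z' t)\<^sup>2) (\<lambda>t. - 2 * v' t + 2 * k1 t * z' t) 0 tb"
  unfolding solves_closed_def by blast

lemma closed_cont: "solves_closed \<sigma> k1 k2 tb z' v' \<Longrightarrow> continuous_on {0..tb} z'"
  "solves_closed \<sigma> k1 k2 tb z' v' \<Longrightarrow> continuous_on {0..tb} v'"
  unfolding solves_closed_def using bounded_primitive_continuous by blast+

lemma continuous_at_end:
  fixes x :: "real \<Rightarrow> real"
  assumes "continuous_on {0..tb} x" "0 < e"
  obtains T where "0 \<le> T" "T < tb" "\<And>t. T \<le> t \<Longrightarrow> t \<le> tb \<Longrightarrow> \<bar>x t - x tb\<bar> < e"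
proof -
  have "tb \<in> {0..tb}" using tb by simp
  then obtain d where d: "d > 0" "\<forall>s\<in>{0..tb}. dist s tb < d \<longrightarrow> dist (x s) (x tb) < e"
    using assms unfolding continuous_on_iff by blast
  show ?thesis
  proof (rule that[of "max 0 (tb - d / 2)"])
    fix t assume t: "max 0 (tb - d / 2) \<le> t" "t \<le> tb"
    then have "t \<in> {0..tb}" "dist t tb < d" using d(1) by (auto simp: dist_real_def)
    then show "\<bar>x t - x tb\<bar> < e" using d(2) unfolding dist_real_def by blast
  qed (use d(1) tb in auto)
qed

lemma z_small:
  assumes "0 < e"
  obtains T where "0 \<le> T" "T < tb" "\<And>t. T \<le> t \<Longrightarrow> t \<le> tb \<Longrightarrow> \<bar>z t\<bar> < e"
  using continuous_at_end[OF closed_cont(1)[OF sol] assms] quenched by auto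

text \<open>
  If \<open>v tb < 0\<close>, then \<open>z\<^sup>2\<close> has the positive derivative \<open>- 2 * v + 2 * c1 * z\<close> near \<open>tb\<close>, but it
  has to decrease to \<open>0\<close>.
\<close>
lemma v_end_nonneg: "0 \<le> v tb"
proof (rule ccontr)
  assume neg: "\<not> ?thesis"
  have "continuous_on {0..tb} (\<lambda>t. 2 * v t + 2 * (\<beta> * z t))"
    by (intro continuous_intros closed_cont[OF sol])
  then obtain T where T: "0 \<le> T" "T < tb"
    "\<And>t. T \<le> t \<Longrightarrow> t \<le> tb \<Longrightarrow> \<bar>2 * v t + 2 * (\<beta> * z t) - (2 * v tb + 2 * (\<beta> * z tb))\<bar> < - v tb"
    using continuous_at_end[of "\<lambda>t. 2 * v t + 2 * (\<beta> * z t)" "- v tb"] neg by auto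
  have "(z T)\<^sup>2 \<le> (z tb)\<^sup>2"
  proof (rule bounded_primitive_mono[OF closed_w_bp[OF sol]])
    fix u assume u: "T \<le> u" "u \<le> tb"
    have zu: "0 \<le> z u" using closed_pos[OF sol, of u] quenched T u by (cases "u = tb") auto
    have "\<bar>c1 u * z u\<bar> \<le> \<beta> * z u"
      unfolding abs_mult using c_bound(1)[of u] zu T u by (intro mult_mono) auto
    then show "0 \<le> - 2 * v u + 2 * c1 u * z u"
      using T(3)[OF u] neg quenched unfolding mult.assoc by auto
  qed (use T in auto)
  then show False using closed_pos[OF sol T(1,2)] quenched by simp
qed

lemma agree_before_switch:
  assumes "K k1 k2" "K l1 l2"
    and s: "solves_closed \<sigma> k1 k2 tb z1 v1" "solves_closed \<sigma> l1 l2 tb z2 v2"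
    and init: "z1 0 = z2 0" "v1 0 = v2 0"
    and eq: "\<And>t. 0 \<le> t \<Longrightarrow> t < T \<Longrightarrow> k1 t = l1 t \<and> k2 t = l2 t"
    and T: "0 \<le> T" "T < tb"
  shows "z1 T = z2 T \<and> v1 T = v2 T"
proof (cases "T = 0")
  case True then show ?thesis using init by simp
next
  case False
  have before: "z1 t = z2 t \<and> v1 t = v2 t" if "0 \<le> t" "t < T" for t
    by (rule solves_unique[OF K_forcing(1)[OF assms(1)] s(1)[unfolded solves_closed_def, THEN conjunct1]
          s(2)[unfolded solves_closed_def, THEN conjunct1] init]) (use eq that T in auto)
  have cl: "closure {0..<T} = {0..T}" using T False by simp
  have sub: "{0..T} \<subseteq> {0..tb}" using T by auto
  have "z1 T - z2 T = 0"
    by (rule continuous_constant_on_closure[of "{0..<T}" "\<lambda>t. z1 t - z2 t"])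
       (use before T in \<open>auto simp only: cl intro!: continuous_intros continuous_on_subset[OF closed_cont(1)[OF s(1)] sub]
          continuous_on_subset[OF closed_cont(1)[OF s(2)] sub]\<close>, auto)
  moreover have "v1 T - v2 T = 0"
    by (rule continuous_constant_on_closure[of "{0..<T}" "\<lambda>t. v1 t - v2 t"])
       (use before T in \<open>auto simp only: cl intro!: continuous_intros continuous_on_subset[OF closed_cont(2)[OF s(1)] sub]
          continuous_on_subset[OF closed_cont(2)[OF s(2)] sub]\<close>, auto)
  ultimately show ?thesis by simp
qed

end

section \<open>Trajectories that are ahead of an optimal one\<close>

context optimal_quenching
begin

text \<open>
  A competing trajectory that is governed by the optimal forcing from time \<open>T\<close> on.
\<close>
definition tail :: "real \<Rightarrow> (real \<Rightarrow> real) \<Rightarrow> (real \<Rightarrow> real) \<Rightarrow> (real \<Rightarrow> real) \<Rightarrow> (real \<Rightarrow> real) \<Rightarrow> bool" where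
  "tail T k1 k2 z' v' \<longleftrightarrow> 0 \<le> T \<and> T < tb \<and> K k1 k2 \<and> solves_closed \<sigma> k1 k2 tb z' v' \<and>
     z' 0 = z 0 \<and> v' 0 = v 0 \<and> (\<forall>t\<ge>T. k1 t = c1 t \<and> k2 t = c2 t)"

lemma tailD:
  assumes "tail T k1 k2 z' v'"
  shows "0 \<le> T" "T < tb" "K k1 k2" "solves_closed \<sigma> k1 k2 tb z' v'"
    "\<And>t. T \<le> t \<Longrightarrow> k1 t = c1 t \<and> k2 t = c2 t"
  using assms by (auto simp: tail_def)

lemma tail_later: "tail T k1 k2 z' v' \<Longrightarrow> T \<le> T' \<Longrightarrow> T' < tb \<Longrightarrow> tail T' k1 k2 z' v'"
  by (auto simp: tail_def)

lemma tail_pos: "tail T k1 k2 z' v' \<Longrightarrow> T \<le> t \<Longrightarrow> t < tb \<Longrightarrow> 0 < z t \<and> 0 < z' t"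
  using closed_pos[OF sol, of t] closed_pos[of k1 k2 z' v' t] by (auto simp: tail_def)

text \<open>
  The right-hand side is written so that the coefficient of \<open>z - z'\<close> contains \<open>v'\<close>, for
  which \<open>zero_control_bound\<close> is available.
\<close>
lemma tail_diff_z:
  assumes "tail T k1 k2 z' v'" "b < tb"
  shows "bounded_primitive (\<lambda>t. z t - z' t)
    (\<lambda>t. (v' t - v t) / z t + v' t / (z t * z' t) * (z t - z' t)) T b"
proof (cases "T \<le> b")
  case True
  note t = tailD[OF assms(1)]
  have "bounded_primitive (\<lambda>t. z t - z' t)
      (\<lambda>t. (- v t / z t + c1 t) - (- v' t / z' t + k1 t)) T b"
    by (rule bounded_primitive_subinterval[OF bounded_primitive_diff[OF
          closed_z_bp[OF sol, of b] closed_z_bp[OF t(4), of b]]]) (use t(1) True assms(2) in auto)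
  then show ?thesis
  proof (rule bounded_primitive_cong)
    fix u assume u: "T \<le> u" "u \<le> b"
    have "0 < z u" "0 < z' u" using tail_pos[OF assms(1), of u] u assms(2) by auto
    then show "(v' u - v u) / z u + v' u / (z u * z' u) * (z u - z' u) =
        (- v u / z u + c1 u) - (- v' u / z' u + k1 u)"
      using t(5)[OF u(1)] by (simp add: field_simps)
  qed simp
qed (auto simp: bounded_primitive_def)

lemma tail_diff_v:
  assumes "tail T k1 k2 z' v'"
  shows "bounded_primitive (\<lambda>t. v' t - v t) (\<lambda>t. (v' t - v t) + \<sigma> * (z t - z' t)) T tb"
proof -
  note t = tailD[OF assms(1)]
  have "bounded_primitive (\<lambda>t. v' t - v t)
      (\<lambda>t. (1 - \<sigma> * z' t + v' t + k2 t) - (1 - \<sigma> * z t + v t + c2 t)) T tb"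
    by (rule bounded_primitive_subinterval[OF bounded_primitive_diff[OF closed_v_bp[OF t(4)] closed_v_bp[OF sol]]])
       (use t(1) in auto)
  then show ?thesis by (rule bounded_primitive_cong) (use t(5) in \<open>auto simp: algebra_simps\<close>)
qed

lemma tail_diff_w:
  assumes "tail T k1 k2 z' v'"
  shows "bounded_primitive (\<lambda>t. (z t)\<^sup>2 - (z' t)\<^sup>2)
    (\<lambda>t. 2 * (v' t - v t) + 2 * (c1 t * (z t - z' t))) T tb"
proof -
  note t = tailD[OF assms(1)]
  have "bounded_primitive (\<lambda>t. (z t)\<^sup>2 - (z' t)\<^sup>2)
      (\<lambda>t. (- 2 * v t + 2 * c1 t * z t) - (- 2 * v' t + 2 * k1 t * z' t)) T tb"
    by (rule bounded_primitive_subinterval[OF bounded_primitive_diff[OF closed_w_bp[OF sol] closed_w_bp[OF t(4)]]])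
       (use t(1) in auto)
  then show ?thesis by (rule bounded_primitive_cong) (use t(5) in \<open>auto simp: algebra_simps\<close>)
qed

lemma tail_w_end: "tail T k1 k2 z' v' \<Longrightarrow> (z tb)\<^sup>2 - (z' tb)\<^sup>2 \<le> 0"
  using quenched by simp

text \<open>
  If \<open>v' - v\<close> stays above a positive constant, then \<open>z\<^sup>2 - z'\<^sup>2\<close> finally increases, because the
  other term of its derivative is at most \<open>2 * \<beta> * z\<close>. So \<open>z'\<close> would vanish before \<open>z\<close>.
\<close>
lemma ahead_impossible:
  assumes "tail T k1 k2 z' v'" and \<epsilon>: "0 < \<epsilon>"
    and d: "\<And>t. T \<le> t \<Longrightarrow> t < tb \<Longrightarrow> 0 < z t - z' t"
    and e: "\<And>t. T \<le> t \<Longrightarrow> t < tb \<Longrightarrow> \<epsilon> \<le> v' t - v t"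
  shows False
proof -
  note t = tailD[OF assms(1)]
  have "0 < \<epsilon> / (\<beta> + 1)" using \<epsilon> \<beta>_nonneg by simp
  then obtain T1 where T1: "0 \<le> T1" "T1 < tb" "\<And>t. T1 \<le> t \<Longrightarrow> t \<le> tb \<Longrightarrow> \<bar>z t\<bar> < \<epsilon> / (\<beta> + 1)"
    using z_small by blast
  define T2 where "T2 = max T T1"
  have T2: "T \<le> T2" "T1 \<le> T2" "T2 < tb" using T1 t by (auto simp: T2_def)
  have D: "(z u)\<^sup>2 - (z' u)\<^sup>2 \<ge> (z T2)\<^sup>2 - (z' T2)\<^sup>2" if u: "T2 \<le> u" "u < tb" for u
  proof (rule bounded_primitive_mono[OF tail_diff_w[OF assms(1)]])
    fix r assume r: "T2 \<le> r" "r \<le> u"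
    then have r': "T \<le> r" "r < tb" "0 \<le> r" using T2 u t(1) by auto
    have pos: "0 < z r" "0 < z' r" using tail_pos[OF assms(1) r'(1,2)] by auto
    have "\<bar>c1 r * (z r - z' r)\<bar> \<le> \<beta> * (\<epsilon> / (\<beta> + 1))"
      unfolding abs_mult
    proof (rule mult_mono)
      show "\<bar>z r - z' r\<bar> \<le> \<epsilon> / (\<beta> + 1)" using d[OF r'(1,2)] pos T1(3)[of r] r T2 r' by linarith
    qed (use c_bound(1)[OF r'(3)] \<beta>_nonneg in auto)
    also have "\<dots> \<le> \<epsilon>" using \<epsilon> \<beta>_nonneg by (simp add: field_simps)
    finally have "- \<epsilon> \<le> c1 r * (z r - z' r)" by (simp add: abs_le_iff)
    then have "0 \<le> 2 * ((v' r - v r) + c1 r * (z r - z' r))" using e[OF r'(1,2)] by simp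
    then show "0 \<le> 2 * (v' r - v r) + 2 * (c1 r * (z r - z' r))" by (simp only: distrib_left)
  qed (use T2 u in auto)
  have cD: "continuous_on {T2..tb} (\<lambda>t. (z t)\<^sup>2 - (z' t)\<^sup>2)"
    by (rule continuous_on_subset[OF bounded_primitive_continuous[OF tail_diff_w[OF assms(1)]]]) (use T2 in auto)
  then have "((\<lambda>t. (z t)\<^sup>2 - (z' t)\<^sup>2) \<longlongrightarrow> (z tb)\<^sup>2 - (z' tb)\<^sup>2) (at_left tb)"
    by (rule continuous_on_Icc_at_leftD[OF _ T2(3)])
  then have "(z T2)\<^sup>2 - (z' T2)\<^sup>2 \<le> (z tb)\<^sup>2 - (z' tb)\<^sup>2"
    by (rule tendsto_lowerbound) (use T2(3) D in \<open>auto intro!: eventually_at_leftI[of T2]\<close>)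
  moreover have "(z' T2)\<^sup>2 < (z T2)\<^sup>2"
    using d[OF T2(1,3)] tail_pos[OF assms(1) T2(1,3)] by (intro power_strict_mono) auto
  ultimately show False using tail_w_end[OF assms(1)] by linarith
qed

lemma tail_coefficient_bound:
  assumes "tail T k1 k2 z' v'" "T \<le> b" "b < tb"
  obtains M where "0 \<le> M" "\<And>t. T \<le> t \<Longrightarrow> t \<le> b \<Longrightarrow> \<bar>v' t / (z t * z' t)\<bar> \<le> M"
    "\<And>t. T \<le> t \<Longrightarrow> t \<le> b \<Longrightarrow> \<bar>1 / z t\<bar> \<le> M"
proof -
  note t = tailD[OF assms(1)]
  have sub: "{T..b} \<subseteq> {0..tb}" using t assms by auto
  have ne: "z t \<noteq> 0" "z' t \<noteq> 0" if "t \<in> {T..b}" for t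
    using tail_pos[OF assms(1), of t] that assms by auto
  have "continuous_on {T..b} (\<lambda>t. v' t / (z t * z' t))" "continuous_on {T..b} (\<lambda>t. 1 / z t)"
    using ne by (auto intro!: continuous_intros continuous_on_subset[OF closed_cont(1)[OF sol] sub]
      continuous_on_subset[OF closed_cont(1)[OF t(4)] sub] continuous_on_subset[OF closed_cont(2)[OF t(4)] sub])
  then obtain M1 M2 where M: "M1 \<ge> 0" "\<And>t. T \<le> t \<Longrightarrow> t \<le> b \<Longrightarrow> \<bar>v' t / (z t * z' t)\<bar> \<le> M1"
    "M2 \<ge> 0" "\<And>t. T \<le> t \<Longrightarrow> t \<le> b \<Longrightarrow> \<bar>1 / z t\<bar> \<le> M2"
    using continuous_on_Icc_bounded by (metis (no_types, lifting))
  show ?thesis by (rule that[of "max M1 M2"]) (use M in \<open>auto simp: le_max_iff_disj\<close>)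
qed

text \<open>
  For \<open>\<sigma> = 1\<close> the system is cooperative: being closer to \<open>z = 0\<close> and having the larger \<open>v\<close>
  are preserved.
\<close>
lemma ahead_impossible_cooperative:
  assumes "\<sigma> = 1" and tl: "tail T k1 k2 z' v'" and init: "0 < z T - z' T" "0 < v' T - v T"
  shows False
proof -
  note t = tailD[OF tl]
  have pos: "0 < z b - z' b \<and> 0 < v' b - v b" if b: "T \<le> b" "b < tb" for b
  proof -
    obtain M where M: "0 \<le> M" "\<And>t. T \<le> t \<Longrightarrow> t \<le> b \<Longrightarrow> \<bar>v' t / (z t * z' t)\<bar> \<le> M"
      using tail_coefficient_bound[OF tl b] by metis
    show ?thesis
    proof (rule positive_pair_persists[where X="\<lambda>t. z t - z' t" and Y="\<lambda>t. v' t - v t" and K=M,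
          OF tail_diff_z[OF tl b(2)] _ b(1) init])
      show "bounded_primitive (\<lambda>t. v' t - v t) (\<lambda>t. (v' t - v t) + \<sigma> * (z t - z' t)) T b"
        by (rule bounded_primitive_subinterval[OF tail_diff_v[OF tl]]) (use b in auto)
      fix u assume u: "T \<le> u" "u \<le> b"
        and nn: "\<And>s. T \<le> s \<Longrightarrow> s \<le> u \<Longrightarrow> 0 \<le> z s - z' s \<and> 0 \<le> v' s - v s"
      have d: "0 \<le> z u - z' u" "0 \<le> v' u - v u" using nn[OF u(1) order_refl] by auto
      have "0 \<le> (v' u - v u) / z u" using d(2) tail_pos[OF tl u(1)] u b by simp
      moreover have "- M * (z u - z' u) \<le> v' u / (z u * z' u) * (z u - z' u)"
      proof (rule mult_right_mono)
        show "- M \<le> v' u / (z u * z' u)" using abs_le_D2[OF M(2)[OF u]] by linarith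
      qed (rule d(1))
      moreover have "0 \<le> M * (v' u - v u)" using M d by simp
      ultimately show "- M * (z u - z' u) \<le> (v' u - v u) / z u + v' u / (z u * z' u) * (z u - z' u) \<and>
         - M * (v' u - v u) \<le> v' u - v u + \<sigma> * (z u - z' u)"
        using d \<open>\<sigma> = 1\<close> by auto
    qed
  qed
  show False
  proof (rule ahead_impossible[OF tl init(2)])
    fix b assume b: "T \<le> b" "b < tb"
    show "0 < z b - z' b" using pos[OF b] by simp
    show "v' T - v T \<le> v' b - v b"
    proof (rule bounded_primitive_mono[OF tail_diff_v[OF tl] order_refl b(1)])
      fix u assume "T \<le> u" "u \<le> b"
      then show "0 \<le> v' u - v u + \<sigma> * (z u - z' u)" using pos[of u] b \<open>\<sigma> = 1\<close> by auto
    qed (use b in auto)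
  qed
qed

text \<open>
  From time \<open>T\<close> on let the control be zero. Then \<open>v\<close> increases at rate at least \<open>1/2\<close>, and
  the inequality expresses that \<open>z\<^sup>2\<close> is not negative at the optimal time.
\<close>
lemma zero_control_bound:
  assumes "\<sigma> = -1" and k: "K k1 k2" "solves_closed \<sigma> k1 k2 tb z1 v1" "z1 0 = z 0" "v1 0 = v 0"
    and T: "0 \<le> T" "T < tb" and vT: "-1/2 \<le> v1 T"
  shows "2 * v1 T * (tb - T) \<le> (z1 T)\<^sup>2 - (tb - T)\<^sup>2 / 2"
proof -
  let ?l1 = "\<lambda>t. if t < T then k1 t else 0" and ?l2 = "\<lambda>t. if t < T then k2 t else 0"
  have l: "K ?l1 ?l2" by (rule K_switch[OF k(1) K_zero])
  obtain z2 v2 where s2: "solves_closed \<sigma> ?l1 ?l2 tb z2 v2" "z2 0 = z 0" "v2 0 = v 0"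
    using never_earlier_closed[OF l] by blast
  have eq: "z1 T = z2 T" "v1 T = v2 T"
    using agree_before_switch[OF k(1) l k(2) s2(1) _ _ _ T] k s2 by auto
  have vbp: "bounded_primitive v2 (\<lambda>t. 1 - \<sigma> * z2 t + v2 t + ?l2 t) T tb"
    by (rule bounded_primitive_subinterval[OF closed_v_bp[OF s2(1)]]) (use T in auto)
  have z2: "0 \<le> z2 t" if "T \<le> t" "t \<le> tb" for t
    using closed_pos[OF s2(1), of t] s2(1) that T unfolding solves_closed_def by (cases "t = tb") auto
  have v2: "v2 T + (t - T) / 2 \<le> v2 t" if t: "T \<le> t" "t \<le> tb" for t
  proof -
    have "(v2 T + 1) * exp (1 * (t - T)) \<le> v2 t + 1"
    proof (rule Gronwall_lower_const[OF bounded_primitive_subinterval[OF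
            bounded_primitive_add[OF vbp bounded_primitive_const[of 1]] order_refl t(2)] t(1)])
      fix u assume "u \<in> {T..t}"
      then show "1 * (v2 u + 1) \<le> 1 - \<sigma> * z2 u + v2 u + ?l2 u + 0"
        using z2[of u] t \<open>\<sigma> = -1\<close> by auto
    qed
    moreover have "(v2 T + 1) * (1 + (t - T)) \<le> (v2 T + 1) * exp (t - T)"
      using vT eq by (intro mult_left_mono exp_ge_add_one_self) auto
    moreover have "(1 / 2) * (t - T) \<le> (v2 T + 1) * (t - T)"
      using vT eq t by (intro mult_right_mono) auto
    ultimately show ?thesis by (simp add: algebra_simps)
  qed
  let ?Y = "\<lambda>t. (z2 t)\<^sup>2 + (2 * v2 T * (t - T) + (t - T)\<^sup>2 / 2)"
  have lin: "bounded_primitive (\<lambda>t. 2 * v2 T * (t - T) + (t - T)\<^sup>2 / 2) (\<lambda>t. 2 * v2 T + (t - T)) T tb"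
    by (rule bounded_primitive_of_derivative) (auto intro!: derivative_eq_intros continuous_intros)
  have Y: "bounded_primitive ?Y (\<lambda>t. (- 2 * v2 t + 2 * ?l1 t * z2 t) + (2 * v2 T + (t - T))) T tb"
    by (rule bounded_primitive_add[OF bounded_primitive_subinterval[OF closed_w_bp[OF s2(1)]] lin]) (use T in auto)
  have "(-1) * ?Y T \<le> (-1) * ?Y tb"
  proof (rule bounded_primitive_mono[OF bounded_primitive_cmult[OF Y, of "-1"] order_refl])
    fix u assume "T \<le> u" "u \<le> tb"
    then show "0 \<le> - 1 * ((- 2 * v2 u + 2 * ?l1 u * z2 u) + (2 * v2 T + (u - T)))"
      using v2[of u] by (simp add: field_simps)
  qed (use T in auto)
  then have h: "2 * v2 T * (tb - T) + (tb - T)\<^sup>2 / 2 \<le> (z2 T)\<^sup>2 - (z2 tb)\<^sup>2" by simp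
  have "A \<le> C - B" if "A + B \<le> C - D" "0 \<le> D" for A B C D :: real using that by linarith
  from this[OF h zero_le_power2] show ?thesis unfolding eq .
qed

text \<open>
  For \<open>\<sigma> = -1\<close> a lead in \<open>v\<close> is diminished by a lead in \<open>z\<close>. With
  \<open>d = z - z'\<close>, \<open>e = v' - v\<close> and the remaining time \<open>s\<close>, however,
  \<open>zero_control_bound\<close> limits the growth of \<open>d\<close> so much that \<open>e > 4 * d * s\<close> persists when
  \<open>s \<le> 1/8\<close>. It follows that \<open>e / s\<close> does not decrease, while \<open>e\<close> decreases at rate at most
  \<open>z\<close>, which tends to \<open>0\<close>; hence \<open>e\<close> does not tend to \<open>0\<close>.
\<close>
lemma ahead_impossible_oscillating:
  assumes \<sigma>1: "\<sigma> = -1" and tl: "tail T k1 k2 z' v'"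
    and near: "tb - T \<le> 1 / 8" "\<And>t. T \<le> t \<Longrightarrow> t \<le> tb \<Longrightarrow> - 1 / 2 \<le> v t"
    and init: "0 < z T - z' T" "0 < (v' T - v T) - 4 * (tb - T) * (z T - z' T)"
  shows False
proof -
  note t = tailD[OF tl]
  have init': "z' 0 = z 0" "v' 0 = v 0" using tl by (auto simp: tail_def)
  let ?d = "\<lambda>t. z t - z' t" and ?e = "\<lambda>t. v' t - v t"
  let ?J = "\<lambda>t. ?e t - 4 * ((tb - t) * ?d t)"
  let ?gd = "\<lambda>t. ?e t / z t + v' t / (z t * z' t) * ?d t"
  let ?gJ = "\<lambda>t. (?e t + \<sigma> * ?d t) - 4 * ((- 1) * ?d t + (tb - t) * ?gd t)"
  have pos: "0 < ?d b \<and> 0 < ?J b" if b: "T \<le> b" "b < tb" for b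
  proof -
    obtain M where M: "0 \<le> M" "\<And>t. T \<le> t \<Longrightarrow> t \<le> b \<Longrightarrow> \<bar>v' t / (z t * z' t)\<bar> \<le> M"
      "\<And>t. T \<le> t \<Longrightarrow> t \<le> b \<Longrightarrow> \<bar>1 / z t\<bar> \<le> M"
      using tail_coefficient_bound[OF tl b] by metis
    have sbp: "bounded_primitive (\<lambda>t. tb - t) (\<lambda>t. - 1) T b"
      by (rule bounded_primitive_of_derivative) (auto intro!: derivative_eq_intros)
    have dbp: "bounded_primitive ?d ?gd T b" by (rule tail_diff_z[OF tl b(2)])
    have ebp: "bounded_primitive ?e (\<lambda>t. ?e t + \<sigma> * ?d t) T b"
      by (rule bounded_primitive_subinterval[OF tail_diff_v[OF tl]]) (use b in auto)
    have Jbp: "bounded_primitive ?J ?gJ T b"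
      by (rule bounded_primitive_diff[OF ebp bounded_primitive_cmult[OF bounded_primitive_mult[OF sbp dbp]]])
    have J0: "0 < ?J T" using init(2) by (simp only: mult.assoc)
    show ?thesis
    proof (rule positive_pair_persists[where X="?d" and Y="?J" and K=M, OF dbp Jbp b(1) init(1) J0])
      fix u assume u: "T \<le> u" "u \<le> b"
        and nn: "\<And>s. T \<le> s \<Longrightarrow> s \<le> u \<Longrightarrow> 0 \<le> ?d s \<and> 0 \<le> ?J s"
      define Z Z' V' d e s where "Z = z u" and "Z' = z' u" and "V' = v' u" and "d = ?d u"
        and "e = ?e u" and "s = tb - u"
      have s: "0 < s" "s \<le> 1 / 8" using u b near by (auto simp: s_def)
      have Z: "0 < Z" "0 < Z'" using tail_pos[OF tl u(1)] u b by (auto simp: Z_def Z'_def)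
      have dJ: "0 \<le> d" "0 \<le> e - 4 * (s * d)" using nn[OF u(1) order_refl] by (auto simp: d_def e_def s_def)
      have ZZ': "Z' \<le> Z" using dJ(1) by (simp add: d_def Z_def Z'_def)
      have e0: "0 \<le> e" using dJ s by (smt (verit) mult_nonneg_nonneg)
      have "- 1 / 2 \<le> V'" using near(2)[of u] u b e0 by (simp add: e_def V'_def)
      then have zc: "2 * V' * s \<le> Z'\<^sup>2 - s\<^sup>2 / 2"
        using zero_control_bound[OF \<sigma>1 t(3,4) init', of u] u b t(1) by (simp add: V'_def Z'_def s_def)
      have Md: "- M \<le> V' / (Z * Z')" "1 / Z \<le> M"
        using abs_le_D2[OF M(2)[OF u]] abs_le_D1[OF M(3)[OF u]] by (simp_all add: V'_def Z_def Z'_def)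
      have g1: "- M * d \<le> e / Z + V' / (Z * Z') * d"
      proof -
        have "- M * d \<le> V' / (Z * Z') * d" using Md dJ by (intro mult_right_mono) auto
        moreover have "0 \<le> e / Z" using e0 Z by simp
        ultimately show ?thesis by linarith
      qed
      \<comment> \<open>With \<open>r = s / z\<close>, the derivative of \<open>J = e - 4 * s * d\<close> is at least
        \<open>- 4 * r * J + e + d * (1 - 16 * s * r + r\<^sup>2)\<close>, and the last factor is not negative if \<open>s \<le> 1/8\<close>.\<close>
      have main: "- M * (e - 4 * (s * d)) \<le> (e - d) - 4 * ((- 1) * d + s * (e / Z + V' / (Z * Z') * d))"
      proof -
        define r where "r = s / Z"
        have r: "0 \<le> r" using s Z by (simp add: r_def)
        have V: "s * (V' / (Z * Z')) \<le> 1 / 2 - r\<^sup>2 / 4"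
        proof -
          have "s * (V' / (Z * Z')) = (2 * V' * s) / (2 * Z * Z')" using Z by (simp add: field_simps)
          also have "\<dots> \<le> (Z'\<^sup>2 - s\<^sup>2 / 2) / (2 * Z * Z')" using zc Z by (intro divide_right_mono) auto
          also have "\<dots> = Z' / Z / 2 - s\<^sup>2 / (4 * Z * Z')" using Z by (simp add: field_simps power2_eq_square)
          also have "\<dots> \<le> 1 / 2 - s\<^sup>2 / (4 * Z * Z)"
          proof (rule diff_mono)
            show "Z' / Z / 2 \<le> 1 / 2" using Z ZZ' by (simp add: field_simps)
            show "s\<^sup>2 / (4 * Z * Z) \<le> s\<^sup>2 / (4 * Z * Z')"
              using Z ZZ' by (intro divide_left_mono) auto
          qed
          also have "s\<^sup>2 / (4 * Z * Z) = r\<^sup>2 / 4" by (simp add: r_def power2_eq_square)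
          finally show ?thesis .
        qed
        then have V: "s * (V' / (Z * Z')) * d \<le> (1 / 2 - r\<^sup>2 / 4) * d" using dJ(1) by (rule mult_right_mono)
        define J where "J = e - 4 * (s * d)"
        have J: "0 \<le> J" "e = J + 4 * (s * d)" using dJ by (auto simp: J_def)
        have q: "16 * (s * r) \<le> 1 + r\<^sup>2"
        proof -
          have "16 * (s * r) \<le> 16 * ((1 / 8) * r)" using s r by (intro mult_left_mono mult_right_mono) auto
          also have "\<dots> \<le> 1 + r\<^sup>2" using zero_le_power2[of "r - 1"] by (simp add: power2_eq_square algebra_simps)
          finally show ?thesis .
        qed
        define P Q where "P = s * (e / Z)" and "Q = s * (V' / (Z * Z')) * d"
        have "16 * (s * r) * d \<le> (1 + r\<^sup>2) * d" using q dJ(1) by (rule mult_right_mono)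
        moreover have "P = r * J + 4 * ((s * r) * d)"
          unfolding P_def J(2) using Z by (simp add: r_def field_simps)
        moreover have "(e - d) - 4 * ((- 1) * d + s * (e / Z + V' / (Z * Z') * d)) = e + 3 * d - 4 * P - 4 * Q"
          by (simp add: P_def Q_def algebra_simps)
        moreover have "Q \<le> (1 / 2 - r\<^sup>2 / 4) * d" using V by (simp only: Q_def)
        then have "4 * Q \<le> 2 * d - r\<^sup>2 * d" by (simp add: left_diff_distrib)
        ultimately have "(e - d) - 4 * ((- 1) * d + s * (e / Z + V' / (Z * Z') * d)) \<ge> e - 4 * (r * J)"
          by (simp add: distrib_right)
        moreover have "4 * (r * J) \<le> M * J"
        proof -
          have "4 * r = (4 * s) * (1 / Z)" by (simp add: r_def)
          also have "\<dots> \<le> 1 * (1 / Z)" using s Z by (intro mult_right_mono) auto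
          finally have "4 * r \<le> M" using Md by simp
          then show ?thesis using J(1) mult_right_mono[of "4 * r" M J] by simp
        qed
        ultimately show ?thesis using e0 by (simp add: J_def[symmetric])
      qed
      show "- M * ?d u \<le> ?gd u \<and> - M * ?J u \<le> ?gJ u"
        using g1 main \<sigma>1 unfolding Z_def Z'_def V'_def d_def e_def s_def by simp
    qed
  qed
  have e_bigger: "?d u * (4 * (tb - u)) < ?e u" if "T \<le> u" "u < tb" for u
  proof -
    have "4 * ((tb - u) * ?d u) < ?e u" using pos[OF that] by linarith
    then show ?thesis by (simp only: mult_ac)
  qed
  have eT: "0 < ?e T" using e_bigger[of T] pos[of T] t by (smt (verit) mult_pos_pos)
  define c where "c = ?e T / (tb - T)"
  have c: "0 < c" using eT t by (simp add: c_def)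
  have lower: "c * (tb - b) \<le> ?e b" if b: "T \<le> b" "b < tb" for b
  proof -
    have "?e T * exp (ln (tb - b) - ln (tb - T)) \<le> ?e b"
    proof (rule Gronwall_lower[OF bounded_primitive_subinterval[OF tail_diff_v[OF tl] order_refl less_imp_le[OF b(2)]] b(1),
          of "\<lambda>t. ln (tb - t)" "\<lambda>t. - 1 / (tb - t)"])
      show "continuous_on {T..b} (\<lambda>t. - 1 / (tb - t))" using b by (intro continuous_intros) auto
      fix u assume "u \<in> {T..b}"
      then have u: "T \<le> u" "u < tb" using b by auto
      show "((\<lambda>t. ln (tb - t)) has_real_derivative - 1 / (tb - u)) (at u within {T..b})"
        using u by (auto intro!: derivative_eq_intros)
      have "?d u * (tb - u) \<le> ?d u * (4 * (tb - u))" using pos[OF u] u by (intro mult_left_mono) auto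
      then have "?d u * (tb - u) \<le> ?e u" using e_bigger[OF u] by simp
      then have "?d u \<le> ?e u / (tb - u)" using u by (simp add: pos_le_divide_eq)
      moreover have "0 \<le> ?e u" using \<open>?d u * (tb - u) \<le> ?e u\<close> pos[OF u] u by (smt (verit) mult_nonneg_nonneg)
      ultimately show "- 1 / (tb - u) * ?e u \<le> ?e u + \<sigma> * ?d u" using \<sigma>1 by simp
    qed
    moreover have "exp (ln (tb - b) - ln (tb - T)) = (tb - b) / (tb - T)"
      using b by (simp add: exp_diff)
    ultimately show ?thesis by (simp add: c_def)
  qed
  obtain T1 where T1: "0 \<le> T1" "T1 < tb" "\<And>t. T1 \<le> t \<Longrightarrow> t \<le> tb \<Longrightarrow> \<bar>z t\<bar> < c / 2"
    using z_small[of "c / 2"] c by auto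
  define T2 where "T2 = max T T1"
  have T2: "T \<le> T2" "T1 \<le> T2" "T2 < tb" using T1 t by (auto simp: T2_def)
  show False
  proof (rule ahead_impossible[OF tail_later[OF tl T2(1,3)], of "c * (tb - T2) / 2"])
    show "0 < c * (tb - T2) / 2" using c T2 by simp
    fix b assume b: "T2 \<le> b" "b < tb"
    show "0 < ?d b" using pos[of b] b T2 by auto
    have ce: "bounded_primitive (\<lambda>t. ?e t + c / 2 * t) (\<lambda>t. (?e t + \<sigma> * ?d t) + c / 2 * 1) T tb"
      by (intro bounded_primitive_add tail_diff_v[OF tl] bounded_primitive_cmult bounded_primitive_of_derivative)
         (auto intro!: derivative_eq_intros)
    have "?e T2 + c / 2 * T2 \<le> ?e b + c / 2 * b"
    proof (rule bounded_primitive_mono[OF ce T2(1) b(1)])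
      fix u assume "T2 \<le> u" "u \<le> b"
      then have u: "T \<le> u" "u < tb" "T1 \<le> u" using T2 b by auto
      have "0 \<le> c * (tb - u)" using c u by simp
      then have "0 \<le> ?e u" using lower[OF u(1,2)] by linarith
      moreover have "?d u \<le> c / 2" using T1(3)[of u] u tail_pos[OF tl u(1,2)] by auto
      ultimately show "0 \<le> (?e u + \<sigma> * ?d u) + c / 2 * 1" using \<sigma>1 by simp
    qed (use b in auto)
    moreover have "c / 2 * (b - T2) \<le> c / 2 * (tb - T2)" using c b by (intro mult_left_mono) auto
    moreover have "c * (tb - T2) \<le> ?e T2" by (rule lower[OF T2(1,3)])
    moreover have "c / 2 * (b - T2) = c / 2 * b - c / 2 * T2" "c / 2 * (tb - T2) = c * (tb - T2) / 2"
      by (simp_all add: right_diff_distrib)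
    ultimately show "c * (tb - T2) / 2 \<le> ?e b" by linarith
  qed
qed

text \<open>
  If \<open>z\<close> is at least of order \<open>\<surd>s\<close>, where \<open>s\<close> is the remaining time, then the equations of \<open>D = z\<^sup>2 - z'\<^sup>2\<close> and \<open>e = v' - v\<close> have coefficients
  of order \<open>1/\<surd>s\<close>, which are integrable. Hence only the sign of \<open>D\<close> matters near the end: the cone \<open>D > \<surd>s * \<bar>e\<bar>\<close>, which opens to a half plane, is invariant.
\<close>
lemma ahead_impossible_transversal:
  assumes tl: "tail T k1 k2 z' v'"
    and m: "0 < m" "\<And>t. T \<le> t \<Longrightarrow> t < tb \<Longrightarrow> m * (tb - t) \<le> (z t)\<^sup>2"
    and near: "tb - T \<le> 1" "(2 * \<beta> + 1) / sqrt m + 2 + sqrt (tb - T) \<le> 1 / (2 * sqrt (tb - T))"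
    and init: "0 < z T * (z T - z' T) - sqrt (tb - T) * (v' T - v T)"
      "0 < z T * (z T - z' T) + sqrt (tb - T) * (v' T - v T)"
  shows False
proof -
  note t = tailD[OF tl]
  let ?th = "\<lambda>t. sqrt (tb - t)"
  let ?e = "\<lambda>t. v' t - v t" and ?D = "\<lambda>t. (z t)\<^sup>2 - (z' t)\<^sup>2"
  let ?ge = "\<lambda>t. ?e t + \<sigma> * (z t - z' t)" and ?gD = "\<lambda>t. 2 * ?e t + 2 * (c1 t * (z t - z' t))"
  let ?X = "\<lambda>t. ?D t - ?th t * ?e t" and ?Y = "\<lambda>t. ?D t + ?th t * ?e t"
  let ?gth = "\<lambda>t. - 1 / (2 * ?th t) * ?e t + ?th t * ?ge t"
  define M where "M = (2 * \<beta> + 1) / sqrt m"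
  have M0: "0 \<le> M" using \<beta>_nonneg m by (simp add: M_def)
  have th: "0 < ?th u" "?th u \<le> 1" "M + 2 + ?th u \<le> 1 / (2 * ?th u)" if u: "T \<le> u" "u < tb" for u
  proof -
    show 0: "0 < ?th u" using u by simp
    have le: "?th u \<le> ?th T" using u by simp
    show "?th u \<le> 1" using u near by (simp add: real_le_lsqrt)
    have "M + 2 + ?th u \<le> M + 2 + ?th T" using le by simp
    also have "\<dots> \<le> 1 / (2 * ?th T)" using near(2) by (simp add: M_def)
    also have "\<dots> \<le> 1 / (2 * ?th u)" using le 0 by (intro divide_left_mono) auto
    finally show "M + 2 + ?th u \<le> 1 / (2 * ?th u)" .
  qed
  have dD: "\<bar>z u - z' u\<bar> * (sqrt m * ?th u) \<le> \<bar>?D u\<bar>" if u: "T \<le> u" "u < tb" for u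
  proof -
    have p: "0 < z u" "0 < z' u" using tail_pos[OF tl u] by auto
    have "sqrt (m * (tb - u)) \<le> z u" using m(2)[OF u] p by (intro real_le_lsqrt) auto
    then have "sqrt m * ?th u \<le> z u + z' u" using p by (simp add: real_sqrt_mult)
    then have "\<bar>z u - z' u\<bar> * (sqrt m * ?th u) \<le> \<bar>z u - z' u\<bar> * (z u + z' u)" by (rule mult_left_mono) simp
    also have "\<dots> = \<bar>(z u - z' u) * (z u + z' u)\<bar>" using p by (simp add: abs_mult)
    also have "(z u - z' u) * (z u + z' u) = ?D u" by (simp add: algebra_simps power2_eq_square)
    finally show ?thesis .
  qed
  have coef: "\<bar>a * (z u - z' u)\<bar> \<le> M * \<bar>?D u\<bar> / ?th u"
    if u: "T \<le> u" "u < tb" and a: "\<bar>a\<bar> \<le> 2 * \<beta> + 1" for a u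
  proof -
    have "\<bar>z u - z' u\<bar> \<le> \<bar>?D u\<bar> / (sqrt m * ?th u)"
      using dD[OF u] th(1)[OF u] m(1) by (simp add: pos_le_divide_eq)
    then have "\<bar>a\<bar> * \<bar>z u - z' u\<bar> \<le> (2 * \<beta> + 1) * (\<bar>?D u\<bar> / (sqrt m * ?th u))"
      using a by (intro mult_mono) auto
    then show ?thesis by (simp add: M_def abs_mult mult.assoc)
  qed
  have pos: "0 < ?X b \<and> 0 < ?Y b" if b: "T \<le> b" "b < tb" for b
  proof -
    \<comment> \<open>With \<open>\<theta> = \<surd>s\<close>, the derivative \<open>- 1 / (2 * \<theta>)\<close> of \<open>\<theta>\<close> outweighs all coefficients.\<close>
    define N where "N = (2 + 1 / (2 * ?th b) + M) / (2 * ?th b)"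
    have thbp: "bounded_primitive ?th (\<lambda>t. - 1 / (2 * ?th t)) T b"
      by (rule bounded_primitive_of_derivative)
         (use b in \<open>auto intro!: derivative_eq_intros continuous_intros simp: field_simps\<close>)
    have Dbp: "bounded_primitive ?D ?gD T b"
      by (rule bounded_primitive_subinterval[OF tail_diff_w[OF tl]]) (use b in auto)
    have ebp: "bounded_primitive ?e ?ge T b"
      by (rule bounded_primitive_subinterval[OF tail_diff_v[OF tl]]) (use b in auto)
    note the = bounded_primitive_mult[OF thbp ebp]
    note Xbp = bounded_primitive_diff[OF Dbp the] and Ybp = bounded_primitive_add[OF Dbp the]
    have zT: "0 < z T" "0 < z' T" using tail_pos[OF tl order_refl t(2)] by auto
    have "0 < z T * (z T - z' T)" using init by linarith
    then have "0 < z T - z' T" using zT by (simp add: zero_less_mult_iff)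
    then have "z T * (z T - z' T) \<le> (z T + z' T) * (z T - z' T)" using zT by (intro mult_right_mono) auto
    also have "\<dots> = ?D T" by (simp add: algebra_simps power2_eq_square)
    finally have XY0: "0 < ?X T" "0 < ?Y T" using init by auto
    show ?thesis
    proof (rule positive_pair_persists[where X="?X" and Y="?Y" and K=N, OF Xbp Ybp b(1) XY0])
      fix u assume u: "T \<le> u" "u \<le> b"
        and nn: "\<And>s. T \<le> s \<Longrightarrow> s \<le> u \<Longrightarrow> 0 \<le> ?X s \<and> 0 \<le> ?Y s"
      have ub: "u < tb" using u b by simp
      define h d e D where "h = ?th u" and "d = z u - z' u" and "e = ?e u" and "D = ?D u"
      have h: "0 < h" "h \<le> 1" "M + 2 + h \<le> 1 / (2 * h)" using th[OF u(1) ub] by (auto simp: h_def)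
      have XY: "0 \<le> D - h * e" "0 \<le> D + h * e" using nn[OF u(1) order_refl] by (auto simp: h_def e_def D_def)
      have D0: "0 \<le> D" using XY by linarith
      have hb: "?th b \<le> h" "0 < ?th b" using u b by (auto simp: h_def)
      have c1b: "\<bar>c1 u\<bar> \<le> \<beta>" using c_bound(1)[of u] u t by auto
      have "\<bar>h * \<sigma>\<bar> \<le> 1" using h \<sigma> by (simp add: abs_mult)
      then have "\<bar>2 * c1 u - h * \<sigma>\<bar> \<le> 2 * \<beta> + 1" "\<bar>2 * c1 u + h * \<sigma>\<bar> \<le> 2 * \<beta> + 1" using c1b by linarith+
      then have A: "\<bar>(2 * c1 u - h * \<sigma>) * d\<bar> \<le> M * D / h" "\<bar>(2 * c1 u + h * \<sigma>) * d\<bar> \<le> M * D / h"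
        using coef[OF u(1) ub] D0 unfolding d_def D_def h_def by (metis abs_of_nonneg)+
      define X Y where "X = D - h * e" and "Y = D + h * e"
      have De: "D = (X + Y) / 2" "e = (Y - X) / (2 * h)" using h by (auto simp: X_def Y_def)
      have XY': "0 \<le> X" "0 \<le> Y" using XY by (auto simp: X_def Y_def)
      have MD: "M * D / h = (M * X + M * Y) / (2 * h)" unfolding De by (simp add: field_simps)
      have Nge: "(2 + 1 / (2 * h) + M) / (2 * h) \<le> N"
        unfolding N_def using hb h M0 by (intro frac_le add_mono divide_left_mono) auto
      have aux: "- N * W \<le> (q - M) * W' / (2 * h) - (q + M) * W / (2 * h)"
        if "M \<le> q" "q \<le> 2 + 1 / (2 * h)" "0 \<le> W" "0 \<le> W'" for q W W'
      proof -
        have "(q + M) / (2 * h) \<le> (2 + 1 / (2 * h) + M) / (2 * h)" using that h by (intro divide_right_mono) auto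
        then have "(q + M) / (2 * h) * W \<le> N * W" using Nge that by (intro mult_right_mono) auto
        moreover have "0 \<le> (q - M) * W' / (2 * h)" using that h by simp
        ultimately show ?thesis by simp
      qed
      have 1: "- N * X \<le> (2 * e + 2 * (c1 u * d)) - (- 1 / (2 * h) * e + h * (e + \<sigma> * d))"
      proof -
        define q where "q = 2 + 1 / (2 * h) - h"
        have "(2 * e + 2 * (c1 u * d)) - (- 1 / (2 * h) * e + h * (e + \<sigma> * d)) = q * e + (2 * c1 u - h * \<sigma>) * d"
          by (simp add: q_def algebra_simps)
        moreover have "q * e = (q * Y - q * X) / (2 * h)" unfolding De(2) using h by (simp add: field_simps)
        moreover have "- N * X \<le> (q - M) * Y / (2 * h) - (q + M) * X / (2 * h)"
          using h XY' by (intro aux) (auto simp: q_def)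
        then have "- N * X \<le> (q * Y - q * X) / (2 * h) - (M * X + M * Y) / (2 * h)"
          using h by (simp add: field_simps)
        ultimately show ?thesis using A(1) MD by linarith
      qed
      have 2: "- N * Y \<le> (2 * e + 2 * (c1 u * d)) + (- 1 / (2 * h) * e + h * (e + \<sigma> * d))"
      proof -
        define q where "q = 1 / (2 * h) - 2 - h"
        have "(2 * e + 2 * (c1 u * d)) + (- 1 / (2 * h) * e + h * (e + \<sigma> * d)) = - (q * e) + (2 * c1 u + h * \<sigma>) * d"
          by (simp add: q_def algebra_simps)
        moreover have "q * e = (q * Y - q * X) / (2 * h)" unfolding De(2) using h by (simp add: field_simps)
        moreover have "- N * Y \<le> (q - M) * X / (2 * h) - (q + M) * Y / (2 * h)"
          using h XY' by (intro aux) (auto simp: q_def)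
        then have "- N * Y \<le> - ((q * Y - q * X) / (2 * h)) - (M * X + M * Y) / (2 * h)"
          using h by (simp add: field_simps)
        ultimately show ?thesis using A(2) MD by linarith
      qed
      show "- N * ?X u \<le> ?gD u - ?gth u \<and> - N * ?Y u \<le> ?gD u + ?gth u"
        using 1 2 unfolding X_def Y_def h_def d_def e_def D_def by blast
    qed
  qed
  define L where "L = 2 + 2 * M"
  have L0: "0 \<le> L" using M0 by (simp add: L_def)
  have DT: "0 < ?D T" using pos[of T] t by auto
  have low: "?D T * exp (- (2 * L) * ?th T) \<le> ?D b" if b: "T \<le> b" "b < tb" for b
  proof -
    have "?D T * exp (2 * L * ?th b - 2 * L * ?th T) \<le> ?D b"
    proof (rule Gronwall_lower[OF bounded_primitive_subinterval[OF tail_diff_w[OF tl] order_refl less_imp_le[OF b(2)]] b(1),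
          of "\<lambda>t. 2 * L * ?th t" "\<lambda>t. - L / ?th t"])
      show "continuous_on {T..b} (\<lambda>t. - L / ?th t)" using b by (intro continuous_intros) auto
      fix u assume "u \<in> {T..b}"
      then have u: "T \<le> u" "u < tb" using b by auto
      show "((\<lambda>t. 2 * L * ?th t) has_real_derivative - L / ?th u) (at u within {T..b})"
        using u by (auto intro!: derivative_eq_intros simp: field_simps)
      have h: "0 < ?th u" "?th u \<le> 1" using th[OF u] by auto
      have D: "\<bar>?th u * ?e u\<bar> \<le> ?D u" using pos[OF u] by linarith
      then have e: "\<bar>?e u\<bar> \<le> ?D u / ?th u" using h by (simp add: abs_mult pos_le_divide_eq mult.commute)
      have c1b: "\<bar>2 * c1 u\<bar> \<le> 2 * \<beta> + 1" using c_bound(1)[of u] u t by auto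
      have "\<bar>?D u\<bar> = ?D u" using D by linarith
      with coef[OF u c1b] have c: "\<bar>2 * (c1 u * (z u - z' u))\<bar> \<le> M * ?D u / ?th u"
        by (simp only: mult.assoc)
      have eq: "- (2 + 2 * M) / h * D = - (2 * (D / h)) - 2 * (M * D / h)" if "h \<noteq> 0" for h D :: real
        using that by (simp add: field_simps)
      have L: "- L / ?th u * ?D u = - (2 * (?D u / ?th u)) - 2 * (M * ?D u / ?th u)"
        unfolding L_def by (rule eq) (use h in simp)
      have 0: "0 \<le> M * ?D u / ?th u" using M0 h D by simp
      have "- (2 * A) - 2 * B \<le> 2 * e + 2 * X" if "\<bar>2 * X\<bar> \<le> B" "\<bar>e\<bar> \<le> A" "0 \<le> B" for A B e X :: real
        using that by linarith
      from this[OF c e 0] show "- L / ?th u * ?D u \<le> 2 * ?e u + 2 * (c1 u * (z u - z' u))"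
        unfolding L .
    qed
    moreover have "?D T * exp (- (2 * L) * ?th T) \<le> ?D T * exp (2 * L * ?th b - 2 * L * ?th T)"
    proof (rule mult_left_mono)
      have "0 \<le> 2 * L * ?th b" using L0 b by simp
      then show "exp (- (2 * L) * ?th T) \<le> exp (2 * L * ?th b - 2 * L * ?th T)" by simp
    qed (use DT in simp)
    ultimately show ?thesis by linarith
  qed
  have "continuous_on {T..tb} ?D" by (rule bounded_primitive_continuous[OF tail_diff_w[OF tl]])
  then have "(?D \<longlongrightarrow> ?D tb) (at_left tb)" by (rule continuous_on_Icc_at_leftD[OF _ t(2)])
  then have "?D T * exp (- (2 * L) * ?th T) \<le> ?D tb"
    by (rule tendsto_lowerbound) (use t(2) low in \<open>auto intro!: eventually_at_leftI[of T]\<close>)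
  moreover have "0 < ?D T * exp (- (2 * L) * ?th T)" using DT by simp
  ultimately show False using tail_w_end[OF tl] by linarith
qed

end

section \<open>The adjoint equation\<close>

context optimal_quenching
begin

text \<open>
  The transposed linearisation of the system in \<open>(z, v)\<close>. The forcing enters additively and does
  not occur, so that solutions are continuously differentiable.
\<close>
definition adjoint :: "(real \<Rightarrow> real) \<Rightarrow> (real \<Rightarrow> real) \<Rightarrow> bool" where
  "adjoint p q \<longleftrightarrow> (\<forall>t\<in>{0..<tb}.
     (p has_real_derivative - (v t / (z t)\<^sup>2) * p t + \<sigma> * q t) (at t within {0..<tb}) \<and>
     (q has_real_derivative p t / z t - q t) (at t within {0..<tb}))"

lemma continuous_on_state:
  assumes "0 \<le> T" "T < tb"
  shows "continuous_on {0..T} z" "continuous_on {0..T} v" "\<And>t. t \<in> {0..T} \<Longrightarrow> z t \<noteq> 0"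
proof -
  have sub: "{0..T} \<subseteq> {0..tb}" using assms by auto
  show "continuous_on {0..T} z" "continuous_on {0..T} v"
    using continuous_on_subset[OF closed_cont(1)[OF sol] sub] continuous_on_subset[OF closed_cont(2)[OF sol] sub] by auto
  show "z t \<noteq> 0" if "t \<in> {0..T}" for t using closed_pos[OF sol, of t] that assms by auto
qed

lemma adjoint_continuous:
  assumes "adjoint p q" shows "continuous_on {0..<tb} p" "continuous_on {0..<tb} q"
  using assms unfolding adjoint_def by (auto intro!: DERIV_continuous_on)

lemma adjoint_bp:
  assumes "adjoint p q" "0 \<le> T" "T < tb"
  shows "bounded_primitive p (\<lambda>t. - (v t / (z t)\<^sup>2) * p t + \<sigma> * q t) 0 T"
    "bounded_primitive q (\<lambda>t. p t / z t - q t) 0 T"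
proof -
  have sub: "{0..T} \<subseteq> {0..<tb}" using assms by auto
  note c = continuous_on_state[OF assms(2,3)] continuous_on_subset[OF adjoint_continuous(1)[OF assms(1)] sub]
    continuous_on_subset[OF adjoint_continuous(2)[OF assms(1)] sub]
  show "bounded_primitive p (\<lambda>t. - (v t / (z t)\<^sup>2) * p t + \<sigma> * q t) 0 T"
  proof (rule bounded_primitive_of_derivative)
    show "(p has_real_derivative - (v t / (z t)\<^sup>2) * p t + \<sigma> * q t) (at t within {0..T})" if "t \<in> {0..T}" for t
      using assms that unfolding adjoint_def by (intro DERIV_subset[OF _ sub]) auto
  qed (intro continuous_intros c, use c(3) in auto)
  show "bounded_primitive q (\<lambda>t. p t / z t - q t) 0 T"
  proof (rule bounded_primitive_of_derivative)
    show "(q has_real_derivative p t / z t - q t) (at t within {0..T})" if "t \<in> {0..T}" for t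
      using assms that unfolding adjoint_def by (intro DERIV_subset[OF _ sub]) auto
  qed (intro continuous_intros c, use c(3) in auto)
qed

lemma adjoint_combination:
  assumes "adjoint p1 q1" "adjoint p2 q2"
  shows "adjoint (\<lambda>t. a * p1 t + b * p2 t) (\<lambda>t. a * q1 t + b * q2 t)"
  unfolding adjoint_def
proof (intro ballI conjI)
  fix t assume t: "t \<in> {0..<tb}"
  note A = assms[unfolded adjoint_def, rule_format, OF t]
  show "((\<lambda>t. a * p1 t + b * p2 t) has_real_derivative
      - (v t / (z t)\<^sup>2) * (a * p1 t + b * p2 t) + \<sigma> * (a * q1 t + b * q2 t)) (at t within {0..<tb})"
    using A by (auto intro!: derivative_eq_intros simp: algebra_simps add_divide_distrib)
  show "((\<lambda>t. a * q1 t + b * q2 t) has_real_derivative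
      (a * p1 t + b * p2 t) / z t - (a * q1 t + b * q2 t)) (at t within {0..<tb})"
    using A by (auto intro!: derivative_eq_intros simp: algebra_simps add_divide_distrib)
qed

lemma has_real_derivative_of_integral:
  fixes g :: "real \<Rightarrow> real"
  assumes cg: "\<And>T. 0 \<le> T \<Longrightarrow> T < tb \<Longrightarrow> continuous_on {0..T} g"
    and hi: "\<And>T. 0 \<le> T \<Longrightarrow> T < tb \<Longrightarrow> (g has_integral (x T - x0)) {0..T}"
    and t: "t \<in> {0..<tb}"
  shows "(x has_real_derivative g t) (at t within {0..<tb})"
proof -
  define T where "T = (t + tb) / 2"
  have T: "0 \<le> T" "T < tb" "t < T" using t tb by (auto simp: T_def)
  have "((\<lambda>u. integral {0..u} g) has_vector_derivative g t) (at t within {0..T})"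
    by (rule integral_has_vector_derivative[OF cg[OF T(1,2)]]) (use t T in auto)
  then have "((\<lambda>u. x0 + integral {0..u} g) has_real_derivative 0 + g t) (at t within {0..T})"
    unfolding has_real_derivative_iff_has_vector_derivative[symmetric] by (intro DERIV_add) auto
  moreover have "x u = x0 + integral {0..u} g" if "u \<in> {0..T}" for u
    using integral_unique[OF hi[of u]] that T by simp
  ultimately have "(x has_real_derivative g t) (at t within {0..T})"
    using has_field_derivative_transform_within[of "\<lambda>u. x0 + integral {0..u} g" "g t" t "{0..T}" 1 x] t T
    by simp
  moreover have "at t within {0..T} = at t within {0..<tb}"
    by (rule at_within_nhd[of t "{..<T}"]) (use T in auto)
  ultimately show ?thesis by simp
qed

lemma adjoint_exists: "\<exists>p q. adjoint p q \<and> p 0 = p0 \<and> q 0 = q0"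
proof -
  define G where "G t x = (- (v t / (z t)\<^sup>2) * fst x + \<sigma> * snd x, fst x / z t - snd x)" for t and x :: "real \<times> real"
  have "\<exists>x. \<forall>T. 0 \<le> T \<longrightarrow> T < tb \<longrightarrow>
    continuous_on {0..T} x \<and> ((\<lambda>s. G s (x s)) has_integral (x T - (p0, q0))) {0..T}"
  proof (rule Picard_existence)
    fix T assume T: "0 \<le> T" "T < tb"
    note c = continuous_on_state[OF T]
    have "continuous_on {0..T} (\<lambda>t. v t / (z t)\<^sup>2)" using c(3) by (intro continuous_intros c) auto
    then obtain M1 where M1: "0 \<le> M1" "\<And>t. 0 \<le> t \<Longrightarrow> t \<le> T \<Longrightarrow> \<bar>v t / (z t)\<^sup>2\<bar> \<le> M1"
      using continuous_on_Icc_bounded by blast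
    have "continuous_on {0..T} (\<lambda>t. 1 / z t)" using c(3) by (intro continuous_intros c) auto
    then obtain M2 where M2: "0 \<le> M2" "\<And>t. 0 \<le> t \<Longrightarrow> t \<le> T \<Longrightarrow> \<bar>1 / z t\<bar> \<le> M2"
      using continuous_on_Icc_bounded by blast
    have "norm (G t x - G t y) \<le> (M1 + 1 + M2 + 1) * norm (x - y)" if t: "t \<in> {0..T}" for t x y
    proof -
      define a b where "a = fst x - fst y" and "b = snd x - snd y"
      have "x - y = (a, b)" by (simp add: prod_eq_iff a_def b_def)
      then have ab: "\<bar>a\<bar> \<le> norm (x - y)" "\<bar>b\<bar> \<le> norm (x - y)"
        using norm_fst_le[of a b] norm_snd_le[of b a] by simp_all
      have e: "G t x - G t y = (- (v t / (z t)\<^sup>2) * a + \<sigma> * b, (1 / z t) * a - b)"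
        by (simp add: G_def a_def b_def algebra_simps diff_divide_distrib)
      have "norm (G t x - G t y) \<le> \<bar>- (v t / (z t)\<^sup>2) * a + \<sigma> * b\<bar> + \<bar>(1 / z t) * a - b\<bar>"
        unfolding e using norm_Pair_le by (simp only: real_norm_def[symmetric])
      also have "\<dots> \<le> (\<bar>- (v t / (z t)\<^sup>2) * a\<bar> + \<bar>\<sigma> * b\<bar>) + (\<bar>(1 / z t) * a\<bar> + \<bar>b\<bar>)"
        by (intro add_mono abs_triangle_ineq abs_triangle_ineq4)
      also have "\<bar>- (v t / (z t)\<^sup>2) * a\<bar> \<le> M1 * norm (x - y)"
        unfolding abs_mult abs_minus_cancel using M1 ab t by (intro mult_mono) auto
      also have "\<bar>\<sigma> * b\<bar> \<le> norm (x - y)" using ab \<sigma> by (simp add: abs_mult)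
      also have "\<bar>(1 / z t) * a\<bar> \<le> M2 * norm (x - y)"
        unfolding abs_mult using M2 ab t by (intro mult_mono) auto
      also note ab(2)
      finally show ?thesis by (simp add: algebra_simps)
    qed
    then show "\<exists>L. \<forall>t\<in>{0..T}. \<forall>x y. norm (G t x - G t y) \<le> L * norm (x - y)" by blast
  next
    fix T and x :: "real \<Rightarrow> real \<times> real" assume T: "0 \<le> T" "T < tb" and cx: "continuous_on {0..T} x"
    note c = continuous_on_state[OF T]
    show "(\<lambda>s. G s (x s)) integrable_on {0..T}"
      unfolding G_def by (rule integrable_continuous_interval) (intro continuous_intros c cx, use c(3) in auto)
  qed
  then obtain x where x: "\<And>T. 0 \<le> T \<Longrightarrow> T < tb \<Longrightarrow> continuous_on {0..T} x"
    "\<And>T. 0 \<le> T \<Longrightarrow> T < tb \<Longrightarrow> ((\<lambda>s. G s (x s)) has_integral (x T - (p0, q0))) {0..T}"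
    by blast
  define p where "p t = fst (x t)" for t
  define q where "q t = snd (x t)" for t
  have cpq: "continuous_on {0..T} p" "continuous_on {0..T} q" if "0 \<le> T" "T < tb" for T
    unfolding p_def q_def using x(1)[OF that] by (auto intro: continuous_intros)
  have hp: "((\<lambda>t. - (v t / (z t)\<^sup>2) * p t + \<sigma> * q t) has_integral (p T - p0)) {0..T}"
    and hq: "((\<lambda>t. p t / z t - q t) has_integral (q T - q0)) {0..T}" if "0 \<le> T" "T < tb" for T
    using has_integral_linear[OF x(2)[OF that] bounded_linear_fst] has_integral_linear[OF x(2)[OF that] bounded_linear_snd]
    by (simp_all add: o_def G_def p_def q_def)
  have "adjoint p q" unfolding adjoint_def
  proof (intro ballI conjI)
    fix t assume t: "t \<in> {0..<tb}"
    show "(p has_real_derivative - (v t / (z t)\<^sup>2) * p t + \<sigma> * q t) (at t within {0..<tb})"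
      by (rule has_real_derivative_of_integral[OF _ hp t])
         (intro continuous_intros continuous_on_state cpq, use continuous_on_state(3) in auto)
    show "(q has_real_derivative p t / z t - q t) (at t within {0..<tb})"
      by (rule has_real_derivative_of_integral[OF _ hq t])
         (intro continuous_intros continuous_on_state cpq, use continuous_on_state(3) in auto)
  qed
  moreover have "p 0 = p0" "q 0 = q0"
    using has_integral_unique[OF hp[of 0]] has_integral_unique[OF hq[of 0]] tb by fastforce+
  ultimately show ?thesis by blast
qed

lemma adjoint_Wronskian_nonzero:
  assumes "adjoint p1 q1" "adjoint p2 q2" "p1 0 * q2 0 - p2 0 * q1 0 \<noteq> 0" "0 \<le> T" "T < tb"
  shows "p1 T * q2 T - p2 T * q1 T \<noteq> 0"
proof
  assume 0: "p1 T * q2 T - p2 T * q1 T = 0"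
  note 1 = adjoint_bp[OF assms(1,4,5)] and 2 = adjoint_bp[OF assms(2,4,5)]
  note c = continuous_on_state[OF assms(4,5)]
  have "continuous_on {0..T} (\<lambda>t. v t / (z t)\<^sup>2 + 1)" using c(3) by (intro continuous_intros c) auto
  then obtain M where M: "\<And>t. 0 \<le> t \<Longrightarrow> t \<le> T \<Longrightarrow> \<bar>v t / (z t)\<^sup>2 + 1\<bar> \<le> M"
    using continuous_on_Icc_bounded by blast
  let ?W = "\<lambda>t. p1 t * q2 t - p2 t * q1 t"
  have W: "bounded_primitive ?W (\<lambda>t. - (v t / (z t)\<^sup>2 + 1) * ?W t) 0 T"
    by (rule bounded_primitive_cong[OF bounded_primitive_diff[OF bounded_primitive_mult[OF 1(1) 2(2)]
        bounded_primitive_mult[OF 2(1) 1(2)]]]) (use c(3) in \<open>auto simp: field_simps\<close>)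
  have "(?W 0)\<^sup>2 * exp (- (2 * M) * (T - 0)) \<le> (?W T)\<^sup>2"
  proof (rule Gronwall_lower_const[OF bounded_primitive_power2[OF W] assms(4)])
    fix t assume "t \<in> {0..T}"
    then have kM: "v t / (z t)\<^sup>2 + 1 \<le> M" using M[of t] by auto
    have "- (2 * M) * W\<^sup>2 \<le> 2 * W * (- k * W)" if "k \<le> M" for W k :: real
    proof -
      have "k * (2 * W\<^sup>2) \<le> M * (2 * W\<^sup>2)" using that by (intro mult_right_mono) auto
      then show ?thesis by (simp add: power2_eq_square algebra_simps)
    qed
    from this[OF kM] show "- (2 * M) * (?W t)\<^sup>2 \<le> 2 * ?W t * (- (v t / (z t)\<^sup>2 + 1) * ?W t)" .
  qed
  moreover have "0 < (?W 0)\<^sup>2 * exp (- (2 * M) * (T - 0))" using assms(3) by simp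
  ultimately show False using 0 by simp
qed

end

section \<open>First variation\<close>

context optimal_quenching
begin

text \<open>
  For an adjoint solution \<open>(p, q)\<close>, the derivative of \<open>p T * z T + q T * v T\<close> when the forcing
  moves from \<open>(c1, c2)\<close> towards \<open>(k1, k2)\<close>.
\<close>
definition variation :: "(real \<Rightarrow> real) \<Rightarrow> (real \<Rightarrow> real) \<Rightarrow> (real \<Rightarrow> real) \<Rightarrow> (real \<Rightarrow> real) \<Rightarrow> real \<Rightarrow> real" where
  "variation p q k1 k2 T = integral {0..T} (\<lambda>t. p t * (k1 t - c1 t) + q t * (k2 t - c2 t))"

lemma variation_integrable:
  assumes k: "K k1 k2" and pq: "continuous_on {0..T} p" "continuous_on {0..T} q"
  shows "(\<lambda>t. p t * (k1 t - c1 t) + q t * (k2 t - c2 t)) integrable_on {0..T}"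
proof -
  have "(\<lambda>t. (k1 t * p t - c1 t * p t) + (k2 t * q t - c2 t * q t)) integrable_on {0..T}"
    using K_forcing[OF k] K_forcing[OF K_c] pq
    by (intro integrable_add integrable_diff forcing_mult_integrable[of \<beta>]) auto
  then show ?thesis by (simp add: algebra_simps)
qed

lemma adjoint_continuous_on:
  assumes "adjoint p q" "T < tb"
  shows "continuous_on {0..T} p" "continuous_on {0..T} q"
  using assms adjoint_continuous[OF assms(1)] by (auto elim!: continuous_on_subset)

lemma K_perturb:
  assumes "K k1 k2" "0 \<le> r" "r \<le> 1"
  shows "K (\<lambda>t. if t < T then c1 t + r * (k1 t - c1 t) else c1 t) (\<lambda>t. if t < T then c2 t + r * (k2 t - c2 t) else c2 t)"
  by (intro K_switch K_convex K_c assms)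

text \<open>
  The displacement \<open>(dz, dv)\<close> satisfies the linearised system up to a term of order
  \<open>dz\<^sup>2 + dv\<^sup>2\<close>, and by Gronwall's lemma it is of order \<open>r\<close>. Pairing it with an adjoint
  solution eliminates the linear terms.
\<close>
lemma linearization:
  assumes k: "K k1 k2" and T: "0 \<le> T" "T < tb" and adj: "adjoint p q"
  obtains C r0 where "0 < r0" "\<And>r z' v'. 0 < r \<Longrightarrow> r \<le> r0 \<Longrightarrow>
    tail T (\<lambda>t. if t < T then c1 t + r * (k1 t - c1 t) else c1 t)
      (\<lambda>t. if t < T then c2 t + r * (k2 t - c2 t) else c2 t) z' v' \<Longrightarrow>
    \<bar>p T * (z' T - z T) + q T * (v' T - v T) - r * variation p q k1 k2 T\<bar> \<le> C * r\<^sup>2"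
proof -
  note c = continuous_on_state[OF T] and cpq = adjoint_continuous_on[OF adj T(2)]
  have zpos: "0 < z t" if "0 \<le> t" "t \<le> T" for t using closed_pos[OF sol, of t] that T by auto
  obtain m where m: "0 < m" "\<And>t. 0 \<le> t \<Longrightarrow> t \<le> T \<Longrightarrow> m \<le> z t"
    using continuous_on_positive_bounded_below[OF T(1) c(1) zpos] by blast
  obtain V where V: "0 \<le> V" "\<And>t. 0 \<le> t \<Longrightarrow> t \<le> T \<Longrightarrow> \<bar>v t\<bar> \<le> V"
    using continuous_on_Icc_bounded[OF c(2)] by blast
  obtain Z where Z: "0 \<le> Z" "\<And>t. 0 \<le> t \<Longrightarrow> t \<le> T \<Longrightarrow> \<bar>z t\<bar> \<le> Z"
    using continuous_on_Icc_bounded[OF c(1)] by blast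
  obtain P where P: "0 \<le> P" "\<And>t. 0 \<le> t \<Longrightarrow> t \<le> T \<Longrightarrow> \<bar>p t\<bar> \<le> P"
    using continuous_on_Icc_bounded[OF cpq(1)] by blast
  \<comment> \<open>\<open>K0\<close> is the Gronwall constant of the displacement while \<open>z' \<ge> m / 2\<close>, and \<open>r0\<close> is so small that
    this bound is never left.\<close>
  define K0 where "K0 = 4 * V / m\<^sup>2 + 2 / m + 5"
  define E where "E = 8 * \<beta>\<^sup>2 * exp (K0 * T)"
  define r0 where "r0 = m / (2 * sqrt (E + 1))"
  have K0: "5 \<le> K0" using V m by (simp add: K0_def)
  have E: "0 \<le> E" by (simp add: E_def)
  have r0: "0 < r0" using m E by (simp add: r0_def)
  have Er: "E * r\<^sup>2 < (m / 2)\<^sup>2" if "0 < r" "r \<le> r0" for r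
  proof -
    have "E * r\<^sup>2 < (E + 1) * r\<^sup>2" using that by simp
    also have "\<dots> \<le> (E + 1) * r0\<^sup>2" using that E by (intro mult_left_mono power_mono) auto
    also have "\<dots> = (m / 2)\<^sup>2" using E by (simp add: r0_def power_divide power_mult_distrib field_simps)
    finally show ?thesis .
  qed
  define C where "C = P * ((V + Z) * E * 2 / m ^ 3) * T"
  have cb: "\<bar>k1 t - c1 t\<bar> \<le> 2 * \<beta>" "\<bar>k2 t - c2 t\<bar> \<le> 2 * \<beta>" if "0 \<le> t" for t
    using K_forcing[OF k] K_forcing[OF K_c] that unfolding forcing_def by (smt (verit))+
  show ?thesis
  proof (rule that[OF r0, of C])
    fix r z' v' assume r: "0 < r" "r \<le> r0"
      and tl: "tail T (\<lambda>t. if t < T then c1 t + r * (k1 t - c1 t) else c1 t)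
      (\<lambda>t. if t < T then c2 t + r * (k2 t - c2 t) else c2 t) z' v'"
    let ?dz = "\<lambda>t. z' t - z t" and ?dv = "\<lambda>t. v' t - v t"
    let ?h1 = "\<lambda>t. if t < T then r * (k1 t - c1 t) else 0" and ?h2 = "\<lambda>t. if t < T then r * (k2 t - c2 t) else 0"
    let ?g1 = "\<lambda>t. (v t * ?dz t - z t * ?dv t) / (z t * z' t) + ?h1 t"
    let ?g2 = "\<lambda>t. - (\<sigma> * ?dz t) + ?dv t + ?h2 t"
    note sol' = tailD(4)[OF tl]
    have init: "?dz 0 = 0" "?dv 0 = 0" using tl by (auto simp: tail_def)
    have z'pos: "0 < z' t" if "0 \<le> t" "t \<le> T" for t using closed_pos[OF sol', of t] that T by auto
    have hb: "\<bar>?h1 t\<bar> \<le> 2 * \<beta> * r" "\<bar>?h2 t\<bar> \<le> 2 * \<beta> * r" if "0 \<le> t" for t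
      using cb[OF that] r \<beta>_nonneg by (auto simp: abs_mult mult.commute intro!: mult_right_mono)
    have dzbp: "bounded_primitive ?dz ?g1 0 T"
    proof (rule bounded_primitive_cong[OF bounded_primitive_diff[OF closed_z_bp[OF sol' T] closed_z_bp[OF sol T]]])
      fix t assume t: "0 \<le> t" "t \<le> T"
      have "(v t * ?dz t - z t * ?dv t) / (z t * z' t) = - v' t / z' t + v t / z t"
        using zpos[OF t] z'pos[OF t] by (simp add: field_simps)
      then show "?g1 t = (- v' t / z' t + (if t < T then c1 t + r * (k1 t - c1 t) else c1 t)) - (- v t / z t + c1 t)"
        by simp
    qed simp
    have dvbp: "bounded_primitive ?dv ?g2 0 T"
      by (rule bounded_primitive_cong[OF bounded_primitive_subinterval[OF bounded_primitive_diff[OF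
          closed_v_bp[OF sol'] closed_v_bp[OF sol]]]]) (use T in \<open>auto simp: algebra_simps\<close>)
    define X where "X t = (?dz t)\<^sup>2 + (?dv t)\<^sup>2 + 8 * \<beta>\<^sup>2 * r\<^sup>2" for t
    have Xbp: "bounded_primitive X (\<lambda>t. 2 * ?dz t * ?g1 t + 2 * ?dv t * ?g2 t + 0) 0 T"
      unfolding X_def by (intro bounded_primitive_add bounded_primitive_power2 bounded_primitive_const dzbp dvbp)
    have growth: "2 * ?dz t * ?g1 t + 2 * ?dv t * ?g2 t + 0 \<le> K0 * X t"
      if t: "0 \<le> t" "t \<le> T" and near: "m / 2 \<le> z' t" for t
    proof -
      define a b where "a = ?dz t" and "b = ?dv t"
      define h1 h2 where "h1 = ?h1 t" and "h2 = ?h2 t"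
      have mz: "0 < z t" "0 < z' t" "m \<le> z t" using zpos[OF t] z'pos[OF t] m(2)[OF t] by auto
      have ab: "2 * (\<bar>a\<bar> * \<bar>b\<bar>) \<le> a\<^sup>2 + b\<^sup>2" using sum_squares_bound[of "\<bar>a\<bar>" "\<bar>b\<bar>"] by simp
      have 1: "2 * (v t / (z t * z' t) * a\<^sup>2) \<le> 4 * V / m\<^sup>2 * a\<^sup>2"
      proof -
        have "v t / (z t * z' t) \<le> V / (m * (m / 2))"
          using V(2)[OF t] V(1) mz m(1) near by (intro frac_le mult_mono) auto
        then have "2 * (v t / (z t * z' t)) * a\<^sup>2 \<le> 2 * (V / (m * (m / 2))) * a\<^sup>2" by (intro mult_right_mono) auto
        then show ?thesis by (simp add: power2_eq_square mult.assoc)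
      qed
      have 2: "- 2 * (a * b / z' t) \<le> 2 / m * (a\<^sup>2 + b\<^sup>2)"
      proof -
        have "- 2 * (a * b) \<le> 2 * (\<bar>a\<bar> * \<bar>b\<bar>)" using abs_ge_minus_self[of "a * b"] by (simp add: abs_mult)
        then have "- 2 * (a * b) / z' t \<le> (a\<^sup>2 + b\<^sup>2) / z' t" using mz ab by (intro divide_right_mono) auto
        also have "\<dots> \<le> (a\<^sup>2 + b\<^sup>2) / (m / 2)" using near m by (intro divide_left_mono) auto
        finally show ?thesis by (simp add: mult.commute)
      qed
      have 3: "2 * (a * h1) \<le> a\<^sup>2 + h1\<^sup>2" "2 * (b * h2) \<le> b\<^sup>2 + h2\<^sup>2"
        using sum_squares_bound[of a h1] sum_squares_bound[of b h2] by (simp_all add: mult.assoc)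
      have 4: "- 2 * (\<sigma> * (a * b)) \<le> a\<^sup>2 + b\<^sup>2"
        using ab \<sigma> abs_ge_minus_self[of "\<sigma> * (a * b)"] by (simp add: abs_mult)
      have "\<bar>h1\<bar> \<le> 2 * \<beta> * r" "\<bar>h2\<bar> \<le> 2 * \<beta> * r" unfolding h1_def h2_def by (rule hb[OF t(1)])+
      from this[THEN power_mono, OF abs_ge_zero, of 2]
      have "\<bar>h1\<bar>\<^sup>2 \<le> (2 * \<beta> * r)\<^sup>2" "\<bar>h2\<bar>\<^sup>2 \<le> (2 * \<beta> * r)\<^sup>2" by -
      then have 5: "h1\<^sup>2 + h2\<^sup>2 \<le> 8 * \<beta>\<^sup>2 * r\<^sup>2" by (simp add: power_mult_distrib)
      have e: "2 * a * ((v t * a - z t * b) / (z t * z' t) + h1) + 2 * b * (- (\<sigma> * a) + b + h2) + 0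
          = 2 * (v t / (z t * z' t) * a\<^sup>2) + - 2 * (a * b / z' t) + 2 * (a * h1) + (- 2 * (\<sigma> * (a * b)) + 2 * b\<^sup>2 + 2 * (b * h2))"
        using mz by (simp add: field_simps power2_eq_square)
      have "4 * V / m\<^sup>2 * a\<^sup>2 \<le> 4 * V / m\<^sup>2 * (a\<^sup>2 + b\<^sup>2)" using V m by (intro mult_left_mono) auto
      with 1 have b1: "2 * (v t / (z t * z' t) * a\<^sup>2) \<le> 4 * V / m\<^sup>2 * (a\<^sup>2 + b\<^sup>2)" by (rule order_trans)
      have lin: "A1 + A2 + A3 + (A4 + 2 * y + A5) \<le> B1 + B2 + 5 * (x + y) + B3"
        if "A1 \<le> B1" "A2 \<le> B2" "A3 \<le> x + u" "A5 \<le> y + w" "A4 \<le> x + y" "u + w \<le> B3" "0 \<le> x" "0 \<le> y"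
        for A1 A2 A3 A4 A5 B1 B2 B3 x y u w :: real using that unfolding distrib_left by linarith
      have "2 * (v t / (z t * z' t) * a\<^sup>2) + - 2 * (a * b / z' t) + 2 * (a * h1) + (- 2 * (\<sigma> * (a * b)) + 2 * b\<^sup>2 + 2 * (b * h2))
          \<le> 4 * V / m\<^sup>2 * (a\<^sup>2 + b\<^sup>2) + 2 / m * (a\<^sup>2 + b\<^sup>2) + 5 * (a\<^sup>2 + b\<^sup>2) + 8 * \<beta>\<^sup>2 * r\<^sup>2"
        by (rule lin[OF b1 2 3 4 5 zero_le_power2 zero_le_power2])
      also have "\<dots> = K0 * (a\<^sup>2 + b\<^sup>2) + 1 * (8 * \<beta>\<^sup>2 * r\<^sup>2)" by (simp add: K0_def algebra_simps)
      also have "\<dots> \<le> K0 * (a\<^sup>2 + b\<^sup>2) + K0 * (8 * \<beta>\<^sup>2 * r\<^sup>2)" using K0 by (intro add_left_mono mult_right_mono) auto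
      also have "\<dots> = K0 * X t" by (simp add: X_def a_def b_def distrib_left)
      finally show ?thesis unfolding e[symmetric] unfolding a_def b_def h1_def h2_def .
    qed
    have XE: "(?dz t)\<^sup>2 + (?dv t)\<^sup>2 \<le> E * r\<^sup>2"
      if t: "0 \<le> t" "t \<le> T" and near: "\<And>s. 0 \<le> s \<Longrightarrow> s \<le> t \<Longrightarrow> m / 2 \<le> z' s" for t
    proof -
      have "X t \<le> X 0 * exp (K0 * (t - 0))"
        by (rule Gronwall_const[OF bounded_primitive_subinterval[OF Xbp order_refl t(2)] t(1)])
           (use growth near t in auto)
      also have "\<dots> \<le> X 0 * exp (K0 * T)"
        using K0 t by (intro mult_left_mono) (auto simp: X_def mult_left_mono)
      also have "\<dots> = E * r\<^sup>2" using init by (simp add: X_def E_def)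
      finally have "X t \<le> E * r\<^sup>2" .
      moreover have "(?dz t)\<^sup>2 + (?dv t)\<^sup>2 \<le> X t" by (simp add: X_def)
      ultimately show ?thesis by (rule order_trans[rotated])
    qed
    have far: "m / 2 \<le> z' t" if t: "0 \<le> t" "t \<le> T" for t
    proof -
      have "\<bar>?dz t\<bar> < m / 2"
      proof (rule continuity_bootstrap[of 0 t "\<lambda>t. \<bar>?dz t\<bar>"])
        show "continuous_on {0..t} (\<lambda>t. \<bar>?dz t\<bar>)"
          by (rule continuous_on_rabs[OF continuous_on_subset[OF bounded_primitive_continuous[OF dzbp]]])
             (use t in auto)
        fix u assume u: "0 \<le> u" "u \<le> t" and le: "\<And>s. 0 \<le> s \<Longrightarrow> s \<le> u \<Longrightarrow> \<bar>?dz s\<bar> \<le> m / 2"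
        have "m / 2 \<le> z' s" if "0 \<le> s" "s \<le> u" for s
          using le[OF that] m(2)[of s] that u t by linarith
        then have "(?dz u)\<^sup>2 + (?dv u)\<^sup>2 \<le> E * r\<^sup>2" using XE[of u] u t by auto
        then have "(?dz u)\<^sup>2 < (m / 2)\<^sup>2" using Er[OF r] zero_le_power2[of "?dv u"] by linarith
        then have "\<bar>?dz u\<bar>\<^sup>2 < (m / 2)\<^sup>2" by simp
        then show "\<bar>?dz u\<bar> < m / 2" by (rule power2_less_imp_less) (use m in simp)
      qed (use t init m in auto)
      then show ?thesis using m(2)[OF t] by linarith
    qed
    have small: "(?dz t)\<^sup>2 + (?dv t)\<^sup>2 \<le> E * r\<^sup>2" if "0 \<le> t" "t \<le> T" for t
      using XE[OF that] far that by auto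
    let ?F = "\<lambda>t. p t * ?dz t + q t * ?dv t"
    let ?gF = "\<lambda>t. ((- (v t / (z t)\<^sup>2) * p t + \<sigma> * q t) * ?dz t + p t * ?g1 t) + ((p t / z t - q t) * ?dv t + q t * ?g2 t)"
    let ?H = "\<lambda>t. p t * ?h1 t + q t * ?h2 t"
    have F: "bounded_primitive ?F ?gF 0 T"
      by (intro bounded_primitive_add bounded_primitive_mult adjoint_bp[OF adj T] dzbp dvbp)
    have "((\<lambda>t. r * (p t * (k1 t - c1 t) + q t * (k2 t - c2 t))) has_integral r * variation p q k1 k2 T) {0..T}"
      unfolding variation_def
      by (intro has_integral_mult_right integrable_integral variation_integrable[OF k cpq])
    then have H: "(?H has_integral r * variation p q k1 k2 T) {0..T}"
      by (rule has_integral_spike_finite[of "{T}", rotated 2]) (auto simp: algebra_simps)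
    have "(?gF has_integral (?F T - ?F 0)) {0..T}"
      by (rule bounded_primitive_has_integral[OF F order_refl T(1) order_refl])
    then have "((\<lambda>t. ?gF t - ?H t) has_integral (?F T - ?F 0 - r * variation p q k1 k2 T)) (cbox 0 T)"
      using has_integral_diff[OF _ H] by simp
    moreover have "norm (?gF t - ?H t) \<le> P * ((V + Z) * E * 2 / m ^ 3) * r\<^sup>2" if "t \<in> cbox 0 T" for t
    proof -
      have t: "0 \<le> t" "t \<le> T" using that by auto
      define a b where "a = ?dz t" and "b = ?dv t"
      have mz: "0 < z t" "0 < z' t" "m \<le> z t" "m / 2 \<le> z' t"
        using zpos[OF t] z'pos[OF t] m(2)[OF t] far[OF t] by auto
      have e: "((- (v t / (z t)\<^sup>2) * p t + \<sigma> * q t) * a + p t * ((v t * a - z t * b) / (z t * z' t) + h1))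
          + ((p t / z t - q t) * b + q t * (- (\<sigma> * a) + b + h2)) - (p t * h1 + q t * h2)
          = p t * (- ((v t * a - z t * b) * a / ((z t)\<^sup>2 * z' t)))" for h1 h2
      proof -
        have ae: "a = z' t - z t" by (simp add: a_def)
        show ?thesis unfolding ae using mz(1,2) by (simp add: field_simps power2_eq_square)
      qed
      have gH: "?gF t - ?H t = p t * (- ((v t * a - z t * b) * a / ((z t)\<^sup>2 * z' t)))"
        unfolding a_def b_def by (rule e[unfolded a_def b_def])
      have N: "a\<^sup>2 + b\<^sup>2 \<le> E * r\<^sup>2" using small[OF t] by (simp add: a_def b_def)
      have ab: "\<bar>a\<bar> * \<bar>a\<bar> \<le> E * r\<^sup>2" "\<bar>b\<bar> * \<bar>a\<bar> \<le> E * r\<^sup>2"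
      proof -
        have "\<bar>a\<bar> * \<bar>a\<bar> = a\<^sup>2" by (simp add: power2_eq_square)
        then show "\<bar>a\<bar> * \<bar>a\<bar> \<le> E * r\<^sup>2" using N zero_le_power2[of b] by linarith
        have "2 * (\<bar>a\<bar> * \<bar>b\<bar>) \<le> a\<^sup>2 + b\<^sup>2" using sum_squares_bound[of "\<bar>a\<bar>" "\<bar>b\<bar>"] by simp
        moreover have "0 \<le> \<bar>a\<bar> * \<bar>b\<bar>" by simp
        ultimately have "\<bar>a\<bar> * \<bar>b\<bar> \<le> E * r\<^sup>2" using N by linarith
        then show "\<bar>b\<bar> * \<bar>a\<bar> \<le> E * r\<^sup>2" by (simp only: mult.commute)
      qed
      have "\<bar>(v t * a - z t * b) * a\<bar> = \<bar>v t * a * a - z t * b * a\<bar>" by (simp add: algebra_simps)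
      also have "\<dots> \<le> \<bar>v t * a * a\<bar> + \<bar>z t * b * a\<bar>" by (rule abs_triangle_ineq4)
      also have "\<dots> = \<bar>v t\<bar> * (\<bar>a\<bar> * \<bar>a\<bar>) + \<bar>z t\<bar> * (\<bar>b\<bar> * \<bar>a\<bar>)" by (simp only: abs_mult mult.assoc)
      also have "\<dots> \<le> V * (E * r\<^sup>2) + Z * (E * r\<^sup>2)"
        by (rule add_mono[OF mult_mono[OF V(2)[OF t] ab(1) V(1)] mult_mono[OF Z(2)[OF t] ab(2) Z(1)]]) simp_all
      finally have num: "\<bar>(v t * a - z t * b) * a\<bar> \<le> (V + Z) * E * r\<^sup>2" by (simp add: algebra_simps)
      have den: "m ^ 3 / 2 \<le> (z t)\<^sup>2 * z' t"
      proof -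
        have "m ^ 3 / 2 = m\<^sup>2 * (m / 2)" by (simp add: power3_eq_cube power2_eq_square)
        also have "\<dots> \<le> (z t)\<^sup>2 * z' t" using mz m(1) by (intro mult_mono power_mono) auto
        finally show ?thesis .
      qed
      have "\<bar>(v t * a - z t * b) * a / ((z t)\<^sup>2 * z' t)\<bar> = \<bar>(v t * a - z t * b) * a\<bar> / ((z t)\<^sup>2 * z' t)"
        using mz by (simp add: abs_mult)
      also have "\<dots> \<le> (V + Z) * E * r\<^sup>2 / (m ^ 3 / 2)"
        using num den m(1) V(1) Z(1) E by (intro frac_le) auto
      finally have "\<bar>p t\<bar> * \<bar>(v t * a - z t * b) * a / ((z t)\<^sup>2 * z' t)\<bar> \<le> P * ((V + Z) * E * r\<^sup>2 / (m ^ 3 / 2))"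
        using P(2)[OF t] P(1) by (intro mult_mono) auto
      also have "\<dots> = P * ((V + Z) * E * 2 / m ^ 3) * r\<^sup>2" by simp
      finally have "\<bar>p t\<bar> * \<bar>(v t * a - z t * b) * a / ((z t)\<^sup>2 * z' t)\<bar> \<le> P * ((V + Z) * E * 2 / m ^ 3) * r\<^sup>2" .
      then show ?thesis unfolding gH real_norm_def abs_mult[of "p t"] abs_minus_cancel .
    qed
    moreover have "0 \<le> P * ((V + Z) * E * 2 / m ^ 3) * r\<^sup>2" using P V Z E m by simp
    ultimately have "norm (?F T - ?F 0 - r * variation p q k1 k2 T) \<le> P * ((V + Z) * E * 2 / m ^ 3) * r\<^sup>2 * measure lborel (cbox 0 T)"
      using has_integral_bound by blast
    then show "\<bar>p T * ?dz T + q T * ?dv T - r * variation p q k1 k2 T\<bar> \<le> C * r\<^sup>2"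
      using init T by (simp add: C_def content_real mult_ac)
  qed
qed

end

section \<open>Multipliers at a fixed time\<close>

text \<open>
  A hyperplane that separates the set from the open quadrant passes through the origin, and its
  normal vector lies in the closed quadrant.
\<close>
lemma quadrant_separation:
  fixes S :: "(real \<times> real) set"
  assumes "convex S" "(0, 0) \<in> S" and no: "\<And>x y. (x, y) \<in> S \<Longrightarrow> \<not> (0 < x \<and> 0 < y)"
  obtains \<mu>1 \<mu>2 where "0 \<le> \<mu>1" "0 \<le> \<mu>2" "\<mu>1 \<noteq> 0 \<or> \<mu>2 \<noteq> 0" "\<And>x y. (x, y) \<in> S \<Longrightarrow> \<mu>1 * x + \<mu>2 * y \<le> 0"
proof -
  let ?Q = "{0<..} \<times> {0<..} :: (real \<times> real) set"
  have "\<exists>a b. a \<noteq> 0 \<and> (\<forall>x\<in>S. inner a x \<le> b) \<and> (\<forall>x\<in>?Q. b \<le> inner a x)"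
  proof (rule separating_hyperplane_sets[OF assms(1)])
    show "convex ?Q" by (intro convex_Times) auto
    show "S \<noteq> {}" using assms(2) by blast
    have "(1, 1) \<in> ?Q" by simp
    then show "?Q \<noteq> {}" by blast
    show "S \<inter> ?Q = {}" using no by auto
  qed
  then obtain a b where ab: "a \<noteq> 0" "\<forall>x\<in>S. inner a x \<le> b" "\<forall>x\<in>?Q. b \<le> inner a x" by blast
  obtain m n where a: "a = (m, n)" by (cases a)
  have up: "m * x + n * y \<le> b" if "(x, y) \<in> S" for x y using ab(2) that by (force simp: a)
  have lo: "b \<le> m * x + n * y" if "0 < x" "0 < y" for x y using ab(3) that by (force simp: a)
  have b0: "0 \<le> b" using up[OF assms(2)] by simp
  have m0: "0 \<le> m"
  proof (rule ccontr)
    assume neg: "\<not> 0 \<le> m"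
    have "b \<le> m * ((\<bar>n\<bar> + 1) / - m) + n * 1" using neg by (intro lo) (auto intro!: divide_pos_neg)
    also have "\<dots> = - (\<bar>n\<bar> + 1) + n" using neg by simp
    finally show False using b0 by linarith
  qed
  have n0: "0 \<le> n"
  proof (rule ccontr)
    assume neg: "\<not> 0 \<le> n"
    have "b \<le> m * 1 + n * ((\<bar>m\<bar> + 1) / - n)" using neg by (intro lo) (auto intro!: divide_pos_neg)
    also have "\<dots> = - (\<bar>m\<bar> + 1) + m" using neg by simp
    finally show False using b0 by linarith
  qed
  have "b \<le> 0"
  proof (rule ccontr)
    assume "\<not> b \<le> 0"
    define t where "t = b / (2 * (m + n + 1))"
    have mn: "0 < m + n + 1" using m0 n0 by simp
    have t: "0 < t" using \<open>\<not> b \<le> 0\<close> mn by (simp add: t_def)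
    have "b \<le> m * t + n * t" by (rule lo[OF t t])
    also have "\<dots> \<le> (m + n + 1) * t" using t by (simp add: algebra_simps)
    also have "\<dots> = b / 2" using mn by (simp add: t_def field_simps)
    finally show False using \<open>\<not> b \<le> 0\<close> by simp
  qed
  have le: "m * x + n * y \<le> 0" if "(x, y) \<in> S" for x y
    using up[OF that] \<open>b \<le> 0\<close> by linarith
  have ne: "m \<noteq> 0 \<or> n \<noteq> 0" using ab(1) by (simp add: a zero_prod_def)
  show ?thesis by (rule that[OF m0 n0 ne le])
qed

context optimal_quenching
begin

text \<open>
  The values at \<open>T\<close> of the two adjoint solutions are the functionals that define a cone of
  displacements. If both variations are positive, a small perturbation of the forcing leads into
  this cone.
\<close>
lemma cone_reached:
  assumes k: "K k1 k2" and T: "0 \<le> T" "T < tb" and adj: "adjoint p1 q1" "adjoint p2 q2"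
    and pos: "0 < variation p1 q1 k1 k2 T" "0 < variation p2 q2 k1 k2 T"
  obtains l1 l2 z' v' where "tail T l1 l2 z' v'" "0 < p1 T * (z' T - z T) + q1 T * (v' T - v T)"
    "0 < p2 T * (z' T - z T) + q2 T * (v' T - v T)"
proof -
  let ?l1 = "\<lambda>r t. if t < T then c1 t + r * (k1 t - c1 t) else c1 t"
  let ?l2 = "\<lambda>r t. if t < T then c2 t + r * (k2 t - c2 t) else c2 t"
  define positive where "positive p q r \<longleftrightarrow> (\<forall>z' v'. tail T (?l1 r) (?l2 r) z' v' \<longrightarrow>
      0 < p T * (z' T - z T) + q T * (v' T - v T))" for p q r
  have small: "\<exists>r0>0. \<forall>r. 0 < r \<longrightarrow> r \<le> r0 \<longrightarrow> positive p q r"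
    if a: "adjoint p q" and I: "0 < variation p q k1 k2 T" for p q
  proof -
    obtain C r0 where r0: "0 < r0" "\<And>r z' v'. 0 < r \<Longrightarrow> r \<le> r0 \<Longrightarrow> tail T (?l1 r) (?l2 r) z' v' \<Longrightarrow>
      \<bar>p T * (z' T - z T) + q T * (v' T - v T) - r * variation p q k1 k2 T\<bar> \<le> C * r\<^sup>2"
      by (rule linearization[OF k T a]) (rule that)
    define r1 where "r1 = min r0 (variation p q k1 k2 T / (2 * (\<bar>C\<bar> + 1)))"
    have "0 < r1" using r0(1) I by (simp add: r1_def)
    moreover have "positive p q r" if r: "0 < r" "r \<le> r1" for r
      unfolding positive_def
    proof (intro allI impI)
      fix z' v' assume tl: "tail T (?l1 r) (?l2 r) z' v'"
      have est: "\<bar>p T * (z' T - z T) + q T * (v' T - v T) - r * variation p q k1 k2 T\<bar> \<le> C * r\<^sup>2"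
        by (rule r0(2)[OF r(1) _ tl]) (use r in \<open>simp add: r1_def\<close>)
      have "C * r \<le> (\<bar>C\<bar> + 1) * r1" using r by (intro mult_mono) auto
      also have "\<dots> \<le> (\<bar>C\<bar> + 1) * (variation p q k1 k2 T / (2 * (\<bar>C\<bar> + 1)))"
        by (intro mult_left_mono) (auto simp: r1_def)
      also have "\<dots> = variation p q k1 k2 T / 2" by (simp add: field_simps)
      also have "\<dots> < variation p q k1 k2 T" using I by simp
      finally have "C * r * r < variation p q k1 k2 T * r" using r by (intro mult_strict_right_mono) auto
      then have "C * r\<^sup>2 < r * variation p q k1 k2 T" by (simp add: power2_eq_square mult_ac)
      then show "0 < p T * (z' T - z T) + q T * (v' T - v T)" using est by linarith
    qed
    ultimately show ?thesis by blast
  qed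
  obtain r1 where r1: "0 < r1" "\<forall>r. 0 < r \<longrightarrow> r \<le> r1 \<longrightarrow> positive p1 q1 r"
    using small[OF adj(1) pos(1)] by blast
  obtain r2 where r2: "0 < r2" "\<forall>r. 0 < r \<longrightarrow> r \<le> r2 \<longrightarrow> positive p2 q2 r"
    using small[OF adj(2) pos(2)] by blast
  define r where "r = min 1 (min r1 r2)"
  have r: "0 < r" "r \<le> 1" "r \<le> r1" "r \<le> r2" using r1(1) r2(1) by (auto simp: r_def)
  have Kr: "K (?l1 r) (?l2 r)" by (rule K_perturb[OF k]) (use r in auto)
  obtain z' v' where s: "solves_closed \<sigma> (?l1 r) (?l2 r) tb z' v'" "z' 0 = z 0" "v' 0 = v 0"
    using never_earlier_closed[OF Kr] by blast
  have tl: "tail T (?l1 r) (?l2 r) z' v'" using T Kr s by (auto simp: tail_def)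
  have "positive p1 q1 r" "positive p2 q2 r" using r1(2) r2(2) r by auto
  then show ?thesis using tl unfolding positive_def by (intro that[OF tl]) auto
qed

lemma variation_has_integral:
  assumes "K k1 k2" "adjoint p q" "T < tb"
  shows "((\<lambda>t. p t * (k1 t - c1 t) + q t * (k2 t - c2 t)) has_integral variation p q k1 k2 T) {0..T}"
  unfolding variation_def
  by (intro integrable_integral variation_integrable assms adjoint_continuous_on[OF assms(2,3)])

lemma variation_adjoint_linear:
  assumes "K k1 k2" "adjoint p1 q1" "adjoint p2 q2" "T < tb"
  shows "variation (\<lambda>t. a * p1 t + b * p2 t) (\<lambda>t. a * q1 t + b * q2 t) k1 k2 T
    = a * variation p1 q1 k1 k2 T + b * variation p2 q2 k1 k2 T"
proof -
  have "((\<lambda>t. a * (p1 t * (k1 t - c1 t) + q1 t * (k2 t - c2 t)) + b * (p2 t * (k1 t - c1 t) + q2 t * (k2 t - c2 t)))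
     has_integral a * variation p1 q1 k1 k2 T + b * variation p2 q2 k1 k2 T) {0..T}"
    by (intro has_integral_add has_integral_mult_right variation_has_integral assms)
  then show ?thesis unfolding variation_def[of "\<lambda>t. a * p1 t + b * p2 t"]
    by (intro integral_unique) (simp add: algebra_simps)
qed

lemma variation_forcing_convex:
  assumes "K k1 k2" "K l1 l2" "adjoint p q" "T < tb"
  shows "variation p q (\<lambda>t. k1 t + r * (l1 t - k1 t)) (\<lambda>t. k2 t + r * (l2 t - k2 t)) T
    = (1 - r) * variation p q k1 k2 T + r * variation p q l1 l2 T"
proof -
  have "((\<lambda>t. (1 - r) * (p t * (k1 t - c1 t) + q t * (k2 t - c2 t)) + r * (p t * (l1 t - c1 t) + q t * (l2 t - c2 t)))
     has_integral (1 - r) * variation p q k1 k2 T + r * variation p q l1 l2 T) {0..T}"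
    by (intro has_integral_add has_integral_mult_right variation_has_integral assms)
  then show ?thesis unfolding variation_def[of p q "\<lambda>t. k1 t + r * (l1 t - k1 t)"]
    by (intro integral_unique) (simp add: algebra_simps)
qed

lemma variation_switch:
  assumes "K k1 k2" "adjoint p q" "0 \<le> T" "T \<le> T'" "T' < tb"
  shows "variation p q (\<lambda>t. if t < T then k1 t else c1 t) (\<lambda>t. if t < T then k2 t else c2 t) T' = variation p q k1 k2 T"
proof -
  let ?l1 = "\<lambda>t. if t < T then k1 t else c1 t" and ?l2 = "\<lambda>t. if t < T then k2 t else c2 t"
  let ?g = "\<lambda>t. p t * (?l1 t - c1 t) + q t * (?l2 t - c2 t)"
  have 1: "(?g has_integral variation p q k1 k2 T) {0..T}"
    by (rule has_integral_spike_finite[of "{T}", OF _ _ variation_has_integral[OF assms(1,2), of T]])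
       (use assms in auto)
  have 2: "(?g has_integral 0) {T..T'}"
    by (rule has_integral_is_0) auto
  have "(?g has_integral (variation p q k1 k2 T + 0)) {0..T'}"
    by (rule has_integral_combine[OF assms(3,4) 1 2])
  then show ?thesis unfolding variation_def[of p q ?l1] by (intro integral_unique) simp
qed

lemma multipliers:
  assumes T: "0 \<le> T" "T < tb" and adj: "adjoint p1 q1" "adjoint p2 q2"
    and blocked: "\<And>l1 l2 z' v'. tail T l1 l2 z' v' \<Longrightarrow>
      \<not> (0 < p1 T * (z' T - z T) + q1 T * (v' T - v T) \<and> 0 < p2 T * (z' T - z T) + q2 T * (v' T - v T))"
  obtains \<mu>1 \<mu>2 where "0 \<le> \<mu>1" "0 \<le> \<mu>2" "\<mu>1 \<noteq> 0 \<or> \<mu>2 \<noteq> 0"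
    "\<And>k1 k2. K k1 k2 \<Longrightarrow> \<mu>1 * variation p1 q1 k1 k2 T + \<mu>2 * variation p2 q2 k1 k2 T \<le> 0"
proof -
  define S where "S = {(variation p1 q1 k1 k2 T, variation p2 q2 k1 k2 T) |k1 k2. K k1 k2}"
  have "convex S" unfolding convex_alt
  proof (intro ballI allI impI)
    fix x y u assume x: "x \<in> S" and y: "y \<in> S" and u: "0 \<le> u \<and> u \<le> (1::real)"
    obtain k1 k2 where k: "K k1 k2" "x = (variation p1 q1 k1 k2 T, variation p2 q2 k1 k2 T)"
      using x by (auto simp: S_def)
    obtain l1 l2 where l: "K l1 l2" "y = (variation p1 q1 l1 l2 T, variation p2 q2 l1 l2 T)"
      using y by (auto simp: S_def)
    have "K (\<lambda>t. k1 t + u * (l1 t - k1 t)) (\<lambda>t. k2 t + u * (l2 t - k2 t))"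
      using K_convex[OF k(1) l(1)] u by blast
    then have "(variation p1 q1 (\<lambda>t. k1 t + u * (l1 t - k1 t)) (\<lambda>t. k2 t + u * (l2 t - k2 t)) T,
        variation p2 q2 (\<lambda>t. k1 t + u * (l1 t - k1 t)) (\<lambda>t. k2 t + u * (l2 t - k2 t)) T) \<in> S"
      unfolding S_def by blast
    then show "(1 - u) *\<^sub>R x + u *\<^sub>R y \<in> S"
      unfolding variation_forcing_convex[OF k(1) l(1) adj(1) T(2)] variation_forcing_convex[OF k(1) l(1) adj(2) T(2)]
      by (simp add: k(2) l(2))
  qed
  moreover have "(0, 0) \<in> S"
  proof -
    have "(variation p1 q1 c1 c2 T, variation p2 q2 c1 c2 T) \<in> S" unfolding S_def using K_c by blast
    then show ?thesis by (simp add: variation_def)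
  qed
  moreover have "\<not> (0 < x \<and> 0 < y)" if "(x, y) \<in> S" for x y
  proof
    assume pos: "0 < x \<and> 0 < y"
    obtain k1 k2 where "K k1 k2" "x = variation p1 q1 k1 k2 T" "y = variation p2 q2 k1 k2 T"
      using \<open>(x, y) \<in> S\<close> by (auto simp: S_def)
    then show False using cone_reached[OF _ T adj] blocked pos by metis
  qed
  ultimately obtain \<mu>1 \<mu>2 where "0 \<le> \<mu>1" "0 \<le> \<mu>2" "\<mu>1 \<noteq> 0 \<or> \<mu>2 \<noteq> 0" "\<And>x y. (x, y) \<in> S \<Longrightarrow> \<mu>1 * x + \<mu>2 * y \<le> 0"
    using quadrant_separation by metis
  then show ?thesis by (intro that[of \<mu>1 \<mu>2]) (auto simp: S_def)
qed

end

section \<open>The limit at the quenching time\<close>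

context optimal_quenching
begin

text \<open>
  The functionals \<open>(A1, B1)\<close> and \<open>(A2, B2)\<close> define a cone that no competitor can reach at time \<open>T\<close>.
  They are the terminal values of two adjoint solutions, and so the multipliers of these two yield
  one adjoint solution whose terminal value lies in the dual cone. Its coefficients \<open>a\<close> and \<open>b\<close> with
  respect to a fixed basis are normalised, so that they have a limit point as \<open>T\<close> varies.
\<close>
lemma stationary_at:
  assumes T: "0 \<le> T" "T < tb" and adj: "adjoint p1 q1" "adjoint p2 q2"
    and init: "p1 0 = 1" "q1 0 = 0" "p2 0 = 0" "q2 0 = 1"
    and det: "A1 * B2 - A2 * B1 \<noteq> 0"
    and blocked: "\<And>l1 l2 z' v'. tail T l1 l2 z' v' \<Longrightarrow>
      \<not> (0 < A1 * (z' T - z T) + B1 * (v' T - v T) \<and> 0 < A2 * (z' T - z T) + B2 * (v' T - v T))"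
  shows "\<exists>a b \<mu>1 \<mu>2. a\<^sup>2 + b\<^sup>2 = 1 \<and> 0 \<le> \<mu>1 \<and> 0 \<le> \<mu>2 \<and>
    a * p1 T + b * p2 T = \<mu>1 * A1 + \<mu>2 * A2 \<and> a * q1 T + b * q2 T = \<mu>1 * B1 + \<mu>2 * B2 \<and>
    (\<forall>k1 k2. K k1 k2 \<longrightarrow> a * variation p1 q1 k1 k2 T + b * variation p2 q2 k1 k2 T \<le> 0)"
proof -
  define W where "W = p1 T * q2 T - p2 T * q1 T"
  have W: "W \<noteq> 0" unfolding W_def by (rule adjoint_Wronskian_nonzero[OF adj _ T]) (simp add: init)
  have terminal: "\<exists>a b. a * p1 T + b * p2 T = A \<and> a * q1 T + b * q2 T = B" for A B
  proof (intro exI conjI)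
    show "(A * q2 T - B * p2 T) / W * p1 T + (B * p1 T - A * q1 T) / W * p2 T = A"
      using W by (simp add: field_simps) (simp add: W_def algebra_simps)
    show "(A * q2 T - B * p2 T) / W * q1 T + (B * p1 T - A * q1 T) / W * q2 T = B"
      using W by (simp add: field_simps) (simp add: W_def algebra_simps)
  qed
  obtain a1 b1 where 1: "a1 * p1 T + b1 * p2 T = A1" "a1 * q1 T + b1 * q2 T = B1" using terminal by blast
  obtain a2 b2 where 2: "a2 * p1 T + b2 * p2 T = A2" "a2 * q1 T + b2 * q2 T = B2" using terminal by blast
  have bl: "\<not> (0 < (a1 * p1 T + b1 * p2 T) * (z' T - z T) + (a1 * q1 T + b1 * q2 T) * (v' T - v T) \<and>
      0 < (a2 * p1 T + b2 * p2 T) * (z' T - z T) + (a2 * q1 T + b2 * q2 T) * (v' T - v T))"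
    if "tail T l1 l2 z' v'" for l1 l2 z' v'
    unfolding 1 2 by (rule blocked[OF that])
  obtain \<mu>1 \<mu>2 where \<mu>: "0 \<le> \<mu>1" "0 \<le> \<mu>2" "\<mu>1 \<noteq> 0 \<or> \<mu>2 \<noteq> 0"
    and le: "\<And>k1 k2. K k1 k2 \<Longrightarrow>
      \<mu>1 * variation (\<lambda>t. a1 * p1 t + b1 * p2 t) (\<lambda>t. a1 * q1 t + b1 * q2 t) k1 k2 T +
      \<mu>2 * variation (\<lambda>t. a2 * p1 t + b2 * p2 t) (\<lambda>t. a2 * q1 t + b2 * q2 t) k1 k2 T \<le> 0"
    by (rule multipliers[OF T adjoint_combination[OF adj, of a1 b1] adjoint_combination[OF adj, of a2 b2]])
       (erule bl, rule that)
  define a where "a = \<mu>1 * a1 + \<mu>2 * a2"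
  define b where "b = \<mu>1 * b1 + \<mu>2 * b2"
  have P: "a * p1 T + b * p2 T = \<mu>1 * A1 + \<mu>2 * A2" "a * q1 T + b * q2 T = \<mu>1 * B1 + \<mu>2 * B2"
    by (simp_all add: a_def b_def algebra_simps flip: 1 2)
  have nz: "0 < a\<^sup>2 + b\<^sup>2"
  proof (rule ccontr)
    assume "\<not> ?thesis"
    then have "a = 0" "b = 0" using sum_power2_gt_zero_iff[of a b] by auto
    then have 0: "\<mu>1 * A1 + \<mu>2 * A2 = 0" "\<mu>1 * B1 + \<mu>2 * B2 = 0" using P by auto
    have "\<mu>1 * (A1 * B2 - A2 * B1) = (\<mu>1 * A1 + \<mu>2 * A2) * B2 - (\<mu>1 * B1 + \<mu>2 * B2) * A2"
      by (simp add: algebra_simps)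
    moreover have "\<mu>2 * (A1 * B2 - A2 * B1) = (\<mu>1 * B1 + \<mu>2 * B2) * A1 - (\<mu>1 * A1 + \<mu>2 * A2) * B1"
      by (simp add: algebra_simps)
    ultimately show False using 0 det \<mu>(3) by simp
  qed
  \<comment> \<open>Normalisation at time \<open>0\<close>, where \<open>(a, b)\<close> is the value of the adjoint solution.\<close>
  define n where "n = sqrt (a\<^sup>2 + b\<^sup>2)"
  have n: "0 < n" "n\<^sup>2 = a\<^sup>2 + b\<^sup>2" using nz by (simp_all add: n_def)
  have "(a / n)\<^sup>2 + (b / n)\<^sup>2 = (a\<^sup>2 + b\<^sup>2) / n\<^sup>2" by (simp add: power_divide add_divide_distrib)
  moreover have "(a\<^sup>2 + b\<^sup>2) / n\<^sup>2 = 1" unfolding n(2) by (rule divide_self) (use nz in linarith)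
  ultimately have "(a / n)\<^sup>2 + (b / n)\<^sup>2 = 1" by simp
  moreover have "a / n * p1 T + b / n * p2 T = \<mu>1 / n * A1 + \<mu>2 / n * A2"
    "a / n * q1 T + b / n * q2 T = \<mu>1 / n * B1 + \<mu>2 / n * B2"
    using P by (simp_all flip: add_divide_distrib)
  moreover have "a / n * variation p1 q1 k1 k2 T + b / n * variation p2 q2 k1 k2 T \<le> 0" if k: "K k1 k2" for k1 k2
  proof -
    have "a * variation p1 q1 k1 k2 T + b * variation p2 q2 k1 k2 T \<le> 0"
      using le[OF k] unfolding variation_adjoint_linear[OF k adj T(2)]
      by (simp add: a_def b_def algebra_simps)
    then show ?thesis using n(1) by (simp add: divide_nonpos_pos flip: add_divide_distrib)
  qed
  ultimately show ?thesis using \<mu> n(1)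
    by (intro exI[of _ "a / n"] exI[of _ "b / n"] exI[of _ "\<mu>1 / n"] exI[of _ "\<mu>2 / n"]) auto
qed

text \<open>
  The inequality at a time \<open>T'\<close> implies the one at any earlier \<open>T\<close>, because a forcing may be
  switched back to the optimal one at \<open>T\<close>. For fixed \<open>T\<close> it is linear in \<open>(a, b)\<close> and passes to the
  limit. The predicate \<open>R\<close> transports further information on the solutions along the sequence.
\<close>
lemma limit_multiplier:
  assumes T0: "0 \<le> T0" "T0 < tb" and adj: "adjoint p1 q1" "adjoint p2 q2"
    and each: "\<And>T. T0 \<le> T \<Longrightarrow> T < tb \<Longrightarrow> \<exists>a b. a\<^sup>2 + b\<^sup>2 = 1 \<and> R T a b \<and>
      (\<forall>k1 k2. K k1 k2 \<longrightarrow> a * variation p1 q1 k1 k2 T + b * variation p2 q2 k1 k2 T \<le> 0)"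
  obtains a b and Tn an bn :: "nat \<Rightarrow> real" where "a\<^sup>2 + b\<^sup>2 = 1" "an \<longlonglongrightarrow> a" "bn \<longlonglongrightarrow> b" "Tn \<longlonglongrightarrow> tb"
    "\<And>n. T0 \<le> Tn n \<and> Tn n < tb \<and> (an n)\<^sup>2 + (bn n)\<^sup>2 = 1 \<and> R (Tn n) (an n) (bn n)"
    "\<And>T k1 k2. 0 \<le> T \<Longrightarrow> T < tb \<Longrightarrow> K k1 k2 \<Longrightarrow> a * variation p1 q1 k1 k2 T + b * variation p2 q2 k1 k2 T \<le> 0"
proof -
  define t where "t n = tb - (tb - T0) / real (Suc n)" for n
  have t: "T0 \<le> t n" "t n < tb" for n
  proof -
    have "(tb - T0) / real (Suc n) \<le> (tb - T0) / 1" using T0 by (intro divide_left_mono) auto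
    then show "T0 \<le> t n" by (simp add: t_def)
    show "t n < tb" using T0 by (simp add: t_def)
  qed
  have tlim: "t \<longlonglongrightarrow> tb"
  proof -
    have "(\<lambda>n. tb - (tb - T0) * inverse (real (Suc n))) \<longlonglongrightarrow> tb - (tb - T0) * 0"
      by (intro tendsto_intros LIMSEQ_inverse_real_of_nat)
    then show ?thesis by (simp add: t_def[abs_def] divide_inverse)
  qed
  have "\<forall>n. \<exists>x. (fst x)\<^sup>2 + (snd x)\<^sup>2 = 1 \<and> R (t n) (fst x) (snd x) \<and>
      (\<forall>k1 k2. K k1 k2 \<longrightarrow> fst x * variation p1 q1 k1 k2 (t n) + snd x * variation p2 q2 k1 k2 (t n) \<le> 0)"
    using each[OF t] by simp
  then obtain x :: "nat \<Rightarrow> real \<times> real" where x: "\<And>n. (fst (x n))\<^sup>2 + (snd (x n))\<^sup>2 = 1" "\<And>n. R (t n) (fst (x n)) (snd (x n))"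
    "\<And>n k1 k2. K k1 k2 \<Longrightarrow> fst (x n) * variation p1 q1 k1 k2 (t n) + snd (x n) * variation p2 q2 k1 k2 (t n) \<le> 0"
    by metis
  have sph: "x n \<in> sphere 0 1" for n using x(1)[of n] by (simp add: norm_prod_def)
  have "seq_compact (sphere (0 :: real \<times> real) 1)" by (simp add: compact_imp_seq_compact)
  then obtain l and r :: "nat \<Rightarrow> nat" where l: "l \<in> sphere 0 1" "strict_mono r" "(x \<circ> r) \<longlonglongrightarrow> l"
    using sph unfolding seq_compact_def by metis
  have l1: "(fst l)\<^sup>2 + (snd l)\<^sup>2 = 1"
    using l(1) by (simp add: norm_prod_def)
  have lims: "(\<lambda>n. fst (x (r n))) \<longlonglongrightarrow> fst l" "(\<lambda>n. snd (x (r n))) \<longlonglongrightarrow> snd l"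
    using tendsto_fst[OF l(3)] tendsto_snd[OF l(3)] by (simp_all add: o_def)
  have trlim: "(\<lambda>n. t (r n)) \<longlonglongrightarrow> tb" using LIMSEQ_subseq_LIMSEQ[OF tlim l(2)] by (simp add: o_def)
  show ?thesis
  proof (rule that[OF l1 lims trlim])
    fix T k1 k2 assume T: "0 \<le> T" "T < tb" and k: "K k1 k2"
    let ?k1 = "\<lambda>t. if t < T then k1 t else c1 t" and ?k2 = "\<lambda>t. if t < T then k2 t else c2 t"
    have k': "K ?k1 ?k2" by (rule K_switch[OF k K_c])
    have "\<forall>\<^sub>F n in sequentially. T < t (r n)" by (rule order_tendstoD(1)[OF trlim T(2)])
    then have "\<forall>\<^sub>F n in sequentially. fst (x (r n)) * variation p1 q1 k1 k2 T + snd (x (r n)) * variation p2 q2 k1 k2 T \<le> 0"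
    proof (rule eventually_mono)
      fix n assume n: "T < t (r n)"
      show "fst (x (r n)) * variation p1 q1 k1 k2 T + snd (x (r n)) * variation p2 q2 k1 k2 T \<le> 0"
        using x(3)[OF k', of "r n"]
        unfolding variation_switch[OF k adj(1) T(1) less_imp_le[OF n] t(2)]
          variation_switch[OF k adj(2) T(1) less_imp_le[OF n] t(2)] .
    qed
    moreover have "(\<lambda>n. fst (x (r n)) * variation p1 q1 k1 k2 T + snd (x (r n)) * variation p2 q2 k1 k2 T)
       \<longlonglongrightarrow> fst l * variation p1 q1 k1 k2 T + snd l * variation p2 q2 k1 k2 T"
      by (intro tendsto_intros lims)
    ultimately show "fst l * variation p1 q1 k1 k2 T + snd l * variation p2 q2 k1 k2 T \<le> 0"
      by (intro tendsto_upperbound) auto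
  qed (use x t in auto)
qed

text \<open>
  If \<open>v tb > 0\<close>, then \<open>z\<^sup>2\<close> decreases at rate at least \<open>v tb\<close> near the end.
\<close>
lemma z_lower_bound:
  assumes v: "0 < v tb"
  obtains T where "0 \<le> T" "T < tb" "\<And>t. T \<le> t \<Longrightarrow> t < tb \<Longrightarrow> v tb * (tb - t) \<le> (z t)\<^sup>2"
proof -
  have "continuous_on {0..tb} (\<lambda>t. 2 * v t - 2 * (\<beta> * z t))"
    by (intro continuous_intros closed_cont[OF sol])
  then obtain T where T: "0 \<le> T" "T < tb"
    "\<And>t. T \<le> t \<Longrightarrow> t \<le> tb \<Longrightarrow> \<bar>2 * v t - 2 * (\<beta> * z t) - (2 * v tb - 2 * (\<beta> * z tb))\<bar> < v tb"
    using continuous_at_end[of "\<lambda>t. 2 * v t - 2 * (\<beta> * z t)" "v tb"] v by auto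
  show ?thesis
  proof (rule that[OF T(1,2)])
    fix t assume t: "T \<le> t" "t < tb"
    have lin: "bounded_primitive (\<lambda>u. v tb * u) (\<lambda>u. v tb * 1) 0 tb"
      by (intro bounded_primitive_cmult bounded_primitive_of_derivative) (auto intro!: derivative_eq_intros)
    have "(-1) * ((z t)\<^sup>2 + v tb * t) \<le> (-1) * ((z tb)\<^sup>2 + v tb * tb)"
    proof (rule bounded_primitive_mono[OF bounded_primitive_cmult[OF bounded_primitive_add[OF closed_w_bp[OF sol] lin], of "-1"]])
      fix u assume u: "t \<le> u" "u \<le> tb"
      have zu: "0 \<le> z u" using closed_pos[OF sol, of u] quenched T t u by (cases "u = tb") auto
      have "\<bar>c1 u * z u\<bar> \<le> \<beta> * z u"
        unfolding abs_mult using c_bound(1)[of u] zu T t u by (intro mult_mono) auto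
      then show "0 \<le> -1 * ((- 2 * v u + 2 * c1 u * z u) + v tb * 1)"
        using T(3)[of u] t u quenched unfolding mult.assoc by auto
    qed (use t T in auto)
    then show "v tb * (tb - t) \<le> (z t)\<^sup>2" using quenched by (simp add: algebra_simps)
  qed
qed

text \<open>
  The quotient \<open>p / z\<close> is, up to a factor, the adjoint variable of \<open>z\<^sup>2\<close>. It and \<open>q\<close> satisfy a
  linear system with coefficients of order \<open>1/z\<close>, which are integrable if \<open>v tb > 0\<close>.
\<close>
lemma adjoint_bounded:
  assumes adj: "adjoint p q" and v: "0 < v tb"
  obtains C where "0 \<le> C" "\<And>t. 0 \<le> t \<Longrightarrow> t < tb \<Longrightarrow> \<bar>p t\<bar> \<le> C * z t \<and> \<bar>q t\<bar> \<le> C"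
proof -
  obtain T1 where T1: "0 \<le> T1" "T1 < tb" "\<And>t. T1 \<le> t \<Longrightarrow> t < tb \<Longrightarrow> v tb * (tb - t) \<le> (z t)\<^sup>2"
    using z_lower_bound[OF v] by blast
  define T where "T = max T1 (tb - 1)"
  have T: "0 \<le> T" "T < tb" "T1 \<le> T" "tb - 1 \<le> T" using T1 by (auto simp: T_def)
  define L where "L = (1 + 2 * \<beta>) / sqrt (v tb) + 1"
  have L: "0 \<le> L" using \<beta>_nonneg v by (simp add: L_def)
  let ?N = "\<lambda>t. (p t / z t)\<^sup>2 + (q t)\<^sup>2"
  have Nb: "?N b \<le> ?N T * exp (2 * L)" if b: "T \<le> b" "b < tb" for b
  proof -
    have b0: "0 \<le> b" using b T by simp
    have zpos: "0 < z t" if "0 \<le> t" "t \<le> b" for t using closed_pos[OF sol, of t] that b by auto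
    have iz: "bounded_primitive (\<lambda>t. inverse (z t)) (\<lambda>t. - ((inverse (z t))\<^sup>2) * (- v t / z t + c1 t)) 0 b"
    proof (rule bounded_primitive_chain[OF closed_z_bp[OF sol b0 b(2)], of inverse "\<lambda>r. - ((inverse r)\<^sup>2)"])
      show "(inverse has_real_derivative - ((inverse (z t))\<^sup>2)) (at (z t))" if "t \<in> {0..b}" for t
        using DERIV_inverse[of "z t" UNIV] zpos[of t] that by (simp add: power2_eq_square)
      show "continuous_on (z ` {0..b}) (\<lambda>r. - ((inverse r)\<^sup>2))"
        using zpos by (intro continuous_intros) force
    qed
    have bpp: "bounded_primitive (\<lambda>t. p t / z t) (\<lambda>t. \<sigma> * q t / z t - c1 t * (p t / z t) / z t) 0 b"
    proof (rule bounded_primitive_cong[OF bounded_primitive_mult[OF adjoint_bp(1)[OF adj b0 b(2)] iz]])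
      fix t assume t: "0 \<le> t" "t \<le> b"
      show "p t / z t = p t * inverse (z t)" by (simp add: divide_inverse)
      show "\<sigma> * q t / z t - c1 t * (p t / z t) / z t =
        (- (v t / (z t)\<^sup>2) * p t + \<sigma> * q t) * inverse (z t) + p t * (- ((inverse (z t))\<^sup>2) * (- v t / z t + c1 t))"
        using zpos[OF t] by (simp add: field_simps power2_eq_square)
    qed
    have Nbp: "bounded_primitive ?N (\<lambda>t. 2 * (p t / z t) * (\<sigma> * q t / z t - c1 t * (p t / z t) / z t) + 2 * q t * (p t / z t - q t)) 0 b"
      by (intro bounded_primitive_add bounded_primitive_power2 bpp adjoint_bp(2)[OF adj b0 b(2)])
    let ?\<kappa> = "\<lambda>t. - (2 * L) * sqrt (tb - t)"
    have "?N b \<le> ?N T * exp (?\<kappa> b - ?\<kappa> T)"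
    proof (rule Gronwall[OF bounded_primitive_subinterval[OF Nbp T(1) order_refl] b(1), of ?\<kappa> "\<lambda>t. L / sqrt (tb - t)"])
      show "continuous_on {T..b} (\<lambda>t. L / sqrt (tb - t))" using b by (intro continuous_intros) auto
      fix t assume "t \<in> {T..b}"
      then have t: "T \<le> t" "t \<le> b" "t < tb" "0 \<le> t" using b T by auto
      show "(?\<kappa> has_real_derivative L / sqrt (tb - t)) (at t within {T..b})"
        using t by (auto intro!: derivative_eq_intros simp: field_simps)
      define h where "h = sqrt (tb - t)"
      have h: "0 < h" "h \<le> 1" using t T by (auto simp: h_def)
      define x y s where "x = p t / z t" and "y = q t" and "s = 1 / z t"
      have z: "0 < z t" using zpos t by auto
      have s0: "0 < s" using z by (simp add: s_def)
      have s: "s \<le> 1 / (sqrt (v tb) * h)"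
      proof -
        have "sqrt (v tb * (tb - t)) \<le> z t" using T1(3)[of t] t T z by (intro real_le_lsqrt) auto
        then have "sqrt (v tb) * h \<le> z t" by (simp add: real_sqrt_mult h_def)
        then show ?thesis unfolding s_def using h v z by (intro divide_left_mono) auto
      qed
      have xy: "2 * (\<bar>x\<bar> * \<bar>y\<bar>) \<le> x\<^sup>2 + y\<^sup>2" using sum_squares_bound[of "\<bar>x\<bar>" "\<bar>y\<bar>"] by simp
      have 1: "2 * (\<sigma> * (x * y)) \<le> x\<^sup>2 + y\<^sup>2"
        using xy \<sigma> abs_ge_self[of "\<sigma> * (x * y)"] by (simp add: abs_mult)
      have 2: "- 2 * (c1 t * x\<^sup>2) \<le> 2 * \<beta> * (x\<^sup>2 + y\<^sup>2)"
      proof -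
        have "- (c1 t) * x\<^sup>2 \<le> \<beta> * (x\<^sup>2 + y\<^sup>2)"
          using c_bound(1)[OF t(4)] \<beta>_nonneg by (intro mult_mono) auto
        then show ?thesis by simp
      qed
      have 3: "2 * (x * y) - 2 * y\<^sup>2 \<le> x\<^sup>2 + y\<^sup>2"
      proof -
        have "x * y \<le> \<bar>x\<bar> * \<bar>y\<bar>" using abs_ge_self[of "x * y"] by (simp add: abs_mult)
        then show ?thesis using xy zero_le_power2[of y] by linarith
      qed
      have "2 * x * (\<sigma> * y / z t - c1 t * x / z t) + 2 * y * (x - y) =
          (2 * (\<sigma> * (x * y)) + - 2 * (c1 t * x\<^sup>2)) * s + (2 * (x * y) - 2 * y\<^sup>2)"
        by (simp add: s_def algebra_simps power2_eq_square diff_divide_distrib)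
      also have "\<dots> \<le> (1 + 2 * \<beta>) * (x\<^sup>2 + y\<^sup>2) * s + (x\<^sup>2 + y\<^sup>2)"
      proof (rule add_mono[OF mult_right_mono 3])
        show "2 * (\<sigma> * (x * y)) + - 2 * (c1 t * x\<^sup>2) \<le> (1 + 2 * \<beta>) * (x\<^sup>2 + y\<^sup>2)"
          using add_mono[OF 1 2] by (simp add: algebra_simps)
      qed (use s0 in simp)
      also have "\<dots> \<le> (1 + 2 * \<beta>) * (x\<^sup>2 + y\<^sup>2) * (1 / (sqrt (v tb) * h)) + (x\<^sup>2 + y\<^sup>2) * (1 / h)"
      proof (rule add_mono[OF mult_left_mono[OF s]])
        show "0 \<le> (1 + 2 * \<beta>) * (x\<^sup>2 + y\<^sup>2)" using \<beta>_nonneg by simp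
        have "(x\<^sup>2 + y\<^sup>2) * 1 \<le> (x\<^sup>2 + y\<^sup>2) * (1 / h)" using h by (intro mult_left_mono) auto
        then show "x\<^sup>2 + y\<^sup>2 \<le> (x\<^sup>2 + y\<^sup>2) * (1 / h)" by simp
      qed
      also have "\<dots> = L / h * (x\<^sup>2 + y\<^sup>2)"
        using h v by (simp add: L_def field_simps)
      finally show "2 * (p t / z t) * (\<sigma> * q t / z t - c1 t * (p t / z t) / z t) + 2 * q t * (p t / z t - q t)
          \<le> L / sqrt (tb - t) * ?N t" by (simp only: x_def y_def h_def)
    qed
    also have "\<dots> \<le> ?N T * exp (2 * L)"
    proof (rule mult_left_mono)
      have "L * sqrt (tb - T) \<le> L * 1" using L T by (intro mult_left_mono) auto
      moreover have "0 \<le> L * sqrt (tb - b)" using L b by simp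
      ultimately show "exp (?\<kappa> b - ?\<kappa> T) \<le> exp (2 * L)" by simp
    qed simp
    finally show ?thesis .
  qed
  have cont: "continuous_on {0..T} ?N"
    using continuous_on_state(3)[OF T(1,2)]
    by (intro continuous_intros continuous_on_state[OF T(1,2)] adjoint_continuous_on[OF adj T(2)]) auto
  obtain M where M: "0 \<le> M" "\<And>t. 0 \<le> t \<Longrightarrow> t \<le> T \<Longrightarrow> \<bar>?N t\<bar> \<le> M"
    using continuous_on_Icc_bounded[OF cont] by blast
  define C where "C = sqrt (max M (?N T * exp (2 * L)))"
  have NC: "?N t \<le> C\<^sup>2" if "0 \<le> t" "t < tb" for t
  proof -
    have "?N t \<le> max M (?N T * exp (2 * L))"
    proof (cases "t \<le> T")
      case True then show ?thesis using M(2)[OF that(1)] by (simp add: le_max_iff_disj)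
    next
      case False then show ?thesis using Nb[of t] that by (simp add: le_max_iff_disj)
    qed
    moreover have "0 \<le> max M (?N T * exp (2 * L))" using M(1) by (simp add: le_max_iff_disj)
    ultimately show ?thesis by (simp add: C_def)
  qed
  have C0: "0 \<le> C" using M(1) by (simp add: C_def le_max_iff_disj)
  show ?thesis
  proof (rule that[OF C0])
    fix t assume t: "0 \<le> t" "t < tb"
    have "(p t / z t)\<^sup>2 \<le> C\<^sup>2" "(q t)\<^sup>2 \<le> C\<^sup>2"
      using NC[OF t] zero_le_power2[of "p t / z t"] zero_le_power2[of "q t"] by linarith+
    then have "\<bar>p t / z t\<bar> \<le> C" "\<bar>q t\<bar> \<le> C"
      using abs_le_square_iff[of "p t / z t" C] abs_le_square_iff[of "q t" C] C0 by linarith+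
    then show "\<bar>p t\<bar> \<le> C * z t \<and> \<bar>q t\<bar> \<le> C" using closed_pos[OF sol t] by (simp add: abs_divide pos_divide_le_eq)
  qed
qed

lemma extremal_adjoint_of_multipliers:
  assumes "0 \<le> T0" "T0 < tb"
    and each: "\<And>T p1 q1 p2 q2. T0 \<le> T \<Longrightarrow> T < tb \<Longrightarrow> adjoint p1 q1 \<Longrightarrow> adjoint p2 q2 \<Longrightarrow>
      p1 0 = 1 \<Longrightarrow> q1 0 = 0 \<Longrightarrow> p2 0 = 0 \<Longrightarrow> q2 0 = 1 \<Longrightarrow>
      \<exists>a b. a\<^sup>2 + b\<^sup>2 = 1 \<and> (\<forall>k1 k2. K k1 k2 \<longrightarrow> a * variation p1 q1 k1 k2 T + b * variation p2 q2 k1 k2 T \<le> 0)"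
  shows "\<exists>p q. adjoint p q \<and> (p 0)\<^sup>2 + (q 0)\<^sup>2 = 1 \<and>
    (\<forall>T k1 k2. 0 \<le> T \<longrightarrow> T < tb \<longrightarrow> K k1 k2 \<longrightarrow> variation p q k1 k2 T \<le> 0)"
proof -
  obtain p1 q1 where 1: "adjoint p1 q1" "p1 0 = 1" "q1 0 = 0" using adjoint_exists by blast
  obtain p2 q2 where 2: "adjoint p2 q2" "p2 0 = 0" "q2 0 = 1" using adjoint_exists by blast
  have each': "\<exists>a b. a\<^sup>2 + b\<^sup>2 = 1 \<and> True \<and>
      (\<forall>k1 k2. K k1 k2 \<longrightarrow> a * variation p1 q1 k1 k2 T + b * variation p2 q2 k1 k2 T \<le> 0)"
    if "T0 \<le> T" "T < tb" for T
    using each[OF that 1(1) 2(1) 1(2,3) 2(2,3)] by simp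
  obtain a b where ab: "a\<^sup>2 + b\<^sup>2 = 1"
    "\<And>T k1 k2. 0 \<le> T \<Longrightarrow> T < tb \<Longrightarrow> K k1 k2 \<Longrightarrow> a * variation p1 q1 k1 k2 T + b * variation p2 q2 k1 k2 T \<le> 0"
    by (rule limit_multiplier[OF assms(1,2) 1(1) 2(1), of "\<lambda>_ _ _. True"])
       (rule each', assumption+, rule that)
  show ?thesis
  proof (intro exI conjI allI impI)
    show "adjoint (\<lambda>t. a * p1 t + b * p2 t) (\<lambda>t. a * q1 t + b * q2 t)" by (rule adjoint_combination[OF 1(1) 2(1)])
    show "(a * p1 0 + b * p2 0)\<^sup>2 + (a * q1 0 + b * q2 0)\<^sup>2 = 1" using ab(1) 1 2 by simp
    fix T k1 k2 assume "0 \<le> T" "T < tb" and k: "K k1 k2"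
    then show "variation (\<lambda>t. a * p1 t + b * p2 t) (\<lambda>t. a * q1 t + b * q2 t) k1 k2 T \<le> 0"
      using ab(2) by (simp add: variation_adjoint_linear[OF k 1(1) 2(1)])
  qed
qed

lemma extremal_adjoint_degenerate:
  assumes v0: "v tb = 0"
  shows "\<exists>p q. adjoint p q \<and> (p 0)\<^sup>2 + (q 0)\<^sup>2 = 1 \<and>
    (\<forall>T k1 k2. 0 \<le> T \<longrightarrow> T < tb \<longrightarrow> K k1 k2 \<longrightarrow> variation p q k1 k2 T \<le> 0)"
proof -
  obtain T1 where T1: "0 \<le> T1" "T1 < tb" "\<And>t. T1 \<le> t \<Longrightarrow> t \<le> tb \<Longrightarrow> \<bar>v t - v tb\<bar> < 1 / 2"
    using continuous_at_end[OF closed_cont(2)[OF sol], of "1/2"] by auto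
  define T0 where "T0 = max T1 (tb - 1 / 8)"
  have T0: "0 \<le> T0" "T0 < tb" "T1 \<le> T0" "tb - 1 / 8 \<le> T0" using T1 by (auto simp: T0_def)
  show ?thesis
  proof (rule extremal_adjoint_of_multipliers[OF T0(1,2)])
    fix T p1 q1 p2 q2
    assume T: "T0 \<le> T" "T < tb" and adj: "adjoint p1 q1" "adjoint p2 q2"
      and init: "p1 0 = 1" "q1 0 = 0" "p2 0 = 0" "q2 0 = 1"
    have T': "0 \<le> T" using T T0 by simp
    \<comment> \<open>The cones \<open>\<delta>z < 0\<close>, \<open>\<delta>v > 0\<close> and \<open>\<delta>z < 0\<close>, \<open>\<delta>v > - 4 * s * \<delta>z\<close>.\<close>
    define A where "A = (if \<sigma> = 1 then 0 else 4 * (tb - T))"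
    have blocked: "\<not> (0 < (- 1) * (z' T - z T) + 0 * (v' T - v T) \<and> 0 < A * (z' T - z T) + 1 * (v' T - v T))"
      if tl: "tail T l1 l2 z' v'" for l1 l2 z' v'
    proof
      assume pos: "0 < (- 1) * (z' T - z T) + 0 * (v' T - v T) \<and> 0 < A * (z' T - z T) + 1 * (v' T - v T)"
      then have d: "0 < z T - z' T" by simp
      show False
      proof (cases "\<sigma> = 1")
        case True
        then show False using ahead_impossible_cooperative[OF True tl d] pos by (simp add: A_def)
      next
        case False
        then have "\<sigma> = -1" using \<sigma>_cases by simp
        moreover have "0 < (v' T - v T) - 4 * (tb - T) * (z T - z' T)"
          using pos False by (simp add: A_def algebra_simps)
        moreover have "- 1 / 2 \<le> v t" if "T \<le> t" "t \<le> tb" for t using T1(3)[of t] that T T0 v0 by auto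
        ultimately show False using ahead_impossible_oscillating[OF _ tl _ _ d] T T0 by auto
      qed
    qed
    show "\<exists>a b. a\<^sup>2 + b\<^sup>2 = 1 \<and>
      (\<forall>k1 k2. K k1 k2 \<longrightarrow> a * variation p1 q1 k1 k2 T + b * variation p2 q2 k1 k2 T \<le> 0)"
    proof -
      have "\<exists>a b \<mu>1 \<mu>2. a\<^sup>2 + b\<^sup>2 = 1 \<and> 0 \<le> \<mu>1 \<and> 0 \<le> \<mu>2 \<and>
        a * p1 T + b * p2 T = \<mu>1 * (- 1) + \<mu>2 * A \<and> a * q1 T + b * q2 T = \<mu>1 * 0 + \<mu>2 * 1 \<and>
        (\<forall>k1 k2. K k1 k2 \<longrightarrow> a * variation p1 q1 k1 k2 T + b * variation p2 q2 k1 k2 T \<le> 0)"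
        by (rule stationary_at[OF T' T(2) adj init]) (simp, erule blocked)
      then show ?thesis by blast
    qed
  qed
qed

text \<open>
  The terminal value at \<open>T\<close> lies in the dual of a cone that opens to the half plane
  \<open>\<delta>z < 0\<close>, which means that \<open>q\<close> is small there in comparison with \<open>p / z\<close>. Since \<open>p / z\<close> and \<open>q\<close> stay bounded
  and \<open>q\<close> is Lipschitz, the limit solution satisfies \<open>\<bar>q\<bar> = O(tb - t)\<close> and \<open>\<bar>p\<bar> = O(z)\<close>.
\<close>
lemma extremal_adjoint_transversal:
  assumes v: "0 < v tb"
  shows "\<exists>p q. adjoint p q \<and> (p 0)\<^sup>2 + (q 0)\<^sup>2 = 1 \<and>
    (\<forall>T k1 k2. 0 \<le> T \<longrightarrow> T < tb \<longrightarrow> K k1 k2 \<longrightarrow> variation p q k1 k2 T \<le> 0) \<and>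
    (p \<longlongrightarrow> 0) (at_left tb) \<and> (q \<longlongrightarrow> 0) (at_left tb)"
proof -
  obtain p1 q1 where 1: "adjoint p1 q1" "p1 0 = 1" "q1 0 = 0" using adjoint_exists by blast
  obtain p2 q2 where 2: "adjoint p2 q2" "p2 0 = 0" "q2 0 = 1" using adjoint_exists by blast
  obtain T1 where T1: "0 \<le> T1" "T1 < tb" "\<And>t. T1 \<le> t \<Longrightarrow> t < tb \<Longrightarrow> v tb * (tb - t) \<le> (z t)\<^sup>2"
    using z_lower_bound[OF v] by blast
  define M where "M = (2 * \<beta> + 1) / sqrt (v tb)"
  have M: "0 \<le> M" using \<beta>_nonneg v by (simp add: M_def)
  \<comment> \<open>The invariance of the cone needs \<open>M + 2 + h \<le> 1 / (2 * h)\<close> for \<open>h = \<surd>(tb - T)\<close>, and \<open>h \<le> \<delta>\<close>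
    is enough.\<close>
  define \<delta> where "\<delta> = 1 / (2 * (M + 3))"
  have \<delta>: "0 < \<delta>" "\<delta> \<le> 1" using M by (simp_all add: \<delta>_def)
  define T0 where "T0 = max T1 (tb - \<delta>\<^sup>2)"
  have T0: "0 \<le> T0" "T0 < tb" "T1 \<le> T0" "tb - \<delta>\<^sup>2 \<le> T0" using T1 \<delta> by (auto simp: T0_def)
  define R where "R T a b \<longleftrightarrow> \<bar>a * q1 T + b * q2 T\<bar> * z T \<le> sqrt (tb - T) * \<bar>a * p1 T + b * p2 T\<bar>" for T a b
  have each: "\<exists>a b. a\<^sup>2 + b\<^sup>2 = 1 \<and> R T a b \<and>
      (\<forall>k1 k2. K k1 k2 \<longrightarrow> a * variation p1 q1 k1 k2 T + b * variation p2 q2 k1 k2 T \<le> 0)"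
    if T: "T0 \<le> T" "T < tb" for T
  proof -
    define h where "h = sqrt (tb - T)"
    have T': "0 \<le> T" using T T0 by simp
    have zT: "0 < z T" by (rule closed_pos[OF sol T' T(2)])
    have h: "0 < h" "h \<le> \<delta>" using T T0 \<delta> by (auto simp: h_def intro!: real_le_lsqrt)
    have near: "tb - T \<le> 1" "M + 2 + h \<le> 1 / (2 * h)"
    proof -
      have "\<delta>\<^sup>2 \<le> 1" using \<delta> by (simp add: power_le_one)
      then show "tb - T \<le> 1" using T T0 by linarith
      have "1 / (2 * \<delta>) = M + 3" using M by (simp add: \<delta>_def)
      then have "M + 2 + h \<le> 1 / (2 * \<delta>)" using h \<delta>(2) by linarith
      also have "\<dots> \<le> 1 / (2 * h)" using h \<delta> by (intro divide_left_mono) auto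
      finally show "M + 2 + h \<le> 1 / (2 * h)" .
    qed
    have det: "(- z T) * h - (- z T) * (- h) \<noteq> 0" using zT h by simp
    have blocked: "\<not> (0 < (- z T) * (z' T - z T) + (- h) * (v' T - v T) \<and> 0 < (- z T) * (z' T - z T) + h * (v' T - v T))"
      if tl: "tail T l1 l2 z' v'" for l1 l2 z' v'
    proof
      assume pos: "0 < (- z T) * (z' T - z T) + (- h) * (v' T - v T) \<and> 0 < (- z T) * (z' T - z T) + h * (v' T - v T)"
      have lower: "v tb * (tb - t) \<le> (z t)\<^sup>2" if "T \<le> t" "t < tb" for t using T1(3)[of t] that T T0 by auto
      show False
        by (rule ahead_impossible_transversal[OF tl v lower near(1)])
           (use near(2) pos in \<open>auto simp: M_def h_def algebra_simps\<close>)
    qed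
    obtain a b \<mu>1 \<mu>2 where ab: "a\<^sup>2 + b\<^sup>2 = 1" "0 \<le> \<mu>1" "0 \<le> \<mu>2"
      "a * p1 T + b * p2 T = \<mu>1 * (- z T) + \<mu>2 * (- z T)" "a * q1 T + b * q2 T = \<mu>1 * (- h) + \<mu>2 * h"
      and le: "\<forall>k1 k2. K k1 k2 \<longrightarrow> a * variation p1 q1 k1 k2 T + b * variation p2 q2 k1 k2 T \<le> 0"
    proof -
      have "\<exists>a b \<mu>1 \<mu>2. a\<^sup>2 + b\<^sup>2 = 1 \<and> 0 \<le> \<mu>1 \<and> 0 \<le> \<mu>2 \<and>
        a * p1 T + b * p2 T = \<mu>1 * (- z T) + \<mu>2 * (- z T) \<and> a * q1 T + b * q2 T = \<mu>1 * (- h) + \<mu>2 * h \<and>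
        (\<forall>k1 k2. K k1 k2 \<longrightarrow> a * variation p1 q1 k1 k2 T + b * variation p2 q2 k1 k2 T \<le> 0)"
        by (rule stationary_at[OF T' T(2) 1(1) 2(1) 1(2,3) 2(2,3) det]) (erule blocked)
      then show ?thesis using that by blast
    qed
    have "R T a b"
    proof -
      have "\<mu>1 * (- z T) + \<mu>2 * (- z T) = - ((\<mu>1 + \<mu>2) * z T)" by (simp add: algebra_simps)
      then have P: "\<bar>a * p1 T + b * p2 T\<bar> = (\<mu>1 + \<mu>2) * z T" using ab zT by (simp add: abs_mult)
      have "\<mu>1 * (- h) + \<mu>2 * h = (\<mu>2 - \<mu>1) * h" by (simp add: algebra_simps)
      then have "\<bar>a * q1 T + b * q2 T\<bar> = \<bar>\<mu>2 - \<mu>1\<bar> * h" using ab(5) h by (simp add: abs_mult)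
      also have "\<dots> \<le> (\<mu>1 + \<mu>2) * h" using ab h by (intro mult_right_mono) auto
      finally have "\<bar>a * q1 T + b * q2 T\<bar> * z T \<le> (\<mu>1 + \<mu>2) * h * z T" using zT by (intro mult_right_mono) auto
      then show ?thesis unfolding R_def P h_def by (simp add: mult_ac)
    qed
    then show ?thesis using ab(1) le by blast
  qed
  obtain a b and Tn an bn :: "nat \<Rightarrow> real" where ab: "a\<^sup>2 + b\<^sup>2 = 1" and lim: "an \<longlonglongrightarrow> a" "bn \<longlonglongrightarrow> b" "Tn \<longlonglongrightarrow> tb"
    and n: "\<And>n. T0 \<le> Tn n \<and> Tn n < tb \<and> (an n)\<^sup>2 + (bn n)\<^sup>2 = 1 \<and> R (Tn n) (an n) (bn n)"
    and le: "\<And>T k1 k2. 0 \<le> T \<Longrightarrow> T < tb \<Longrightarrow> K k1 k2 \<Longrightarrow> a * variation p1 q1 k1 k2 T + b * variation p2 q2 k1 k2 T \<le> 0"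
    by (rule limit_multiplier[OF T0(1,2) 1(1) 2(1), of R]) (rule each, assumption+, rule that)
  let ?p = "\<lambda>t. a * p1 t + b * p2 t" and ?q = "\<lambda>t. a * q1 t + b * q2 t"
  obtain C1 where C1: "0 \<le> C1" "\<And>t. 0 \<le> t \<Longrightarrow> t < tb \<Longrightarrow> \<bar>p1 t\<bar> \<le> C1 * z t \<and> \<bar>q1 t\<bar> \<le> C1"
    using adjoint_bounded[OF 1(1) v] by blast
  obtain C2 where C2: "0 \<le> C2" "\<And>t. 0 \<le> t \<Longrightarrow> t < tb \<Longrightarrow> \<bar>p2 t\<bar> \<le> C2 * z t \<and> \<bar>q2 t\<bar> \<le> C2"
    using adjoint_bounded[OF 2(1) v] by blast
  define C where "C = C1 + C2"
  have C0: "0 \<le> C" using C1 C2 by (simp add: C_def)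
  have comb: "\<bar>\<alpha> * x1 + \<gamma> * x2\<bar> \<le> y1 + y2"
    if "\<alpha>\<^sup>2 + \<gamma>\<^sup>2 = 1" "\<bar>x1\<bar> \<le> y1" "\<bar>x2\<bar> \<le> y2" for \<alpha> \<gamma> x1 x2 y1 y2 :: real
  proof -
    have "\<alpha>\<^sup>2 \<le> 1\<^sup>2" "\<gamma>\<^sup>2 \<le> 1\<^sup>2" using that(1) zero_le_power2[of \<alpha>] zero_le_power2[of \<gamma>] unfolding one_power2 by linarith+
    then have "\<bar>\<alpha>\<bar> \<le> 1" "\<bar>\<gamma>\<bar> \<le> 1"
      using abs_le_square_iff[of \<alpha> 1] abs_le_square_iff[of \<gamma> 1] by linarith+
    then have "\<bar>\<alpha>\<bar> * \<bar>x1\<bar> \<le> 1 * y1" "\<bar>\<gamma>\<bar> * \<bar>x2\<bar> \<le> 1 * y2" using that by (intro mult_mono; simp)+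
    then show ?thesis using abs_triangle_ineq[of "\<alpha> * x1" "\<gamma> * x2"] by (simp add: abs_mult)
  qed
  have bp: "\<bar>\<alpha> * p1 t + \<gamma> * p2 t\<bar> \<le> C * z t" "\<bar>\<alpha> * q1 t + \<gamma> * q2 t\<bar> \<le> C"
    if "\<alpha>\<^sup>2 + \<gamma>\<^sup>2 = 1" "0 \<le> t" "t < tb" for \<alpha> \<gamma> t
    using comb[OF that(1), of "p1 t" "C1 * z t" "p2 t" "C2 * z t"] comb[OF that(1), of "q1 t" C1 "q2 t" C2]
      C1(2)[OF that(2,3)] C2(2)[OF that(2,3)] by (simp_all add: C_def distrib_right)
  have q_end: "\<bar>?q t\<bar> \<le> 2 * C * (tb - t)" if t: "0 \<le> t" "t < tb" for t
  proof -
    let ?rhs = "\<lambda>n. sqrt (tb - Tn n) * C + 2 * C * (Tn n - t)"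
    have "\<forall>\<^sub>F n in sequentially. t < Tn n" by (rule order_tendstoD(1)[OF lim(3) t(2)])
    then have ev: "\<forall>\<^sub>F m in sequentially. \<bar>an m * q1 t + bn m * q2 t\<bar> \<le> ?rhs m"
    proof (rule eventually_mono)
      fix m assume m: "t < Tn m"
      note nm = n[of m]
      have Tm: "0 \<le> Tn m" "Tn m < tb" using nm T0 by auto
      have nrm: "(an m)\<^sup>2 + (bn m)\<^sup>2 = 1" using nm by simp
      let ?pm = "\<lambda>t. an m * p1 t + bn m * p2 t" and ?qm = "\<lambda>t. an m * q1 t + bn m * q2 t"
      have zm: "0 < z (Tn m)" by (rule closed_pos[OF sol Tm])
      have "\<bar>?qm (Tn m)\<bar> * z (Tn m) \<le> sqrt (tb - Tn m) * \<bar>?pm (Tn m)\<bar>" using nm by (simp add: R_def)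
      also have "\<dots> \<le> sqrt (tb - Tn m) * (C * z (Tn m))"
        using bp(1)[OF nrm Tm] Tm by (intro mult_left_mono) auto
      finally have e: "\<bar>?qm (Tn m)\<bar> \<le> sqrt (tb - Tn m) * C" using zm by (simp flip: mult.assoc)
      have "bounded_primitive ?qm (\<lambda>t. ?pm t / z t - ?qm t) t (Tn m)"
        by (rule bounded_primitive_subinterval[OF adjoint_bp(2)[OF adjoint_combination[OF 1(1) 2(1)] Tm]]) (use t in auto)
      then have "\<bar>?qm t - ?qm (Tn m)\<bar> \<le> (2 * C) * \<bar>t - Tn m\<bar>"
      proof (rule bounded_primitive_lipschitz)
        fix u assume u: "t \<le> u" "u \<le> Tn m"
        have u': "0 \<le> u" "u < tb" using u t Tm by auto
        have "\<bar>?pm u / z u\<bar> \<le> C"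
          using bp(1)[OF nrm u'] closed_pos[OF sol u'] by (simp add: abs_divide pos_divide_le_eq)
        then show "\<bar>?pm u / z u - ?qm u\<bar> \<le> 2 * C" using bp(2)[OF nrm u'] by linarith
      qed (use C0 m in auto)
      then show "\<bar>?qm t\<bar> \<le> ?rhs m" using e m by simp
    qed
    have l1: "(\<lambda>m. \<bar>an m * q1 t + bn m * q2 t\<bar>) \<longlonglongrightarrow> \<bar>?q t\<bar>" by (intro tendsto_intros lim)
    have "?rhs \<longlonglongrightarrow> sqrt (tb - tb) * C + 2 * C * (tb - t)" by (intro tendsto_intros lim)
    then have l2: "?rhs \<longlonglongrightarrow> 2 * C * (tb - t)" by simp
    show ?thesis by (rule tendsto_le[OF sequentially_bot l2 l1 ev])
  qed
  have ev0: "\<forall>\<^sub>F t in at_left tb. 0 \<le> t \<and> t < tb"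
    by (rule eventually_at_leftI[of 0]) (use tb in auto)
  have "((\<lambda>t. 2 * C * (tb - t)) \<longlongrightarrow> 2 * C * (tb - tb)) (at_left tb)" by (intro tendsto_intros)
  then have "(?q \<longlongrightarrow> 0) (at_left tb)"
    by (intro Lim_null_comparison[of ?q "\<lambda>t. 2 * C * (tb - t)"] eventually_mono[OF ev0]) (use q_end in auto)
  moreover have "(?p \<longlongrightarrow> 0) (at_left tb)"
  proof (rule Lim_null_comparison[of ?p "\<lambda>t. C * z t"])
    show "\<forall>\<^sub>F t in at_left tb. norm (?p t) \<le> C * z t"
      by (rule eventually_mono[OF ev0]) (use bp(1)[OF ab] in auto)
    have "(z \<longlongrightarrow> z tb) (at_left tb)" by (rule continuous_on_Icc_at_leftD[OF closed_cont(1)[OF sol] tb])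
    then have "((\<lambda>t. C * z t) \<longlongrightarrow> C * z tb) (at_left tb)" by (intro tendsto_intros)
    then show "((\<lambda>t. C * z t) \<longlongrightarrow> 0) (at_left tb)" using quenched by simp
  qed
  moreover have "variation ?p ?q k1 k2 T \<le> 0" if "0 \<le> T" "T < tb" "K k1 k2" for T k1 k2
    unfolding variation_adjoint_linear[OF that(3) 1(1) 2(1) that(2)] by (rule le[OF that])
  moreover have "(?p 0)\<^sup>2 + (?q 0)\<^sup>2 = 1" using ab 1 2 by simp
  ultimately show ?thesis using adjoint_combination[OF 1(1) 2(1), of a b]
    by (intro exI[of _ ?p] exI[of _ ?q]) blast
qed

theorem extremal_adjoint:
  obtains p q where "adjoint p q" "(p 0)\<^sup>2 + (q 0)\<^sup>2 = 1"
    "\<And>T k1 k2. 0 \<le> T \<Longrightarrow> T < tb \<Longrightarrow> K k1 k2 \<Longrightarrow> variation p q k1 k2 T \<le> 0"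
    "0 < v tb \<Longrightarrow> (p \<longlongrightarrow> 0) (at_left tb) \<and> (q \<longlongrightarrow> 0) (at_left tb)"
proof (cases "0 < v tb")
  case True
  then show ?thesis using extremal_adjoint_transversal that by blast
next
  case False
  then have "v tb = 0" using v_end_nonneg by simp
  then show ?thesis using extremal_adjoint_degenerate that False by blast
qed

end

section \<open>Return to the original variables\<close>

lemma infdist_Q: "infdist y Q = \<bar>y $ 1 - 1\<bar>"
proof (rule antisym)
  define q :: "real^2" where "q = y + (1 - y $ 1) *\<^sub>R axis 1 1"
  have "q \<in> Q" by (simp add: q_def Q_def axis_def)
  moreover have "dist y q = \<bar>y $ 1 - 1\<bar>" by (simp add: q_def dist_norm)
  ultimately show "infdist y Q \<le> \<bar>y $ 1 - 1\<bar>" by (metis infdist_le)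
  have "Q \<noteq> {}" using \<open>q \<in> Q\<close> by auto
  moreover have "\<bar>y $ 1 - 1\<bar> \<le> dist y x" if "x \<in> Q" for x
    using Finite_Cartesian_Product.norm_nth_le[of "y - x" 1] that by (simp add: Q_def dist_norm)
  ultimately show "\<bar>y $ 1 - 1\<bar> \<le> infdist y Q"
    unfolding infdist_def by (auto intro!: cINF_greatest)
qed

lemma Liminf_zero_iff:
  fixes g :: "real \<Rightarrow> real"
  assumes nn: "\<And>t. 0 \<le> g t" and T: "0 < T"
  shows "Liminf (at_left T) (\<lambda>t. ereal (g t)) = 0 \<longleftrightarrow>
    (\<forall>c t0. 0 < c \<longrightarrow> t0 < T \<longrightarrow> (\<exists>t. t0 < t \<and> 0 \<le> t \<and> t < T \<and> g t < c))"
    (is "?L = 0 \<longleftrightarrow> ?R")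
proof
  assume L: "?L = 0"
  show ?R
  proof (intro allI impI, rule ccontr)
    fix c t0 assume c: "0 < c" "t0 < T" and no: "\<not> (\<exists>t. t0 < t \<and> 0 \<le> t \<and> t < T \<and> g t < c)"
    have "\<forall>\<^sub>F t in at_left T. ereal c \<le> ereal (g t)"
    proof (rule eventually_at_leftI[of "max 0 t0"])
      fix t assume "t \<in> {max 0 t0<..<T}"
      then have "t0 < t" "0 \<le> t" "t < T" by auto
      then have "\<not> g t < c" using no by blast
      then show "ereal c \<le> ereal (g t)" by simp
    qed (use c T in simp)
    then have "ereal c \<le> ?L" by (rule Liminf_bounded)
    then show False using L c by simp
  qed
next
  assume R: ?R
  have "0 \<le> ?L" by (rule Liminf_bounded) (use nn in simp)
  moreover have "\<not> 0 < ?L"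
  proof
    assume "0 < ?L"
    then obtain c where c: "0 < ereal c" "ereal c < ?L" using ereal_dense2 by blast
    have "\<forall>\<^sub>F t in at_left T. ereal c < ereal (g t)" by (rule less_LiminfD[OF c(2)])
    then obtain t0 where t0: "t0 < T" "\<And>t. t0 < t \<Longrightarrow> t < T \<Longrightarrow> c < g t"
      unfolding eventually_at_left_field by auto
    obtain t where "t0 < t" "t < T" "g t < c" using R c(1) t0(1) by (metis ereal_less(2))
    then show False using t0(2)[of t] by simp
  qed
  ultimately show "?L = 0" by simp
qed

lemma borel_measurable_vec_nth:
  fixes g :: "'a \<Rightarrow> 'b::real_normed_vector^'n"
  assumes "g \<in> borel_measurable M"
  shows "(\<lambda>t. g t $ i) \<in> borel_measurable M"
proof -
  have "(\<lambda>x :: 'b^'n. x $ i) \<in> borel_measurable borel"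
    by (intro borel_measurable_continuous_onI continuous_intros)
  from measurable_compose[OF assms this] show ?thesis .
qed

lemma vec2_eq_axis: "(x :: real^2) = x $ 1 *\<^sub>R axis 1 1 + x $ 2 *\<^sub>R axis 2 1"
  by (simp add: vec_eq_iff forall_2 axis_def)

lemma borel_measurable_vec2:
  fixes g :: "'a \<Rightarrow> real^2"
  assumes "(\<lambda>t. g t $ 1) \<in> borel_measurable M" "(\<lambda>t. g t $ 2) \<in> borel_measurable M"
  shows "g \<in> borel_measurable M"
proof -
  have "(\<lambda>t. g t $ 1 *\<^sub>R (axis 1 1 :: real^2) + g t $ 2 *\<^sub>R axis 2 1) \<in> borel_measurable M"
    by (intro borel_measurable_add borel_measurable_scaleR assms borel_measurable_const)
  then show ?thesis by (simp only: vec2_eq_axis[symmetric])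
qed

lemma has_integral_vec2:
  fixes g :: "real \<Rightarrow> real^2"
  assumes "((\<lambda>t. g t $ 1) has_integral I $ 1) S" "((\<lambda>t. g t $ 2) has_integral I $ 2) S"
  shows "(g has_integral I) S"
proof -
  have "((\<lambda>t. g t $ 1 *\<^sub>R (axis 1 1 :: real^2) + g t $ 2 *\<^sub>R axis 2 1) has_integral
      (I $ 1 *\<^sub>R axis 1 1 + I $ 2 *\<^sub>R axis 2 1)) S"
    by (intro has_integral_add has_integral_scaleR_left assms)
  then show ?thesis by (simp only: vec2_eq_axis[symmetric])
qed

lemma has_integral_vec_nth:
  fixes g :: "real \<Rightarrow> real^2"
  assumes "(g has_integral I) S" shows "((\<lambda>t. g t $ i) has_integral I $ i) S"
  using has_integral_linear[OF assms bounded_linear_vec_nth[of i]] by (simp add: o_def)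

lemma f_nth:
  "f B t y u $ 1 = y $ 2 / (1 - y $ 1) + (B t *v u) $ 1"
  "f B t y u $ 2 = y $ 1 + y $ 2 + (B t *v u) $ 2"
  by (simp_all add: f_def)

lemma borel_measurable_lebesgue_on_subset:
  fixes g :: "real \<Rightarrow> 'b::euclidean_space"
  assumes g: "g \<in> borel_measurable (lebesgue_on S)" and "T \<subseteq> S" "T \<in> sets lebesgue"
  shows "g \<in> borel_measurable (lebesgue_on T)"
  using measurable_restrict_mono[OF g \<open>T \<subseteq> S\<close>] .

text \<open>
  Here \<open>B\<close> is bounded at every \<open>t \<ge> 0\<close>, and not only almost everywhere, so that all forcings are
  bounded functions.
\<close>
locale bounded_plant =
  fixes \<rho> C :: real and B :: "real \<Rightarrow> real^2^2" and y0 :: "real^2"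
  assumes \<rho>: "0 < \<rho>" and B_meas: "B \<in> borel_measurable (lebesgue_on {0..})"
    and B_bound: "\<And>t. 0 \<le> t \<Longrightarrow> norm (B t) \<le> C" and y0: "y0 $ 1 \<noteq> 1"
begin

definition \<sigma> :: real where "\<sigma> = (if y0 $ 1 < 1 then 1 else -1)"

definition k1 :: "(real \<Rightarrow> real^2) \<Rightarrow> real \<Rightarrow> real" where "k1 u t = - \<sigma> * (B t *v u t) $ 1"

definition k2 :: "(real \<Rightarrow> real^2) \<Rightarrow> real \<Rightarrow> real" where "k2 u t = (B t *v u t) $ 2"

definition z0 :: real where "z0 = \<sigma> * (1 - y0 $ 1)"

lemma \<sigma>_abs: "\<bar>\<sigma>\<bar> = 1" and \<sigma>_sq: "\<sigma> * \<sigma> = 1" by (simp_all add: \<sigma>_def)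

lemma z0_pos: "0 < z0" using y0 by (simp add: z0_def \<sigma>_def)

lemma C_nonneg: "0 \<le> C" using B_bound[of 0] norm_ge_zero order_trans by blast

lemma controlsD:
  assumes "u \<in> controls \<rho>"
  shows "u \<in> borel_measurable (lebesgue_on {0..})" "\<And>t. 0 \<le> t \<Longrightarrow> norm (u t) \<le> \<rho>"
  using assms by (auto simp: controls_def U_def)

lemma matrix_vector_nth_bound:
  fixes A :: "real^2^2" shows "\<bar>(A *v x) $ i\<bar> \<le> norm A * norm x"
proof -
  have "\<bar>(A *v x) $ i\<bar> = \<bar>inner (A $ i) x\<bar>" by (simp add: matrix_vector_mul_component)
  also have "\<dots> \<le> norm (A $ i) * norm x" by (rule Cauchy_Schwarz_ineq2)
  also have "\<dots> \<le> norm A * norm x" by (intro mult_right_mono Finite_Cartesian_Product.norm_nth_le norm_ge_zero)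
  finally show ?thesis .
qed

lemma matrix_vector_nth_measurable:
  assumes "u \<in> borel_measurable (lebesgue_on {0..})"
  shows "(\<lambda>t. (B t *v u t) $ i) \<in> borel_measurable (lebesgue_on {0..})"
proof -
  have "(\<lambda>t. B t $ i $ 1 * u t $ 1 + B t $ i $ 2 * u t $ 2) \<in> borel_measurable (lebesgue_on {0..})"
    by (intro borel_measurable_add borel_measurable_times borel_measurable_vec_nth B_meas assms)
  then show ?thesis by (simp add: matrix_vector_mult_def sum_2)
qed

lemma Bu_bound:
  assumes "u \<in> controls \<rho>" "0 \<le> t" shows "\<bar>(B t *v u t) $ i\<bar> \<le> C * \<rho>"
proof -
  have "\<bar>(B t *v u t) $ i\<bar> \<le> norm (B t) * norm (u t)" by (rule matrix_vector_nth_bound)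
  also have "\<dots> \<le> C * \<rho>" using B_bound[OF assms(2)] controlsD(2)[OF assms] C_nonneg by (intro mult_mono) auto
  finally show ?thesis .
qed

lemma forcing_Bu: assumes "u \<in> controls \<rho>" shows "forcing (C * \<rho>) (\<lambda>t. (B t *v u t) $ i)"
  unfolding forcing_def
proof (intro conjI allI impI)
  fix T :: real assume "0 \<le> T"
  have "(\<lambda>t. (B t *v u t) $ i) \<in> borel_measurable (lebesgue_on {0..T})"
    by (rule borel_measurable_lebesgue_on_subset[OF matrix_vector_nth_measurable[OF controlsD(1)[OF assms]]]) auto
  then have "(\<lambda>t. (B t *v u t) $ i) absolutely_integrable_on {0..T}"
    by (rule measurable_bounded_by_integrable_imp_absolutely_integrable[where g="\<lambda>_. C * \<rho>"])
       (use Bu_bound[OF assms] in auto)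
  then show "(\<lambda>t. (B t *v u t) $ i) integrable_on {0..T}" by (simp add: set_lebesgue_integral_eq_integral(1))
qed (rule Bu_bound[OF assms])

lemma forcing_k:
  assumes "u \<in> controls \<rho>" shows "forcing (C * \<rho>) (k1 u)" "forcing (C * \<rho>) (k2 u)"
proof -
  show "forcing (C * \<rho>) (k2 u)" using forcing_Bu[OF assms, of 2] by (simp add: k2_def[abs_def])
  have F: "forcing (C * \<rho>) (\<lambda>t. (B t *v u t) $ 1)" by (rule forcing_Bu[OF assms])
  then show "forcing (C * \<rho>) (k1 u)"
    using \<sigma>_abs integrable_on_cmult_left[of "\<lambda>t. (B t *v u t) $ 1" _ "- \<sigma>"]
    unfolding forcing_def k1_def[abs_def] by (auto simp: abs_mult)
qed

lemma triple_imp_solves: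
  assumes "(T, y, u) \<in> triples \<rho> B y0"
  shows "solves \<sigma> (k1 u) (k2 u) T (\<lambda>t. \<sigma> * (1 - y t $ 1)) (\<lambda>t. y t $ 2)" "\<sigma> * (1 - y 0 $ 1) = z0" "y 0 $ 2 = y0 $ 2"
proof -
  let ?z = "\<lambda>t. \<sigma> * (1 - y t $ 1)" and ?v = "\<lambda>t. y t $ 2"
  have T: "0 < T" and cy: "continuous_on {0..<T} y" and u: "u \<in> controls \<rho>"
    and all: "\<forall>t\<in>{0..<T}. y t \<notin> Q \<and> set_integrable lebesgue {0..t} (\<lambda>s. f B s (y s) (u s)) \<and>
      y t = y0 + (LINT s:{0..t}|lebesgue. f B s (y s) (u s))"
    using assms unfolding triples_def by blast+
  have nQ: "y t $ 1 \<noteq> 1" and si: "set_integrable lebesgue {0..t} (\<lambda>s. f B s (y s) (u s))"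
    and ye: "y t = y0 + (LINT s:{0..t}|lebesgue. f B s (y s) (u s))" if "0 \<le> t" "t < T" for t
  proof -
    have "t \<in> {0..<T}" using that by simp
    from bspec[OF all this] show "y t $ 1 \<noteq> 1" "set_integrable lebesgue {0..t} (\<lambda>s. f B s (y s) (u s))"
      "y t = y0 + (LINT s:{0..t}|lebesgue. f B s (y s) (u s))" unfolding Q_def by blast+
  qed
  have hi: "((\<lambda>s. f B s (y s) (u s)) has_integral (y t - y0)) {0..t}" if "0 \<le> t" "t < T" for t
    using set_lebesgue_integral_eq_integral[OF si[OF that]] ye[OF that] by (simp add: has_integral_integral)
  have "((\<lambda>s. f B s (y s) (u s)) has_integral (y 0 - y0)) {0..0}" by (rule hi) (use T in auto)
  moreover have "((\<lambda>s. f B s (y s) (u s)) has_integral 0) {0..0}" by (rule has_integral_null_real) simp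
  ultimately have "y 0 - y0 = 0" by (rule has_integral_unique)
  then have y_init: "y 0 = y0" by simp
  show "?z 0 = z0" "?v 0 = y0 $ 2" by (simp_all add: y_init z0_def)
  have zc: "continuous_on {0..<T} ?z" "continuous_on {0..<T} ?v" by (intro continuous_intros cy)+
  have zpos: "0 < ?z t" if t: "0 \<le> t" "t < T" for t
  proof (rule ccontr)
    assume neg: "\<not> 0 < ?z t"
    have "continuous_on {0..t} ?z" by (rule continuous_on_subset[OF zc(1)]) (use t in auto)
    then obtain s where s: "0 \<le> s" "s \<le> t" "?z s = 0"
      using IVT2'[of ?z t 0 0] neg t z0_pos y_init by (auto simp: z0_def)
    then show False using nQ[of s] t \<sigma>_abs by auto
  qed
  have "\<sigma> * (a / (\<sigma> * b)) = a / b" for a b by (cases "y0 $ 1 < 1") (simp_all add: \<sigma>_def)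
  then have y1: "y t $ 2 / (1 - y t $ 1) = \<sigma> * (y t $ 2 / ?z t)" for t by simp
  show "solves \<sigma> (k1 u) (k2 u) T ?z ?v"
    unfolding solves_def
  proof (intro allI impI conjI ballI)
    fix T' assume T': "0 \<le> T'" "T' < T"
    show "0 < ?z t" if "t \<in> {0..T'}" for t using zpos that T' by auto
    have c: "continuous_on {0..T'} ?z" "continuous_on {0..T'} ?v"
    proof -
      have "{0..T'} \<subseteq> {0..<T}" using T' by auto
      then show "continuous_on {0..T'} ?z" "continuous_on {0..T'} ?v"
        by (auto intro: continuous_on_subset[OF zc(1)] continuous_on_subset[OF zc(2)])
    qed
    have "?z t \<noteq> 0" if "t \<in> {0..T'}" for t using zpos[of t] that T' by force
    then have "continuous_on {0..T'} (\<lambda>t. - ?v t / ?z t)" by (intro continuous_on_divide continuous_on_minus c) blast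
    then obtain M1 where M1: "\<And>t. 0 \<le> t \<Longrightarrow> t \<le> T' \<Longrightarrow> \<bar>- ?v t / ?z t\<bar> \<le> M1" using continuous_on_Icc_bounded by blast
    have "continuous_on {0..T'} (\<lambda>t. 1 - \<sigma> * ?z t + ?v t)" by (intro continuous_intros c)
    then obtain M2 where M2: "\<And>t. 0 \<le> t \<Longrightarrow> t \<le> T' \<Longrightarrow> \<bar>1 - \<sigma> * ?z t + ?v t\<bar> \<le> M2" using continuous_on_Icc_bounded by blast
    have kb: "\<bar>k1 u t\<bar> \<le> C * \<rho>" "\<bar>k2 u t\<bar> \<le> C * \<rho>" if "0 \<le> t" for t
      using forcing_k[OF u] that by (auto simp: forcing_def)
    show "bounded_primitive ?z (\<lambda>t. - ?v t / ?z t + k1 u t) 0 T'"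
    proof (rule bounded_primitiveI_initial)
      fix t assume t: "0 \<le> t" "t \<le> T'"
      have "((\<lambda>s. - \<sigma> * f B s (y s) (u s) $ 1) has_integral (- \<sigma> * (y t - y0) $ 1)) {0..t}"
        by (intro has_integral_mult_right has_integral_vec_nth hi) (use t T' in auto)
      moreover have "- \<sigma> * (y t - y0) $ 1 = ?z t - z0" by (simp add: z0_def algebra_simps)
      moreover have "- \<sigma> * (\<sigma> * a + b) = - a + (- \<sigma> * b)" for a b
        by (cases "y0 $ 1 < 1") (simp_all add: \<sigma>_def)
      then have "- \<sigma> * f B s (y s) (u s) $ 1 = - ?v s / ?z s + k1 u s" for s
        unfolding f_nth(1) y1 k1_def minus_divide_left[symmetric] .
      ultimately show "((\<lambda>s. - ?v s / ?z s + k1 u s) has_integral (?z t - z0)) {0..t}" by (simp only:)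
      show "\<bar>- ?v t / ?z t + k1 u t\<bar> \<le> M1 + C * \<rho>" using M1[OF t] kb(1)[OF t(1)] by linarith
    qed
    show "bounded_primitive ?v (\<lambda>t. 1 - \<sigma> * ?z t + ?v t + k2 u t) 0 T'"
    proof (rule bounded_primitiveI_initial)
      fix t assume t: "0 \<le> t" "t \<le> T'"
      have "((\<lambda>s. f B s (y s) (u s) $ 2) has_integral ((y t - y0) $ 2)) {0..t}"
        by (intro has_integral_vec_nth hi) (use t T' in auto)
      moreover have "f B s (y s) (u s) $ 2 = 1 - \<sigma> * ?z s + ?v s + k2 u s" for s
        using \<sigma>_sq by (simp add: f_nth k2_def flip: mult.assoc)
      ultimately show "((\<lambda>s. 1 - \<sigma> * ?z s + ?v s + k2 u s) has_integral (?v t - y0 $ 2)) {0..t}"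
        by (simp only: vector_minus_component)
      show "\<bar>1 - \<sigma> * ?z t + ?v t + k2 u t\<bar> \<le> M2 + C * \<rho>" using M2[OF t] kb(2)[OF t(1)] by linarith
    qed
  qed
qed

lemma solves_imp_triple:
  assumes u: "u \<in> controls \<rho>" and T: "0 < T" and s: "solves \<sigma> (k1 u) (k2 u) T z v"
    and init: "z 0 = z0" "v 0 = y0 $ 2"
  shows "(T, \<lambda>t. vector [1 - \<sigma> * z t, v t], u) \<in> triples \<rho> B y0"
proof -
  let ?y = "\<lambda>t. vector [1 - \<sigma> * z t, v t] :: real^2"
  have cz: "continuous_on {0..T'} z" "continuous_on {0..T'} v" if "0 \<le> T'" "T' < T" for T'
    using bounded_primitive_continuous solvesD(2,3)[OF s that] by blast+
  have c2: "continuous_on {0..<T} x" if c: "\<And>T'. 0 \<le> T' \<Longrightarrow> T' < T \<Longrightarrow> continuous_on {0..T'} x" for x :: "real \<Rightarrow> real"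
    unfolding continuous_on_eq_continuous_within
  proof
    fix t assume t: "t \<in> {0..<T}"
    define T' where "T' = (t + T) / 2"
    have T': "0 \<le> T'" "T' < T" "t < T'" using t by (auto simp: T'_def)
    have "continuous (at t within {0..T'}) x"
      using c[OF T'(1,2)] t T' unfolding continuous_on_eq_continuous_within by auto
    moreover have "at t within {0..T'} = at t within {0..<T}"
      by (rule at_within_nhd[of t "{..<T'}"]) (use T' in auto)
    ultimately show "continuous (at t within {0..<T}) x" by simp
  qed
  have y_eq: "?y = (\<lambda>t. (1 - \<sigma> * z t) *\<^sub>R axis 1 1 + v t *\<^sub>R axis 2 1)"
    by (rule ext) (simp add: vec_eq_iff forall_2 axis_def)
  have cy: "continuous_on {0..<T} ?y"
    unfolding y_eq by (intro continuous_intros c2 cz)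
  have "\<forall>t\<in>{0..<T}. ?y t \<notin> Q \<and> set_integrable lebesgue {0..t} (\<lambda>s. f B s (?y s) (u s)) \<and>
      ?y t = y0 + (LINT s:{0..t}|lebesgue. f B s (?y s) (u s))"
  proof
    fix t assume "t \<in> {0..<T}"
    then have t: "0 \<le> t" "t < T" by auto
    note sD = solvesD[OF s t]
    have bz: "((\<lambda>s. - v s / z s + k1 u s) has_integral (z t - z 0)) {0..t}"
      by (rule bounded_primitive_has_integral[OF sD(2) order_refl t(1) order_refl])
    have bv: "((\<lambda>s. 1 - \<sigma> * z s + v s + k2 u s) has_integral (v t - v 0)) {0..t}"
      by (rule bounded_primitive_has_integral[OF sD(3) order_refl t(1) order_refl])
    have f1: "f B s (?y s) (u s) $ 1 = - \<sigma> * (- v s / z s + k1 u s)" for s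
      by (cases "y0 $ 1 < 1") (simp_all add: f_nth k1_def \<sigma>_def)
    have f2: "f B s (?y s) (u s) $ 2 = 1 - \<sigma> * z s + v s + k2 u s" for s
      by (simp add: f_nth k2_def)
    have h1: "((\<lambda>s. f B s (?y s) (u s) $ 1) has_integral (?y t - y0) $ 1) {0..t}"
    proof -
      have "- \<sigma> * (z t - z 0) = (?y t - y0) $ 1"
        using \<sigma>_sq by (simp add: init z0_def algebra_simps flip: mult.assoc)
      then show ?thesis unfolding f1 using has_integral_mult_right[OF bz, of "- \<sigma>"] by simp
    qed
    have h2: "((\<lambda>s. f B s (?y s) (u s) $ 2) has_integral (?y t - y0) $ 2) {0..t}"
      unfolding f2 using bv by (simp add: init)
    have h: "((\<lambda>s. f B s (?y s) (u s)) has_integral (?y t - y0)) {0..t}" by (rule has_integral_vec2[OF h1 h2])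
    obtain M1 where M1: "\<And>s. 0 \<le> s \<Longrightarrow> s \<le> t \<Longrightarrow> \<bar>- v s / z s + k1 u s\<bar> \<le> M1" using bounded_primitive_bound[OF sD(2)] by blast
    obtain M2 where M2: "\<And>s. 0 \<le> s \<Longrightarrow> s \<le> t \<Longrightarrow> \<bar>1 - \<sigma> * z s + v s + k2 u s\<bar> \<le> M2" using bounded_primitive_bound[OF sD(3)] by blast
    have ai: "(\<lambda>s. f B s (?y s) (u s)) absolutely_integrable_on {0..t}"
    proof (rule absolutely_integrable_integrable_bound[where g="\<lambda>_. M1 + M2"])
      fix s assume s: "s \<in> {0..t}"
      have "norm (f B s (?y s) (u s)) \<le> \<bar>f B s (?y s) (u s) $ 1\<bar> + \<bar>f B s (?y s) (u s) $ 2\<bar>"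
        using norm_le_l1_cart[of "f B s (?y s) (u s)"] by (simp add: sum_2)
      also have "\<bar>f B s (?y s) (u s) $ 1\<bar> \<le> M1" unfolding f1 using M1[of s] s \<sigma>_abs by (simp add: abs_mult)
      also have "\<bar>f B s (?y s) (u s) $ 2\<bar> \<le> M2" unfolding f2 using M2[of s] s by simp
      finally show "norm (f B s (?y s) (u s)) \<le> M1 + M2" by simp
    qed (use h in auto)
    have LI: "(LINT s:{0..t}|lebesgue. f B s (?y s) (u s)) = ?y t - y0"
      by (rule trans[OF set_lebesgue_integral_eq_integral(2)[OF ai] integral_unique[OF h]])
    have "?y t \<notin> Q" using sD(1)[OF t(1) order_refl] \<sigma>_abs by (auto simp: Q_def)
    moreover have "?y t = y0 + (LINT s:{0..t}|lebesgue. f B s (?y s) (u s))" unfolding LI by simp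
    ultimately show "?y t \<notin> Q \<and> set_integrable lebesgue {0..t} (\<lambda>s. f B s (?y s) (u s)) \<and>
      ?y t = y0 + (LINT s:{0..t}|lebesgue. f B s (?y s) (u s))" using ai by (intro conjI)
  qed
  then have "0 < T \<and> continuous_on {0..<T} ?y \<and> u \<in> controls \<rho> \<and>
    (\<forall>t\<in>{0..<T}. ?y t \<notin> Q \<and> set_integrable lebesgue {0..t} (\<lambda>s. f B s (?y s) (u s)) \<and>
      ?y t = y0 + (LINT s:{0..t}|lebesgue. f B s (?y s) (u s)))"
    using T u cy by (intro conjI)
  then show ?thesis unfolding triples_def mem_Collect_eq prod.case .
qed

text \<open>
  For \<open>w = B\<^sup>T \<psi>\<close> this control maximises \<open>w \<bullet> u\<close>; where \<open>w = 0\<close>, the division by zero makes it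
  the zero vector.
\<close>
lemma maximising_control:
  assumes w: "w \<in> borel_measurable (lebesgue_on {0..T})"
  defines "u \<equiv> \<lambda>t. let x = (if t \<in> {0..T} then w t else 0) in (\<rho> / norm x) *\<^sub>R x"
  shows "u \<in> controls \<rho>"
proof -
  have "(\<lambda>t. if t \<in> {0..T} then w t else 0) \<in> borel_measurable lebesgue"
    by (rule borel_measurable_if_I[OF w]) simp
  then have "u \<in> borel_measurable lebesgue" unfolding u_def Let_def
    by (intro borel_measurable_scaleR borel_measurable_divide borel_measurable_norm borel_measurable_const
        measurable_compose[OF _ borel_measurable_norm] measurable_ident)
  then have "u \<in> borel_measurable (lebesgue_on {0..})" by (rule measurable_restrict_space1)
  moreover have "norm (u t) \<le> \<rho>" for t using \<rho> by (simp add: u_def Let_def)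
  ultimately show ?thesis by (simp add: controls_def U_def)
qed

text \<open>
  The adjoint solution \<open>\<psi> = (-\<sigma> p, q)\<close> satisfies \<open>\<integral> (\<psi> \<bullet> B u - \<psi> \<bullet> B ub) \<le> 0\<close> on \<open>[0, T]\<close> for every
  control \<open>u\<close>. For the pointwise maximiser \<open>u\<close> the integrand is not negative, hence it vanishes almost
  everywhere.
\<close>
theorem maximum_principle:
  assumes opt: "optimal_classical_triple \<rho> B y0 (tb, yb, ub)"
  shows "\<exists>y2_end. ((\<lambda>t. yb t $ 2) \<longlongrightarrow> y2_end) (at_left tb) \<and> y2_end \<ge> 0 \<and>
    (\<exists>\<psi> :: real \<Rightarrow> real^2.
       continuous_on {0..<tb} \<psi> \<and>
       (\<exists>t\<in>{0..<tb}. \<psi> t \<noteq> 0) \<and>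
       (\<forall>t\<in>{0..<tb}. (\<psi> has_vector_derivative - (adjoint_matrix (yb t) *v \<psi> t))
          (at t within {0..<tb})) \<and>
       (AE t in lebesgue_on {0..<tb}.
          is_maximum ((\<lambda>u. \<psi> t \<bullet> (B t *v u)) ` U \<rho>) (\<psi> t \<bullet> (B t *v ub t))) \<and>
       (y2_end > 0 \<longrightarrow> (\<psi> \<longlongrightarrow> 0) (at_left tb)))"
proof -
  have adm: "(tb, yb, ub) \<in> admissible_triples \<rho> B y0"
    and inf: "tb = Inf {T. \<exists>y u. (T, y, u) \<in> admissible_triples \<rho> B y0}"
    using opt by (auto simp: optimal_classical_triple_def)
  then have tri: "(tb, yb, ub) \<in> triples \<rho> B y0" and Lim: "Liminf (at_left tb) (\<lambda>s. ereal (infdist (yb s) Q)) = 0"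
    by (auto simp: admissible_triples_def)
  have tb: "0 < tb" and ub: "ub \<in> controls \<rho>" using tri by (auto simp: triples_def)
  have least: "tb \<le> T" if "(T, y, u) \<in> admissible_triples \<rho> B y0" for T y u
    unfolding inf
  proof (rule cInf_lower)
    show "T \<in> {T. \<exists>y u. (T, y, u) \<in> admissible_triples \<rho> B y0}" using that by blast
    show "bdd_below {T. \<exists>y u. (T, y, u) \<in> admissible_triples \<rho> B y0}"
      by (rule bdd_belowI[of _ 0]) (auto simp: admissible_triples_def triples_def)
  qed
  obtain z v where zv: "solves_closed \<sigma> (k1 ub) (k2 ub) tb z v"
    "\<And>t. 0 \<le> t \<Longrightarrow> t < tb \<Longrightarrow> z t = \<sigma> * (1 - yb t $ 1)" "\<And>t. 0 \<le> t \<Longrightarrow> t < tb \<Longrightarrow> v t = yb t $ 2"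
    using solves_closed_extension[OF forcing_k[OF ub] \<sigma>_abs tb triple_imp_solves(1)[OF tri]] by blast
  have zpos: "0 < z t" if "0 \<le> t" "t < tb" for t
    using zv(1) solvesD(1)[of \<sigma> "k1 ub" "k2 ub" tb z v t t] that unfolding solves_closed_def by blast
  have cz: "continuous_on {0..tb} z" "continuous_on {0..tb} v"
    using zv(1) bounded_primitive_continuous unfolding solves_closed_def by blast+
  have init: "z 0 = z0" "v 0 = y0 $ 2" using zv(2,3)[of 0] tb triple_imp_solves(2,3)[OF tri] by auto
  have zlim: "(z \<longlongrightarrow> z tb) (at_left tb)" "(v \<longlongrightarrow> v tb) (at_left tb)"
    using cz by (auto intro: continuous_on_Icc_at_leftD[OF _ tb])
  have z_end: "z tb = 0"
  proof (rule ccontr)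
    assume "z tb \<noteq> 0"
    then have "0 < z tb" using zv(1) by (simp add: solves_closed_def)
    then have "\<forall>\<^sub>F t in at_left tb. z tb / 2 < z t" using order_tendstoD(1)[OF zlim(1), of "z tb / 2"] by simp
    then obtain t0 where t0: "t0 < tb" "\<And>t. t0 < t \<Longrightarrow> t < tb \<Longrightarrow> z tb / 2 < z t"
      unfolding eventually_at_left_field by auto
    have "\<forall>c t0. 0 < c \<longrightarrow> t0 < tb \<longrightarrow> (\<exists>t. t0 < t \<and> 0 \<le> t \<and> t < tb \<and> infdist (yb t) Q < c)"
      using Lim Liminf_zero_iff[of "\<lambda>t. infdist (yb t) Q" tb, OF infdist_nonneg tb] by simp
    then obtain t where t: "t0 < t" "0 \<le> t" "t < tb" "infdist (yb t) Q < z tb / 2"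
      using t0(1) \<open>0 < z tb\<close> half_gt_zero by blast
    have "\<bar>z t\<bar> = \<bar>yb t $ 1 - 1\<bar>" using zv(2)[OF t(2,3)] \<sigma>_abs by (simp add: abs_mult abs_minus_commute)
    then show False using t t0(2)[of t] zpos[of t] by (simp add: infdist_Q)
  qed
  define K where "K a b \<longleftrightarrow> (\<exists>u\<in>controls \<rho>. a = k1 u \<and> b = k2 u)" for a b
  interpret oq: optimal_quenching \<sigma> "C * \<rho>" tb K "k1 ub" "k2 ub" z v
  proof
    show "\<bar>\<sigma>\<bar> = 1" "0 < tb" "solves_closed \<sigma> (k1 ub) (k2 ub) tb z v" "z tb = 0" by (fact \<sigma>_abs tb zv(1) z_end)+
    show "K (k1 ub) (k2 ub)" using ub by (auto simp: K_def)
    show "forcing (C * \<rho>) a" "forcing (C * \<rho>) b" if "K a b" for a b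
      using that forcing_k by (auto simp: K_def)
    show "K (\<lambda>_. 0) (\<lambda>_. 0)"
      unfolding K_def using \<rho> by (intro bexI[of _ "\<lambda>_. 0"]) (auto simp: k1_def k2_def controls_def U_def)
    show "K (\<lambda>t. a t + r * (a' t - a t)) (\<lambda>t. b t + r * (b' t - b t))"
      if K: "K a b" "K a' b'" and r: "0 \<le> r" "r \<le> 1" for a b a' b' r
    proof -
      obtain u u' where u: "u \<in> controls \<rho>" "a = k1 u" "b = k2 u" and u': "u' \<in> controls \<rho>" "a' = k1 u'" "b' = k2 u'"
        using K by (auto simp: K_def)
      let ?u = "\<lambda>t. (1 - r) *\<^sub>R u t + r *\<^sub>R u' t"
      have "norm (?u t) \<le> \<rho>" if "0 \<le> t" for t
      proof -
        have "norm (?u t) \<le> (1 - r) * norm (u t) + r * norm (u' t)" using norm_triangle_ineq[of "(1 - r) *\<^sub>R u t" "r *\<^sub>R u' t"] r by simp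
        also have "\<dots> \<le> (1 - r) * \<rho> + r * \<rho>"
          using controlsD(2)[OF u(1) that] controlsD(2)[OF u'(1) that] r by (intro add_mono mult_left_mono) auto
        finally show ?thesis by (simp add: algebra_simps)
      qed
      moreover have "?u \<in> borel_measurable (lebesgue_on {0..})"
        by (intro borel_measurable_add borel_measurable_scaleR borel_measurable_const controlsD(1) u(1) u'(1))
      ultimately have "?u \<in> controls \<rho>" by (simp add: controls_def U_def)
      moreover have lin: "B t *v ?u t = (1 - r) *\<^sub>R (B t *v u t) + r *\<^sub>R (B t *v u' t)" for t
        by (simp add: vec_eq_iff matrix_vector_mult_def sum_2 algebra_simps)
      have "k1 ?u = (\<lambda>t. a t + r * (a' t - a t))" "k2 ?u = (\<lambda>t. b t + r * (b' t - b t))"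
        unfolding u u' k1_def[abs_def] k2_def[abs_def] lin by (auto simp: fun_eq_iff algebra_simps)
      ultimately show ?thesis unfolding K_def by metis
    qed
    show "K (\<lambda>t. if t < T then a t else a' t) (\<lambda>t. if t < T then b t else b' t)"
      if K: "K a b" "K a' b'" for a b a' b' T
    proof -
      obtain u u' where u: "u \<in> controls \<rho>" "a = k1 u" "b = k2 u" and u': "u' \<in> controls \<rho>" "a' = k1 u'" "b' = k2 u'"
        using K by (auto simp: K_def)
      let ?u = "\<lambda>t. if t < T then u t else u' t"
      have "{..<T} \<in> sets lebesgue" by simp
      then have "{t \<in> space lebesgue. t < T} \<in> sets lebesgue" by (simp add: lessThan_def)
      then have "Measurable.pred lebesgue (\<lambda>t. t < T)" unfolding pred_def .
      then have "Measurable.pred (lebesgue_on {0..}) (\<lambda>t. t < T)" by (rule measurable_restrict_space1)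
      then have "?u \<in> borel_measurable (lebesgue_on {0..})"
        unfolding pred_def by (intro measurable_If controlsD(1) u(1) u'(1))
      moreover have "norm (?u t) \<le> \<rho>" if "0 \<le> t" for t
        using controlsD(2)[OF u(1) that] controlsD(2)[OF u'(1) that] by simp
      ultimately have "?u \<in> controls \<rho>" unfolding controls_def U_def by simp
      moreover have "k1 ?u = (\<lambda>t. if t < T then a t else a' t)" "k2 ?u = (\<lambda>t. if t < T then b t else b' t)"
        by (auto simp: u u' k1_def k2_def fun_eq_iff)
      ultimately show ?thesis unfolding K_def by metis
    qed
    show "\<exists>z' v'. solves \<sigma> a b tb z' v' \<and> z' 0 = z 0 \<and> v' 0 = v 0" if Kab: "K a b" for a b
    proof -
      obtain u where u: "u \<in> controls \<rho>" "a = k1 u" "b = k2 u" using Kab by (auto simp: K_def)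
      show ?thesis
      proof (rule solves_or_quenches[OF forcing_k[OF u(1)] z0_pos tb, of \<sigma> "y0 $ 2"])
        fix z' v' assume "solves \<sigma> (k1 u) (k2 u) tb z' v'" "z' 0 = z0" "v' 0 = y0 $ 2"
        then show ?thesis unfolding u init by blast
      next
        fix \<tau> z' v' assume \<tau>: "0 < \<tau>" "\<tau> < tb" and s: "solves \<sigma> (k1 u) (k2 u) \<tau> z' v'" "z' 0 = z0" "v' 0 = y0 $ 2"
          and q: "\<And>c t0. 0 < c \<Longrightarrow> t0 < \<tau> \<Longrightarrow> \<exists>t. t0 < t \<and> 0 \<le> t \<and> t < \<tau> \<and> z' t < c"
        let ?y = "\<lambda>t. vector [1 - \<sigma> * z' t, v' t] :: real^2"
        have "\<exists>t. t0 < t \<and> 0 \<le> t \<and> t < \<tau> \<and> infdist (?y t) Q < c" if ct: "0 < c" "t0 < \<tau>" for c t0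
        proof -
          obtain t where t: "t0 < t" "0 \<le> t" "t < \<tau>" "z' t < c" using q[OF ct] by blast
          have "0 < z' t" by (rule solvesD(1)[OF s(1) t(2,3) t(2) order_refl])
          then have "infdist (?y t) Q < c" using t(4) \<sigma>_abs by (simp add: infdist_Q abs_mult)
          then show ?thesis using t by blast
        qed
        then have "Liminf (at_left \<tau>) (\<lambda>t. ereal (infdist (?y t) Q)) = 0"
          using Liminf_zero_iff[of "\<lambda>t. infdist (?y t) Q" \<tau>, OF infdist_nonneg \<tau>(1)] by blast
        then have "(\<tau>, ?y, u) \<in> admissible_triples \<rho> B y0"
          using solves_imp_triple[OF u(1) \<tau>(1) s] by (simp add: admissible_triples_def)
        then show ?thesis using least \<tau>(2) by fastforce
      qed
    qed
  qed
  obtain p q where adj: "oq.adjoint p q" and nz: "(p 0)\<^sup>2 + (q 0)\<^sup>2 = 1"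
    and var: "\<And>T a b. 0 \<le> T \<Longrightarrow> T < tb \<Longrightarrow> K a b \<Longrightarrow> oq.variation p q a b T \<le> 0"
    and fin: "0 < v tb \<Longrightarrow> (p \<longlongrightarrow> 0) (at_left tb) \<and> (q \<longlongrightarrow> 0) (at_left tb)"
    by (rule oq.extremal_adjoint) (rule that)
  define \<psi> where "\<psi> t = (- \<sigma> * p t) *\<^sub>R axis 1 1 + q t *\<^sub>R (axis 2 1 :: real^2)" for t
  have \<psi>_nth: "\<psi> t $ 1 = - \<sigma> * p t" "\<psi> t $ 2 = q t" for t by (simp_all add: \<psi>_def axis_def)
  have cpq: "continuous_on {0..<tb} p" "continuous_on {0..<tb} q" by (fact oq.adjoint_continuous[OF adj])+
  have c\<psi>: "continuous_on {0..<tb} \<psi>" unfolding \<psi>_def[abs_def] by (intro continuous_intros cpq)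
  have ne: "\<psi> 0 \<noteq> 0"
  proof
    assume "\<psi> 0 = 0"
    then have "- \<sigma> * p 0 = 0" "q 0 = 0" using \<psi>_nth[of 0] by simp_all
    then show False using nz \<sigma>_abs by auto
  qed
  have der: "(\<psi> has_vector_derivative - (adjoint_matrix (yb t) *v \<psi> t)) (at t within {0..<tb})" if t: "t \<in> {0..<tb}" for t
  proof -
    note A = adj[unfolded oq.adjoint_def, rule_format, OF t]
    let ?p' = "- (v t / (z t)\<^sup>2) * p t + \<sigma> * q t" and ?q' = "p t / z t - q t"
    have p': "((\<lambda>t. - \<sigma> * p t) has_real_derivative - \<sigma> * ?p') (at t within {0..<tb})"
      by (intro DERIV_cmult conjunct1[OF A])
    have "((\<lambda>t. (- \<sigma> * p t) *\<^sub>R (axis 1 1 :: real^2)) has_vector_derivative (- \<sigma> * ?p') *\<^sub>R axis 1 1) (at t within {0..<tb})"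
      using has_vector_derivative_scaleR[OF p' has_vector_derivative_const[of "axis 1 1 :: real^2"]] by simp
    moreover have "((\<lambda>t. q t *\<^sub>R (axis 2 1 :: real^2)) has_vector_derivative ?q' *\<^sub>R axis 2 1) (at t within {0..<tb})"
      using has_vector_derivative_scaleR[OF conjunct2[OF A] has_vector_derivative_const[of "axis 2 1 :: real^2"]] by simp
    ultimately have "(\<psi> has_vector_derivative ((- \<sigma> * ?p') *\<^sub>R axis 1 1 + ?q' *\<^sub>R axis 2 1)) (at t within {0..<tb})"
      unfolding \<psi>_def[abs_def] by (rule has_vector_derivative_add)
    moreover have "(- \<sigma> * ?p') *\<^sub>R axis 1 1 + ?q' *\<^sub>R axis 2 1 = - (adjoint_matrix (yb t) *v \<psi> t)"
    proof -
      have y: "1 - yb t $ 1 = \<sigma> * z t" "yb t $ 2 = v t" using zv(2,3)[of t] t \<sigma>_sq by (simp_all flip: mult.assoc)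
      have sq: "(\<sigma> * z t)\<^sup>2 = (z t)\<^sup>2" using \<sigma>_sq by (simp add: power_mult_distrib power2_eq_square)
      have sz: "1 / (\<sigma> * z t) = \<sigma> / z t" by (cases "y0 $ 1 < 1") (simp_all add: \<sigma>_def)
      have am: "adjoint_matrix (yb t) = vector [vector [v t / (z t)\<^sup>2, 1], vector [\<sigma> / z t, 1]]"
        unfolding adjoint_matrix_def y sz sq ..
      show ?thesis
        unfolding vec_eq_iff forall_2 am
        by (cases "y0 $ 1 < 1") (simp_all add: \<sigma>_def matrix_vector_mult_def sum_2 \<psi>_nth axis_def)
    qed
    ultimately show ?thesis by simp
  qed
  define w where "w t = \<psi> t v* B t" for t
  have w: "\<psi> t \<bullet> (B t *v x) = w t \<bullet> x" for t x by (simp add: w_def dot_lmul_matrix)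
  have wu: "w t \<bullet> x \<le> \<rho> * norm (w t)" if "norm x \<le> \<rho>" for t x
  proof -
    have "w t \<bullet> x \<le> norm (w t) * norm x" by (rule norm_cauchy_schwarz)
    also have "\<dots> \<le> norm (w t) * \<rho>" using that by (intro mult_left_mono) auto
    finally show ?thesis by (simp add: mult.commute)
  qed
  have AE_T: "AE t in lebesgue. t \<in> {0..T} \<longrightarrow> \<rho> * norm (w t) = w t \<bullet> ub t" if T: "0 \<le> T" "T < tb" for T
  proof -
    have sub: "{0..T} \<subseteq> {0..<tb}" using T by auto
    have m\<psi>: "\<psi> \<in> borel_measurable (lebesgue_on {0..T})"
      by (rule continuous_imp_measurable_on_sets_lebesgue[OF continuous_on_subset[OF c\<psi> sub]]) simp
    have mB: "B \<in> borel_measurable (lebesgue_on {0..T})"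
      by (rule borel_measurable_lebesgue_on_subset[OF B_meas]) auto
    have wi: "(\<lambda>t. w t $ i) \<in> borel_measurable (lebesgue_on {0..T})" for i
    proof -
      have "(\<lambda>t. \<psi> t $ 1 * B t $ 1 $ i + \<psi> t $ 2 * B t $ 2 $ i) \<in> borel_measurable (lebesgue_on {0..T})"
        by (intro borel_measurable_add borel_measurable_times borel_measurable_vec_nth m\<psi> mB)
      then show ?thesis by (simp add: w_def vector_matrix_mult_def sum_2)
    qed
    have mw: "w \<in> borel_measurable (lebesgue_on {0..T})" by (rule borel_measurable_vec2[OF wi wi])
    define us where "us = (\<lambda>t. let x = (if t \<in> {0..T} then w t else 0) in (\<rho> / norm x) *\<^sub>R x)"
    have us: "us \<in> controls \<rho>" unfolding us_def by (rule maximising_control[OF mw])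
    let ?g = "\<lambda>t. \<rho> * norm (w t) - w t \<bullet> ub t"
    have Kus: "K (k1 us) (k2 us)" using us by (auto simp: K_def)
    have "((\<lambda>t. p t * (k1 us t - k1 ub t) + q t * (k2 us t - k2 ub t)) has_integral oq.variation p q (k1 us) (k2 us) T) {0..T}"
      by (rule oq.variation_has_integral[OF Kus adj T(2)])
    then have hg: "(?g has_integral oq.variation p q (k1 us) (k2 us) T) {0..T}"
    proof (rule has_integral_eq[rotated])
      fix t assume t: "t \<in> {0..T}"
      have e: "p t * k1 u t + q t * k2 u t = w t \<bullet> u t" for u
        unfolding w[symmetric] by (simp add: k1_def k2_def inner_vec_def sum_2 \<psi>_nth)
      have "w t \<bullet> us t = \<rho> * norm (w t)"
        using t by (cases "w t = 0") (simp_all add: us_def Let_def dot_square_norm power2_eq_square)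
      then show "p t * (k1 us t - k1 ub t) + q t * (k2 us t - k2 ub t) = ?g t"
        using e[of us] e[of ub] by (simp add: algebra_simps)
    qed
    have g0: "0 \<le> ?g t" if "t \<in> {0..T}" for t using wu[OF controlsD(2)[OF ub, of t]] that by simp
    have "oq.variation p q (k1 us) (k2 us) T = 0"
      using var[OF T Kus] has_integral_nonneg[OF hg g0] by simp
    with hg have hg0: "(?g has_integral 0) {0..T}" by simp
    have ai: "set_integrable lebesgue {0..T} ?g"
      by (rule nonnegative_absolutely_integrable_1[OF has_integral_integrable[OF hg0] g0])
    have "(LINT t:{0..T}|lebesgue. ?g t) = 0"
      using set_lebesgue_integral_eq_integral(2)[OF ai] integral_unique[OF hg0] by simp
    then have "AE t in lebesgue. indicat_real {0..T} t *\<^sub>R ?g t = 0"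
      using integral_nonneg_eq_0_iff_AE[of lebesgue "\<lambda>t. indicat_real {0..T} t *\<^sub>R ?g t"] ai g0
      by (simp add: set_integrable_def set_lebesgue_integral_def indicator_def)
    then show ?thesis by (rule AE_mp) (rule AE_I2, auto simp: indicator_def)
  qed
  define Tn where "Tn n = tb - tb / real (Suc n)" for n
  have Tn: "0 \<le> Tn n" "Tn n < tb" for n
  proof -
    have "tb / real (Suc n) \<le> tb / 1" using tb by (intro divide_left_mono) auto
    then show "0 \<le> Tn n" by (simp add: Tn_def)
    show "Tn n < tb" using tb by (simp add: Tn_def)
  qed
  have "AE t in lebesgue. \<forall>n. t \<in> {0..Tn n} \<longrightarrow> \<rho> * norm (w t) = w t \<bullet> ub t"
    unfolding AE_all_countable using AE_T[OF Tn] by blast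
  then have "AE t in lebesgue. t \<in> {0..<tb} \<longrightarrow> is_maximum ((\<lambda>u. \<psi> t \<bullet> (B t *v u)) ` U \<rho>) (\<psi> t \<bullet> (B t *v ub t))"
  proof (rule AE_mp, intro AE_I2 impI)
    fix t assume all: "\<forall>n. t \<in> {0..Tn n} \<longrightarrow> \<rho> * norm (w t) = w t \<bullet> ub t" and t: "t \<in> {0..<tb}"
    have "0 < (tb - t) / tb" using t tb by simp
    then obtain n where "inverse (real (Suc n)) < (tb - t) / tb" using reals_Archimedean by blast
    then have "tb * inverse (real (Suc n)) < tb - t" using tb by (simp add: pos_less_divide_eq mult.commute)
    then have "t \<in> {0..Tn n}" using t by (simp add: Tn_def divide_inverse)
    then have e: "\<rho> * norm (w t) = w t \<bullet> ub t" using all by blast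
    have "ub t \<in> U \<rho>" using controlsD(2)[OF ub, of t] t by (simp add: U_def)
    then show "is_maximum ((\<lambda>u. \<psi> t \<bullet> (B t *v u)) ` U \<rho>) (\<psi> t \<bullet> (B t *v ub t))"
      unfolding is_maximum_def w
    proof (intro conjI ballI)
      show "w t \<bullet> ub t \<in> (\<lambda>u. w t \<bullet> u) ` U \<rho>" using \<open>ub t \<in> U \<rho>\<close> by (rule imageI)
      fix x assume "x \<in> (\<lambda>u. w t \<bullet> u) ` U \<rho>"
      then obtain u where "norm u \<le> \<rho>" "x = w t \<bullet> u" by (auto simp: U_def)
      then show "x \<le> w t \<bullet> ub t" using wu[of u t] e by simp
    qed
  qed
  then have max: "AE t in lebesgue_on {0..<tb}. is_maximum ((\<lambda>u. \<psi> t \<bullet> (B t *v u)) ` U \<rho>) (\<psi> t \<bullet> (B t *v ub t))"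
    by (subst AE_restrict_space_iff) simp_all
  have "((\<lambda>t. yb t $ 2) \<longlongrightarrow> v tb) (at_left tb)"
  proof (rule Lim_transform_eventually[OF zlim(2)])
    show "\<forall>\<^sub>F t in at_left tb. v t = yb t $ 2" by (rule eventually_at_leftI[of 0]) (use zv(3) tb in auto)
  qed
  moreover have "(\<psi> \<longlongrightarrow> 0) (at_left tb)" if "0 < v tb"
  proof -
    have "((\<lambda>t. (- \<sigma> * p t) *\<^sub>R axis 1 1 + q t *\<^sub>R (axis 2 1 :: real^2)) \<longlongrightarrow> (- \<sigma> * 0) *\<^sub>R axis 1 1 + 0 *\<^sub>R axis 2 1) (at_left tb)"
      using fin[OF that] by (intro tendsto_intros) auto
    then show ?thesis by (simp add: \<psi>_def[abs_def])
  qed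
  ultimately show ?thesis
    using oq.v_end_nonneg c\<psi> ne der max tb by (intro exI[of _ "v tb"] conjI exI[of _ \<psi>]) auto
qed

end

text \<open>
  Trajectories do not see a change of \<open>B\<close> on a null set, so an essentially bounded \<open>B\<close> may be
  replaced by a bounded one.
\<close>
lemma triples_negligible_change:
  assumes N: "negligible N" and eq: "\<And>t. t \<notin> N \<Longrightarrow> 0 \<le> t \<Longrightarrow> B' t = B t"
  shows "triples \<rho> B y0 \<subseteq> triples \<rho> B' y0"
proof
  fix p assume p: "p \<in> triples \<rho> B y0"
  obtain T y u where p_eq: "p = (T, y, u)" by (cases p)
  have tri: "0 < T" "continuous_on {0..<T} y" "u \<in> controls \<rho>"
    and all: "\<forall>t\<in>{0..<T}. y t \<notin> Q \<and> set_integrable lebesgue {0..t} (\<lambda>s. f B s (y s) (u s)) \<and>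
        y t = y0 + (LINT s:{0..t}|lebesgue. f B s (y s) (u s))"
    using p unfolding p_eq triples_def by blast+
  have "\<forall>t\<in>{0..<T}. y t \<notin> Q \<and> set_integrable lebesgue {0..t} (\<lambda>s. f B' s (y s) (u s)) \<and>
        y t = y0 + (LINT s:{0..t}|lebesgue. f B' s (y s) (u s))"
  proof
    fix t assume "t \<in> {0..<T}"
    from bspec[OF all this] have nQ: "y t \<notin> Q" and si: "(\<lambda>s. f B s (y s) (u s)) absolutely_integrable_on {0..t}"
      and ye: "y t = y0 + (LINT s:{0..t}|lebesgue. f B s (y s) (u s))" by auto
    have same: "f B' s (y s) (u s) = f B s (y s) (u s)" if "s \<in> {0..t} - N" for s
      using eq[of s] that by (simp add: f_def)
    have si': "(\<lambda>s. f B' s (y s) (u s)) absolutely_integrable_on {0..t}"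
      by (rule absolutely_integrable_spike[OF si N same])
    have "integral {0..t} (\<lambda>s. f B s (y s) (u s)) = integral {0..t} (\<lambda>s. f B' s (y s) (u s))"
      by (rule integral_spike[OF N same])
    then have "y t = y0 + (LINT s:{0..t}|lebesgue. f B' s (y s) (u s))"
      using ye set_lebesgue_integral_eq_integral(2)[OF si] set_lebesgue_integral_eq_integral(2)[OF si'] by simp
    with nQ si' show "y t \<notin> Q \<and> set_integrable lebesgue {0..t} (\<lambda>s. f B' s (y s) (u s)) \<and>
        y t = y0 + (LINT s:{0..t}|lebesgue. f B' s (y s) (u s))" by (intro conjI)
  qed
  with tri show "p \<in> triples \<rho> B' y0" unfolding p_eq triples_def mem_Collect_eq prod.case by (intro conjI)
qed

theorem theorem5p2:
  fixes \<rho>\<^sub>0 :: real and B :: "real \<Rightarrow> real^2^2" and y\<^sub>0 :: "real^2"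
    and tb :: real and yb ub :: "real \<Rightarrow> real^2"
  assumes "\<rho>\<^sub>0 > 0"
    and "Linfty B"
    and "y\<^sub>0 $ 1 \<noteq> 1"
    and "optimal_classical_triple \<rho>\<^sub>0 B y\<^sub>0 (tb, yb, ub)"
  shows "\<exists>y2_end. ((\<lambda>t. yb t $ 2) \<longlongrightarrow> y2_end) (at_left tb) \<and> y2_end \<ge> 0 \<and>
    (\<exists>\<psi> :: real \<Rightarrow> real^2.
       continuous_on {0..<tb} \<psi> \<and>
       (\<exists>t\<in>{0..<tb}. \<psi> t \<noteq> 0) \<and>
       (\<forall>t\<in>{0..<tb}. (\<psi> has_vector_derivative - (adjoint_matrix (yb t) *v \<psi> t))
          (at t within {0..<tb})) \<and>
       (AE t in lebesgue_on {0..<tb}.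
          is_maximum ((\<lambda>u. \<psi> t \<bullet> (B t *v u)) ` U \<rho>\<^sub>0) (\<psi> t \<bullet> (B t *v ub t))) \<and>
       (y2_end > 0 \<longrightarrow> (\<psi> \<longlongrightarrow> 0) (at_left tb)))"
proof -
  obtain C where C: "AE t in lebesgue_on {0..}. norm (B t) \<le> C"
    and Bm: "B \<in> borel_measurable (lebesgue_on {0..})" using assms(2) by (auto simp: Linfty_def)
  define B' where "B' t = (if norm (B t) \<le> C then B t else 0)" for t
  define N where "N = {t. 0 \<le> t \<and> B' t \<noteq> B t}"
  have "AE t in lebesgue. t \<in> {0..} \<longrightarrow> norm (B t) \<le> C"
    using C by (subst (asm) AE_restrict_space_iff) simp_all
  then have AE_N: "AE t in lebesgue. t \<notin> N" by (rule AE_mp) (rule AE_I2, auto simp: N_def B'_def)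
  then have N: "negligible N" by (simp add: negligible_iff_null_sets completion.null_sets_iff_AE)
  have Bm': "B' \<in> borel_measurable (lebesgue_on {0..})"
    unfolding B'_def[abs_def] using Bm by measurable
  interpret bounded_plant \<rho>\<^sub>0 "\<bar>C\<bar>" B' y\<^sub>0
    by unfold_locales (use assms(1,3) Bm' in \<open>auto simp: B'_def\<close>)
  have "triples \<rho>\<^sub>0 B y\<^sub>0 = triples \<rho>\<^sub>0 B' y\<^sub>0"
    by (intro equalityI triples_negligible_change[OF N]) (auto simp: N_def)
  then have adm: "admissible_triples \<rho>\<^sub>0 B y\<^sub>0 = admissible_triples \<rho>\<^sub>0 B' y\<^sub>0"
    by (simp add: admissible_triples_def)
  have "optimal_classical_triple \<rho>\<^sub>0 B' y\<^sub>0 (tb, yb, ub)"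
    using assms(4) unfolding optimal_classical_triple_def adm .
  from maximum_principle[OF this] obtain y2_end \<psi> where
    lim: "((\<lambda>t. yb t $ 2) \<longlongrightarrow> y2_end) (at_left tb)" "y2_end \<ge> 0"
    and \<psi>: "continuous_on {0..<tb} \<psi>" "\<exists>t\<in>{0..<tb}. \<psi> t \<noteq> 0"
      "\<forall>t\<in>{0..<tb}. (\<psi> has_vector_derivative - (adjoint_matrix (yb t) *v \<psi> t)) (at t within {0..<tb})"
      "y2_end > 0 \<longrightarrow> (\<psi> \<longlongrightarrow> 0) (at_left tb)"
    and max: "AE t in lebesgue_on {0..<tb}. is_maximum ((\<lambda>u. \<psi> t \<bullet> (B' t *v u)) ` U \<rho>\<^sub>0) (\<psi> t \<bullet> (B' t *v ub t))"
    by blast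
  have "AE t in lebesgue. t \<in> {0..<tb} \<longrightarrow> is_maximum ((\<lambda>u. \<psi> t \<bullet> (B' t *v u)) ` U \<rho>\<^sub>0) (\<psi> t \<bullet> (B' t *v ub t))"
    using max by (subst (asm) AE_restrict_space_iff) simp_all
  with AE_N have "AE t in lebesgue. t \<in> {0..<tb} \<longrightarrow> is_maximum ((\<lambda>u. \<psi> t \<bullet> (B t *v u)) ` U \<rho>\<^sub>0) (\<psi> t \<bullet> (B t *v ub t))"
  proof (eventually_elim, intro impI)
    fix t assume t: "t \<notin> N" "t \<in> {0..<tb} \<longrightarrow> is_maximum ((\<lambda>u. \<psi> t \<bullet> (B' t *v u)) ` U \<rho>\<^sub>0) (\<psi> t \<bullet> (B' t *v ub t))"
      "t \<in> {0..<tb}"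
    then have "B' t = B t" by (simp add: N_def)
    with t(2,3) show "is_maximum ((\<lambda>u. \<psi> t \<bullet> (B t *v u)) ` U \<rho>\<^sub>0) (\<psi> t \<bullet> (B t *v ub t))" by simp
  qed
  then have "AE t in lebesgue_on {0..<tb}. is_maximum ((\<lambda>u. \<psi> t \<bullet> (B t *v u)) ` U \<rho>\<^sub>0) (\<psi> t \<bullet> (B t *v ub t))"
    by (subst AE_restrict_space_iff) simp_all
  with lim \<psi> show ?thesis by (intro exI[of _ y2_end] exI[of _ \<psi>] conjI)
qed

end
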